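(* Let $T>0$, let $u_0,b_0\in L^2(\mathbb{T}^2;\mathbb{R}^2)$ be divergence-free, and suppose that $u,b\in C_w([0,T);L^2(\mathbb{T}^2;\mathbb{R}^2))$ satisfy, in the sense of distributions, $$\partial_tb+\operatorname{div}(b\otimes u-u\otimes b)=0,\qquad \operatorname{div}u=\operatorname{div}b=0,\qquad u(\cdot,0)=u_0,\ b(\cdot,0)=b_0,$$ and $\int_{\mathbb{T}^2}u(x,t)\,dx=\int_{\mathbb{T}^2}b(x,t)\,dx=0$ for almost every $t\in[0,T)$. Then either $b\equiv0$ or there exists $C>0$ such that $\int_{\mathbb{T}^2}|b(x,t)|^2\,dx\ge C$ for every $t\in[0,T)$.
   Context: $\mathbb{T}^2=[0,1]^2$ is the flat torus; $(v\otimes w)_{ij}=v_iw_j$; $(\operatorname{div}M)_i=\sum_j\partial_jM_{ij}$. $v\in C_w([0,T);L^2(\mathbb{T}^2;\mathbb{R}^2))$ means that $v\in L^\infty_tL^2_x(\mathbb{T}^2\times[0,T);\mathbb{R}^2)$ and that $t_j\to t$ implies $v(\cdot,t_j)\rightharpoonup v(\cdot,t)$ weakly in $L^2$ for every $t\in[0,T)$. The evolution equation with initial data means: $\int_0^T\!\int_{\mathbb{T}^2}[b\cdot\partial_t\varphi+(b\otimes u-u\otimes b):D\varphi]+\int_{\mathbb{T}^2}b_0\cdot\varphi(\cdot,0)=0$ for all $\varphi\in C_c^\infty(\mathbb{T}^2\times[0,T);\mathbb{R}^2)$; the condition $u(\cdot,0)=u_0$ holds in the sense of the weakly continuous representative.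 *)

theory Defs
  imports "HOL-Analysis.Analysis"
begin

section \<open>The flat torus and square-integrable vector fields\<close>

text \<open>
  The torus is represented by its fundamental domain, the unit square, with Lebesgue measure.
  A vector field on the torus is a function on the plane of which only the values on the square
  matter, and which is considered up to null sets. That opposite sides of the square are identified
  is encoded in the periodicity of the test functions.
\<close>

definition torus :: "(real ^ 2) set" where
  "torus = cbox 0 1"

definition L2_torus :: "(real ^ 2 \<Rightarrow> real ^ 2) set" where
  "L2_torus = {f \<in> borel_measurable (lebesgue_on torus).
     integrable (lebesgue_on torus) (\<lambda>x. (norm (f x))\<^sup>2)}"

definition weakly_converges_L2 :: "(nat \<Rightarrow> real ^ 2 \<Rightarrow> real ^ 2) \<Rightarrow> (real ^ 2 \<Rightarrow> real ^ 2) \<Rightarrow> bool" where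
  "weakly_converges_L2 f g \<longleftrightarrow>
     (\<forall>h\<in>L2_torus. (\<lambda>n. LINT x|lebesgue_on torus. f n x \<bullet> h x)
        \<longlonglongrightarrow> (LINT x|lebesgue_on torus. g x \<bullet> h x))"

text \<open>
  A time-dependent field is a function of \<open>(x, t)\<close>. In the following definition every time slice
  is the value of the weakly continuous representative.
\<close>

definition Cw_L2 :: "real \<Rightarrow> ((real ^ 2) \<times> real \<Rightarrow> real ^ 2) set" where
  "Cw_L2 T = {v.
     v \<in> borel_measurable (lebesgue_on (torus \<times> {0..<T})) \<and>
     (\<exists>M. AE t in lebesgue_on {0..<T}. (LINT x|lebesgue_on torus. (norm (v (x, t)))\<^sup>2) \<le> M) \<and>
     (\<forall>t\<in>{0..<T}. (\<lambda>x. v (x, t)) \<in> L2_torus) \<and>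
     (\<forall>t\<in>{0..<T}. \<forall>s. (\<forall>n. s n \<in> {0..<T}) \<longrightarrow> s \<longlonglongrightarrow> t \<longrightarrow>
        weakly_converges_L2 (\<lambda>n x. v (x, s n)) (\<lambda>x. v (x, t)))}"

section \<open>Smooth functions and test functions\<close>

primrec times_cont_diff :: "nat \<Rightarrow> ('a::real_normed_vector \<Rightarrow> 'b::real_normed_vector) \<Rightarrow> bool" where
  "times_cont_diff 0 f \<longleftrightarrow> continuous_on UNIV f"
| "times_cont_diff (Suc k) f \<longleftrightarrow> (\<forall>x. f differentiable (at x)) \<and>
     (\<forall>h. times_cont_diff k (\<lambda>x. frechet_derivative f (at x) h))"

definition smooth :: "('a::real_normed_vector \<Rightarrow> 'b::real_normed_vector) \<Rightarrow> bool" where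
  "smooth f \<longleftrightarrow> (\<forall>k. times_cont_diff k f)"

definition torus_test_function :: "(real ^ 2 \<Rightarrow> real) \<Rightarrow> bool" where
  "torus_test_function \<psi> \<longleftrightarrow> smooth \<psi> \<and> (\<forall>x j. \<psi> (x + axis j 1) = \<psi> x)"

text \<open>
  Smooth functions with compact support in the product of the torus and the time interval \<open>I\<close>.
  They are given as restrictions of smooth functions on the whole space-time: for
  \<open>I = {0..<T}\<close> this means smoothness up to and including \<open>t = 0\<close>, where they need not vanish.
  Values for times outside \<open>I\<close> are never used.
\<close>

definition test_function :: "real set \<Rightarrow> ((real ^ 2) \<times> real \<Rightarrow> 'b::real_normed_vector) \<Rightarrow> bool" where
  "test_function I \<phi> \<longleftrightarrow> smooth \<phi> \<and> (\<forall>x t j. \<phi> (x + axis j 1, t) = \<phi> (x, t)) \<and>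
     (\<exists>K. compact K \<and> K \<subseteq> I \<and> (\<forall>x. \<forall>t\<in>I - K. \<phi> (x, t) = 0))"

section \<open>The equations in the sense of distributions\<close>

definition grad :: "(real ^ 2 \<Rightarrow> real) \<Rightarrow> real ^ 2 \<Rightarrow> real ^ 2" where
  "grad f x = (\<chi> j. frechet_derivative f (at x) (axis j 1))"

definition outer :: "real ^ 2 \<Rightarrow> real ^ 2 \<Rightarrow> real ^ 2 ^ 2" where
  "outer v w = (\<chi> i j. v $ i * w $ j)"

definition weakly_div_free :: "(real ^ 2 \<Rightarrow> real ^ 2) \<Rightarrow> bool" where
  "weakly_div_free v \<longleftrightarrow>
     (\<forall>\<psi>. torus_test_function \<psi> \<longrightarrow> (LINT x|lebesgue_on torus. v x \<bullet> grad \<psi> x) = 0)"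

definition spacetime_div_free :: "real \<Rightarrow> ((real ^ 2) \<times> real \<Rightarrow> real ^ 2) \<Rightarrow> bool" where
  "spacetime_div_free T v \<longleftrightarrow>
     (\<forall>\<psi>. test_function {0<..<T} \<psi> \<longrightarrow>
        (LINT t|lebesgue_on {0<..<T}. LINT x|lebesgue_on torus.
           v (x, t) \<bullet> grad (\<lambda>y. \<psi> (y, t)) x) = 0)"

text \<open>
  The weak form of \<open>\<partial>\<^sub>t b + div (b \<otimes> u - u \<otimes> b) = 0\<close> with initial datum \<open>b\<^sub>0\<close>.
  The inner product of matrices is the Frobenius product, and the \<open>(i, j)\<close> entry of the spatial
  Jacobian is the derivative of the \<open>i\<close>-th component in the \<open>j\<close>-th direction.
\<close>

definition weak_induction_equation ::
  "real \<Rightarrow> (real ^ 2 \<Rightarrow> real ^ 2) \<Rightarrow> ((real ^ 2) \<times> real \<Rightarrow> real ^ 2) \<Rightarrow>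
   ((real ^ 2) \<times> real \<Rightarrow> real ^ 2) \<Rightarrow> bool" where
  "weak_induction_equation T b0 u b \<longleftrightarrow>
     (\<forall>\<phi> :: (real ^ 2) \<times> real \<Rightarrow> real ^ 2. test_function {0..<T} \<phi> \<longrightarrow>
        (LINT t|lebesgue_on {0..<T}. LINT x|lebesgue_on torus.
           b (x, t) \<bullet> vector_derivative (\<lambda>s. \<phi> (x, s)) (at t) +
           (outer (b (x, t)) (u (x, t)) - outer (u (x, t)) (b (x, t)))
             \<bullet> jacobian (\<lambda>y. \<phi> (y, t)) (at x)) +
        (LINT x|lebesgue_on torus. b0 x \<bullet> \<phi> (x, 0)) = 0)"

end

theory Submission
  imports Defs
begin

text \<open>
  In two dimensions \<open>b\<close> is the rotated gradient of a magnetic potential \<open>a\<close> that is transported: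
  \<open>\<partial>\<^sub>t a + u \<cdot> \<nabla>a = 0\<close>. Since \<open>a\<close> has a square-integrable gradient, \<open>\<beta>(a)\<close> for a smooth bounded
  \<open>\<beta>\<close> is an admissible test function in \<open>div u = 0\<close>, and so the integral of \<open>\<beta>(a)\<close> is conserved.
  With \<open>\<beta> = 1 - cos\<close> this integral is at most half the squared \<open>L\<^sup>2\<close> norm of \<open>a\<close>, hence at most
  the magnetic energy (Poincare); so if the energy comes arbitrarily close to \<open>0\<close>, the
  conserved quantity is \<open>0\<close>, which forces \<open>b = 0\<close> at every time.

  The potential itself is never constructed. All estimates are made on the smooth potentials
  \<open>a\<^sub>n\<close> of the mollified fields \<open>K\<^sub>n * b\<close>, for trigonometric kernels \<open>K\<^sub>n\<close>, where the conservation
  law holds up to an error that tends to \<open>0\<close> because \<open>K\<^sub>n * (b \<times> u) - (K\<^sub>n * b) \<times> u\<close> tends to \<open>0\<close>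
  in \<open>L\<^sup>1\<close>.
\<close>


subsection \<open>Closure properties of smooth functions\<close>

text \<open>The natural invariant, the integral of a^2, is out of reach: u and grad a are only
  square-integrable, and a planar function with square-integrable gradient need not be bounded, so a
  (u \<cdot> grad a) may fail to be integrable. A bounded derivative of \<beta> cures this, because
  u \<cdot> grad a itself is integrable. Yet \<beta> must still detect b. For \<beta> = 1 - cos, the
  squares of \<beta> and of its derivative are at most 2 \<beta>, so a vanishing integral of
  \<beta>(a) makes grad a vanish weakly, although \<beta> has zeros other than 0.

  The trigonometric kernels have periodic primitives in closed form. Hence the potential of the
  mollified field is an explicit convolution, and its bounds are uniform in n.

  In time, pairings with the flux b \<times> u are only bounded and measurable. For fixed n the
  mollified potential is Lipschitz in time, and the chain rule is replaced by increments whose error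
  is quadratic in the step. Only then does n tend to infinity, at each time separately.\<close>

lemma times_cont_diff_SucI:
  assumes "\<And>x. (f has_derivative f' x) (at x)" and "\<And>h. times_cont_diff k (\<lambda>x. f' x h)"
  shows "times_cont_diff (Suc k) f"
proof -
  have "frechet_derivative f (at x) = f' x" for x
    using assms(1) frechet_derivative_at by metis
  then show ?thesis using assms by (auto simp: differentiable_def)
qed

lemma times_cont_diff_SucD:
  assumes "times_cont_diff (Suc k) f"
  shows "(f has_derivative frechet_derivative f (at x)) (at x)"
    and "times_cont_diff k (\<lambda>x. frechet_derivative f (at x) h)"
  using assms by (auto simp: frechet_derivative_works)

lemma times_cont_diff_mono: "times_cont_diff (Suc k) f \<Longrightarrow> times_cont_diff k f"
proof (induction k arbitrary: f)
  case 0
  then show ?case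
    by (auto simp: continuous_on_eq_continuous_at intro: differentiable_imp_continuous_within)
next
  case (Suc k)
  show ?case
    by (rule times_cont_diff_SucI[OF times_cont_diff_SucD(1)[OF Suc.prems]])
      (rule Suc.IH, rule times_cont_diff_SucD(2)[OF Suc.prems])
qed

lemma times_cont_diff_const: "times_cont_diff k (\<lambda>x. c)"
proof (induction k arbitrary: c)
  case (Suc k)
  show ?case by (rule times_cont_diff_SucI[where f'="\<lambda>x h. 0"]) (auto simp: Suc)
qed auto

lemma times_cont_diff_bounded_linear:
  assumes "bounded_linear f" shows "times_cont_diff k f"
proof (cases k)
  case 0
  then show ?thesis using assms by (simp add: linear_continuous_on)
next
  case (Suc m)
  show ?thesis unfolding Suc
    by (rule times_cont_diff_SucI[where f'="\<lambda>x. f"])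
      (auto intro: times_cont_diff_const bounded_linear_imp_has_derivative assms)
qed

lemma times_cont_diff_add:
  "times_cont_diff k f \<Longrightarrow> times_cont_diff k g \<Longrightarrow> times_cont_diff k (\<lambda>x. f x + g x)"
proof (induction k arbitrary: f g)
  case 0
  then show ?case by (auto intro: continuous_intros)
next
  case (Suc k)
  show ?case
    by (rule times_cont_diff_SucI[OF has_derivative_add[OF times_cont_diff_SucD(1)[OF Suc.prems(1)]
          times_cont_diff_SucD(1)[OF Suc.prems(2)]]])
      (rule Suc.IH; rule times_cont_diff_SucD(2); rule Suc.prems)
qed

text \<open>By the product rule the derivative is a sum of two terms of the same kind, in each of
  which one factor has lost an order; the other is weakened by \<open>times_cont_diff_mono\<close>
  before the induction hypothesis applies. A general bilinear map covers products and scalar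
  multiples at once.\<close>

lemma times_cont_diff_bilinear:
  assumes "bounded_bilinear B"
  shows "times_cont_diff k f \<Longrightarrow> times_cont_diff k g \<Longrightarrow> times_cont_diff k (\<lambda>x. B (f x) (g x))"
proof (induction k arbitrary: f g)
  case 0
  then show ?case using bounded_bilinear.continuous_on[OF assms] by auto
next
  case (Suc k)
  note mono = Suc.prems[THEN times_cont_diff_mono]
  show ?case
    by (rule times_cont_diff_SucI[OF bounded_bilinear.FDERIV[OF assms
          times_cont_diff_SucD(1)[OF Suc.prems(1)] times_cont_diff_SucD(1)[OF Suc.prems(2)]]])
      (intro times_cont_diff_add Suc.IH mono times_cont_diff_SucD(2)[OF Suc.prems(1)]
        times_cont_diff_SucD(2)[OF Suc.prems(2)])
qed

lemma times_cont_diff_affine: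
  assumes "bounded_linear L"
  shows "times_cont_diff k f \<Longrightarrow> times_cont_diff k (\<lambda>x. f (L x + c))"
proof (induction k arbitrary: f)
  case 0
  then have "continuous_on UNIV f" by simp
  then have "continuous_on UNIV (\<lambda>x. f (L x + c))"
    by (rule continuous_on_compose2) (auto intro!: continuous_on_add linear_continuous_on[OF assms] continuous_on_const)
  then show ?case by simp
next
  case (Suc k)
  have "((\<lambda>x. f (L x + c)) has_derivative (\<lambda>h. frechet_derivative f (at (L x + c)) (L h))) (at x)" for x
    by (rule has_derivative_compose[OF has_derivative_add_const[OF
          bounded_linear_imp_has_derivative[OF assms]] times_cont_diff_SucD(1)[OF Suc.prems]])
  then show ?case
    by (rule times_cont_diff_SucI) (rule Suc.IH, rule times_cont_diff_SucD(2)[OF Suc.prems])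
qed

text \<open>A joint induction, since the derivative of either function contains the other.\<close>

lemma times_cont_diff_sin_cos:
  fixes f :: "'a::real_normed_vector \<Rightarrow> real"
  assumes "times_cont_diff k f"
  shows "times_cont_diff k (\<lambda>x. sin (f x)) \<and> times_cont_diff k (\<lambda>x. cos (f x))"
  using assms
proof (induction k)
  case 0
  then show ?case by (auto intro: continuous_intros)
next
  case (Suc k)
  note d = times_cont_diff_SucD[OF Suc.prems]
  note IH = Suc.IH[OF times_cont_diff_mono[OF Suc.prems]]
  have "times_cont_diff (Suc k) (\<lambda>x. sin (f x))"
    by (rule times_cont_diff_SucI[OF has_derivative_sin[OF d(1)]])
      (use IH d(2) in \<open>auto intro!: times_cont_diff_bilinear[OF bounded_bilinear_mult]\<close>)
  moreover have "times_cont_diff k (\<lambda>x. - sin (f x))"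
    using times_cont_diff_bilinear[OF bounded_bilinear_mult times_cont_diff_const[of k "-1"]
        conjunct1[OF IH]] by simp
  then have "times_cont_diff (Suc k) (\<lambda>x. cos (f x))"
    by (intro times_cont_diff_SucI[OF has_derivative_cos[OF d(1)]]
        times_cont_diff_bilinear[OF bounded_bilinear_mult] d(2))
  ultimately show ?case by blast
qed

named_theorems smooth_intros

lemma smooth_const [smooth_intros]: "smooth (\<lambda>x. c)"
  by (simp add: smooth_def times_cont_diff_const)

lemma smooth_bounded_linear: "bounded_linear f \<Longrightarrow> smooth f"
  by (simp add: smooth_def times_cont_diff_bounded_linear)

lemma smooth_add [smooth_intros]: "smooth f \<Longrightarrow> smooth g \<Longrightarrow> smooth (\<lambda>x. f x + g x)"
  by (simp add: smooth_def times_cont_diff_add)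

lemma smooth_mult [smooth_intros]:
  fixes f g :: "'a::real_normed_vector \<Rightarrow> real"
  shows "smooth f \<Longrightarrow> smooth g \<Longrightarrow> smooth (\<lambda>x. f x * g x)"
  by (simp add: smooth_def times_cont_diff_bilinear[OF bounded_bilinear_mult])

lemma smooth_scaleR [smooth_intros]:
  "smooth f \<Longrightarrow> smooth g \<Longrightarrow> smooth (\<lambda>x. f x *\<^sub>R g x)"
  by (simp add: smooth_def times_cont_diff_bilinear[OF bounded_bilinear_scaleR])

lemma smooth_minus [smooth_intros]:
  fixes f :: "'a::real_normed_vector \<Rightarrow> real"
  shows "smooth f \<Longrightarrow> smooth (\<lambda>x. - f x)"
  using smooth_mult[OF smooth_const[of "-1"]] by simp

lemma smooth_diff [smooth_intros]:
  fixes f :: "'a::real_normed_vector \<Rightarrow> real"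
  shows "smooth f \<Longrightarrow> smooth g \<Longrightarrow> smooth (\<lambda>x. f x - g x)"
  using smooth_add[OF _ smooth_minus] by force

lemma smooth_power [smooth_intros]:
  fixes f :: "'a::real_normed_vector \<Rightarrow> real"
  shows "smooth f \<Longrightarrow> smooth (\<lambda>x. f x ^ n)"
  by (induction n) (auto intro: smooth_intros)

lemma smooth_affine: "bounded_linear L \<Longrightarrow> smooth f \<Longrightarrow> smooth (\<lambda>x. f (L x + c))"
  by (simp add: smooth_def times_cont_diff_affine)

lemma smooth_sin [smooth_intros]:
  fixes f :: "'a::real_normed_vector \<Rightarrow> real"
  shows "smooth f \<Longrightarrow> smooth (\<lambda>x. sin (f x))"
  by (simp add: smooth_def times_cont_diff_sin_cos)

lemma smooth_cos [smooth_intros]: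
  fixes f :: "'a::real_normed_vector \<Rightarrow> real"
  shows "smooth f \<Longrightarrow> smooth (\<lambda>x. cos (f x))"
  by (simp add: smooth_def times_cont_diff_sin_cos)

lemma smooth_has_derivative:
  "smooth f \<Longrightarrow> (f has_derivative frechet_derivative f (at x)) (at x)"
  unfolding smooth_def using times_cont_diff_SucD(1) by blast

lemma smooth_frechet_derivative:
  "smooth f \<Longrightarrow> smooth (\<lambda>x. frechet_derivative f (at x) h)"
  unfolding smooth_def using times_cont_diff_SucD(2) by blast

lemma smooth_continuous_on: "smooth f \<Longrightarrow> continuous_on S f"
  unfolding smooth_def
  using times_cont_diff.simps(1) continuous_on_subset subset_UNIV by metis

subsection \<open>Periodic smooth functions\<close>

lemma periodic_shift:
  fixes H :: "real ^ 2 \<Rightarrow> 'b"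
  assumes "\<And>x j. H (x + axis j 1) = H x"
  shows "H (x + (\<chi> i. of_int (k i))) = H x"
proof -
  have nat: "H (x + axis j (real m)) = H x" for x j m
  proof (induction m)
    case (Suc m)
    have "x + axis j (real (Suc m)) = (x + axis j (real m)) + axis j 1"
      by (simp add: vec_eq_iff axis_def)
    then show ?case using assms Suc by metis
  qed (simp add: axis_def vec_eq_iff zero_vec_def[symmetric])
  have int: "H (x + axis j (of_int m)) = H x" for x j m
  proof (cases "m \<ge> 0")
    case True
    then show ?thesis using nat[of x j "nat m"] by simp
  next
    case False
    have "x + axis j (of_int m) + axis j (real (nat (- m))) = x"
      using False by (simp add: vec_eq_iff axis_def)
    then show ?thesis using nat[of "x + axis j (of_int m)" j "nat (-m)"] by metis
  qed
  have "x + (\<chi> i. of_int (k i)) = x + axis 1 (of_int (k 1)) + axis 2 (of_int (k 2))"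
    by (simp add: vec_eq_iff axis_def forall_2)
  then show ?thesis using int by metis
qed

lemma periodic_representative:
  fixes H :: "real ^ 2 \<Rightarrow> 'b"
  assumes "\<And>x j. H (x + axis j 1) = H x"
  obtains y where "y \<in> torus" "H y = H x"
proof
  let ?y = "x + (\<chi> i. of_int (- \<lfloor>x $ i\<rfloor>))"
  show "?y \<in> torus"
    by (auto simp: torus_def mem_box_cart) linarith+
  show "H ?y = H x" by (rule periodic_shift) (rule assms)
qed

lemma torus_test_function_frechet_derivative:
  assumes "torus_test_function H"
  shows "torus_test_function (\<lambda>z. frechet_derivative H (at z) h)"
  unfolding torus_test_function_def
proof (intro conjI allI)
  have sm: "smooth H" and per: "\<And>x j. H (x + axis j 1) = H x"
    using assms by (auto simp: torus_test_function_def)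
  show "smooth (\<lambda>z. frechet_derivative H (at z) h)"
    using sm by (rule smooth_frechet_derivative)
  fix x and j :: 2
  have "((\<lambda>x. H (x + axis j 1)) has_derivative (\<lambda>h. frechet_derivative H (at (x + axis j 1)) h)) (at x)"
    by (rule has_derivative_compose[OF _ smooth_has_derivative[OF sm]])
      (auto intro!: derivative_eq_intros)
  then have "(H has_derivative (\<lambda>h. frechet_derivative H (at (x + axis j 1)) h)) (at x)"
    by (simp add: per)
  then show "frechet_derivative H (at (x + axis j 1)) h = frechet_derivative H (at x) h"
    using frechet_derivative_at by metis
qed

lemma torus_test_function_bounded:
  assumes "torus_test_function H"
  obtains B where "B > 0" "\<And>z. \<bar>H z\<bar> \<le> B"
proof -
  have "compact (H ` torus)"
    using assms unfolding torus_test_function_def torus_def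
    by (intro compact_continuous_image smooth_continuous_on compact_cbox) auto
  then obtain B where B: "B > 0" "\<And>z. z \<in> torus \<Longrightarrow> \<bar>H z\<bar> \<le> B"
    using compact_imp_bounded bounded_pos by (metis imageI real_norm_def)
  have "\<bar>H z\<bar> \<le> B" for z
    using periodic_representative[of H z] B assms by (metis torus_test_function_def)
  then show ?thesis using B that by blast
qed

lemma torus_test_function_continuous_on: "torus_test_function H \<Longrightarrow> continuous_on S H"
  by (simp add: torus_test_function_def smooth_continuous_on)

lemma torus_test_function_has_derivative:
  "torus_test_function H \<Longrightarrow> (H has_derivative frechet_derivative H (at x)) (at x)"
  by (simp add: torus_test_function_def smooth_has_derivative)

text \<open>Linearity reduces the derivative to its two partial derivatives. These are again
  periodic and smooth, hence bounded by compactness of the square, which makes the bound uniform in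
  the point.\<close>

lemma torus_test_function_frechet_bounded:
  assumes "torus_test_function H"
  obtains B where "B > 0" "\<And>z h. \<bar>frechet_derivative H (at z) h\<bar> \<le> B * norm h"
proof -
  let ?D = "\<lambda>j z. frechet_derivative H (at z) (axis j 1)"
  obtain B1 where B1: "B1 > 0" "\<And>z. \<bar>?D 1 z\<bar> \<le> B1"
    using torus_test_function_bounded[OF torus_test_function_frechet_derivative[OF assms]] by blast
  obtain B2 where B2: "B2 > 0" "\<And>z. \<bar>?D 2 z\<bar> \<le> B2"
    using torus_test_function_bounded[OF torus_test_function_frechet_derivative[OF assms]] by blast
  have "\<bar>frechet_derivative H (at z) h\<bar> \<le> (B1 + B2) * norm h" for z h
  proof -
    have h: "h = (h $ 1) *\<^sub>R axis 1 1 + (h $ 2) *\<^sub>R axis 2 1"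
      by (simp add: vec_eq_iff axis_def forall_2)
    interpret bounded_linear "frechet_derivative H (at z)"
      using torus_test_function_has_derivative[OF assms] has_derivative_bounded_linear by blast
    have "frechet_derivative H (at z) h = h $ 1 * ?D 1 z + h $ 2 * ?D 2 z"
      by (subst h) (simp add: add scaleR)
    also have "\<bar>\<dots>\<bar> \<le> \<bar>h $ 1\<bar> * \<bar>?D 1 z\<bar> + \<bar>h $ 2\<bar> * \<bar>?D 2 z\<bar>"
      using abs_triangle_ineq[of "h $ 1 * ?D 1 z" "h $ 2 * ?D 2 z"] by (simp add: abs_mult)
    also have "\<dots> \<le> norm h * B1 + norm h * B2"
      by (intro add_mono mult_mono component_le_norm_cart B1 B2) auto
    finally show ?thesis by (simp add: algebra_simps)
  qed
  then show ?thesis using that[of "B1 + B2"] B1 B2 by auto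
qed

lemma torus_test_function_lipschitz:
  assumes "torus_test_function H"
  obtains B where "B > 0" "\<And>x y. \<bar>H x - H y\<bar> \<le> B * norm (x - y)"
proof -
  obtain B where B: "B > 0" "\<And>z h. \<bar>frechet_derivative H (at z) h\<bar> \<le> B * norm h"
    using torus_test_function_frechet_bounded[OF assms] by blast
  have "norm (H x - H y) \<le> B * norm (x - y)" for x y
    by (rule differentiable_bound[OF convex_UNIV
          has_derivative_at_withinI[OF torus_test_function_has_derivative[OF assms]]])
      (auto intro!: onorm_le B(2))
  then show ?thesis using B that by simp
qed

lemma torus_test_function_const: "torus_test_function (\<lambda>x. c)"
  by (auto simp: torus_test_function_def intro: smooth_intros)

lemma torus_test_function_diff:
  "torus_test_function f \<Longrightarrow> torus_test_function g \<Longrightarrow> torus_test_function (\<lambda>x. f x - g x)"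
  by (auto simp: torus_test_function_def intro: smooth_intros)

lemma torus_test_function_minus:
  "torus_test_function f \<Longrightarrow> torus_test_function (\<lambda>x. - f x)"
  by (auto simp: torus_test_function_def intro: smooth_intros)

lemma torus_test_function_mult:
  "torus_test_function f \<Longrightarrow> torus_test_function g \<Longrightarrow> torus_test_function (\<lambda>x. f x * g x)"
  by (auto simp: torus_test_function_def intro: smooth_intros)

lemma torus_test_function_sin:
  "torus_test_function f \<Longrightarrow> torus_test_function (\<lambda>x. sin (f x))"
  by (auto simp: torus_test_function_def intro: smooth_intros)

lemma torus_test_function_cos:
  "torus_test_function f \<Longrightarrow> torus_test_function (\<lambda>x. cos (f x))"
  by (auto simp: torus_test_function_def intro: smooth_intros)

lemma torus_test_function_shift:
  "torus_test_function f \<Longrightarrow> torus_test_function (\<lambda>x. f (x - c))"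
proof -
  assume f: "torus_test_function f"
  have "smooth (\<lambda>x. f (x + - c))"
    using f by (intro smooth_affine[OF bounded_linear_ident]) (auto simp: torus_test_function_def)
  moreover have "f (x + axis j 1 - c) = f (x - c)" for x j
    using f by (metis add_diff_eq diff_add_eq torus_test_function_def)
  ultimately show ?thesis by (auto simp: torus_test_function_def)
qed

lemma torus_test_function_reflect:
  "torus_test_function f \<Longrightarrow> torus_test_function (\<lambda>x. f (c - x))"
proof -
  assume f: "torus_test_function f"
  have "smooth (\<lambda>x. f (- x + c))"
    using f by (intro smooth_affine[OF bounded_linear_minus[OF bounded_linear_ident]])
      (auto simp: torus_test_function_def)
  moreover have "f (c - (x + axis j 1)) = f (c - x)" for x j
    using f by (metis diff_add_cancel diff_diff_eq torus_test_function_def)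
  ultimately show ?thesis by (auto simp: torus_test_function_def)
qed

lemma torus_test_function_coordinate:
  fixes g :: "real \<Rightarrow> real"
  assumes "smooth g" "\<And>s. g (s + 1) = g s"
  shows "torus_test_function (\<lambda>x. g (x $ j))"
proof -
  have "smooth (\<lambda>x::real^2. g (x $ j + 0))"
    by (rule smooth_affine[OF bounded_linear_vec_nth assms(1)])
  moreover have "g ((x + axis i 1) $ j) = g (x $ j)" for x :: "real^2" and i
    using assms(2) by (cases "i = j") (auto simp: axis_def)
  ultimately show ?thesis by (simp add: torus_test_function_def)
qed

subsection \<open>A smooth function vanishing on a half line\<close>

text \<open>The denominator \<open>s ^ m\<close> makes the family closed under differentiation up to
  linear combinations, so that smoothness of all members follows from one induction. The member for
  \<open>m = 0\<close> is the classical smooth function that is flat at the origin.\<close>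

definition flat_exp :: "nat \<Rightarrow> real \<Rightarrow> real" where
  "flat_exp m s = (if s > 0 then exp (- 1 / s) / s ^ m else 0)"

lemma power_over_fact_le_exp:
  fixes x :: real
  assumes "x \<ge> 0" shows "x ^ k / fact k \<le> exp x"
proof -
  have "(\<Sum>n\<in>{k}. x ^ n /\<^sub>R fact n) \<le> exp x"
    using assms exp_converges[of x]
    by (subst sums_unique[OF exp_converges[of x]], intro sum_le_suminf) (auto dest: sums_summable)
  then show ?thesis by (simp add: divide_inverse mult.commute)
qed

text \<open>Compares \<open>exp (1 / s)\<close> with the term of order \<open>m + 2\<close> of its
  power series. Two powers of \<open>s\<close> survive the division by \<open>s ^ m\<close>, and a
  quadratic bound is what differentiability at the origin with derivative 0 requires.\<close>

lemma flat_exp_bound: "\<bar>flat_exp m s\<bar> \<le> fact (m + 2) * s\<^sup>2"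
proof (cases "s > 0")
  case True
  define F :: real where "F = fact (m + 2)"
  have F: "F > 0" by (simp add: F_def)
  have "(1 / s) ^ (m + 2) / F \<le> exp (1 / s)"
    unfolding F_def using True by (intro power_over_fact_le_exp) auto
  then have "1 \<le> exp (1 / s) * F * s ^ (m + 2)"
    using True F by (simp add: power_one_over divide_simps mult_ac)
  then have "exp (- (1 / s)) \<le> F * s ^ (m + 2)"
    by (simp add: exp_minus divide_simps mult_ac)
  then have "exp (- (1 / s)) / s ^ m \<le> F * s\<^sup>2"
    using True by (simp add: divide_simps power_add power2_eq_square mult_ac)
  then show ?thesis
    using True by (simp add: flat_exp_def F_def)
qed (simp add: flat_exp_def)

lemma flat_exp_has_derivative:
  "(flat_exp m has_real_derivative flat_exp (m + 2) s - m * flat_exp (m + 1) s) (at s)"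
proof -
  consider "s < 0" | "s = 0" | "s > 0" by linarith
  then show ?thesis
  proof cases
    case 1
    have "((\<lambda>s. 0) has_real_derivative 0) (at s)" by simp
    then have "(flat_exp m has_real_derivative 0) (at s)"
      by (rule has_field_derivative_transform_within_open[where S="{..<0}"])
        (use 1 in \<open>auto simp: flat_exp_def\<close>)
    then show ?thesis using 1 by (simp add: flat_exp_def)
  next
    case 2
    have "((\<lambda>h. (flat_exp m (0 + h) - flat_exp m 0) / h) \<longlongrightarrow> 0) (at 0)"
    proof (rule Lim_null_comparison)
      show "\<forall>\<^sub>F h in at 0. norm ((flat_exp m (0 + h) - flat_exp m 0) / h) \<le> fact (m + 2) * \<bar>h\<bar>"
      proof (rule eventually_at_ball'[THEN eventually_mono, of 1])
        fix h :: real assume "h \<in> ball 0 1 \<and> h \<noteq> 0 \<and> h \<in> UNIV"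
        then show "norm ((flat_exp m (0 + h) - flat_exp m 0) / h) \<le> fact (m + 2) * \<bar>h\<bar>"
          using flat_exp_bound[of m h] flat_exp_def[of m 0]
          by (simp add: pos_divide_le_eq power2_eq_square abs_mult[symmetric] mult.assoc del: fact_Suc)
      qed simp
      show "((\<lambda>h. fact (m + 2) * \<bar>h\<bar>) \<longlongrightarrow> 0) (at (0::real))"
        by (rule tendsto_eq_intros | simp)+
    qed
    then show ?thesis using 2 by (simp add: DERIV_def flat_exp_def)
  next
    case 3
    have 0: "((\<lambda>s. exp (- 1 / s)) has_real_derivative exp (- 1 / s) / s\<^sup>2) (at s)"
      using 3 by (auto intro!: derivative_eq_intros simp: power2_eq_square)
    have "((\<lambda>s. exp (- 1 / s) / s ^ m) has_real_derivative
        (exp (- 1 / s) / s\<^sup>2 * s ^ m - exp (- 1 / s) * (m * s ^ (m - Suc 0))) / (s ^ m * s ^ m)) (at s)"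
      using 3 by (intro DERIV_divide[OF 0 DERIV_pow]) auto
    moreover have "(E / s\<^sup>2 * s ^ m - E * (m * s ^ (m - Suc 0))) / (s ^ m * s ^ m)
        = E / s ^ (m + 2) - m * (E / s ^ (m + 1))" for E
      using 3 by (cases m) (auto simp: field_simps power2_eq_square)
    ultimately have "((\<lambda>s. exp (- 1 / s) / s ^ m) has_real_derivative
        flat_exp (m + 2) s - m * flat_exp (m + 1) s) (at s)"
      using 3 by (simp only: flat_exp_def if_True)
    then show ?thesis
      by (rule has_field_derivative_transform_within_open[where S="{0<..}"])
        (use 3 in \<open>auto simp: flat_exp_def\<close>)
  qed
qed

lemma smooth_flat_exp: "smooth (flat_exp m)"
proof -
  have "times_cont_diff k (flat_exp m)" for k
  proof (induction k arbitrary: m)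
    case 0
    show ?case
      using DERIV_continuous[OF flat_exp_has_derivative]
      by (simp add: continuous_on_eq_continuous_at)
  next
    case (Suc k)
    have 1: "times_cont_diff k (\<lambda>s. flat_exp (m + 2) s + (- real m) * flat_exp (m + 1) s)"
      by (intro times_cont_diff_add times_cont_diff_bilinear[OF bounded_bilinear_mult]
          times_cont_diff_const Suc)
    have "times_cont_diff k (\<lambda>s. (flat_exp (m + 2) s - m * flat_exp (m + 1) s) * h)" for h
      using times_cont_diff_bilinear[OF bounded_bilinear_mult 1 times_cont_diff_const[of k h]] by simp
    then show ?case
      by (rule times_cont_diff_SucI[OF flat_exp_has_derivative[THEN has_field_derivative_imp_has_derivative]])
  qed
  then show ?thesis by (simp add: smooth_def)
qed


subsection \<open>Integration over the torus\<close>

abbreviation torus_measure :: "(real ^ 2) measure" (\<open>\<mu>\<close>)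
  where "\<mu> \<equiv> lebesgue_on torus"

lemma torus_lmeasurable: "torus \<in> lmeasurable"
  by (simp add: torus_def)

lemma torus_sets_lebesgue [simp]: "torus \<in> sets lebesgue"
  by (simp add: torus_def)

interpretation torus: finite_measure \<mu>
  by (rule finite_measure_lebesgue_on[OF torus_lmeasurable])

interpretation torus_pair: pair_sigma_finite \<mu> \<mu> ..

lemma measure_torus [simp]: "measure \<mu> torus = 1"
  by (simp add: measure_restrict_space torus_def content_cbox_if_cart interval_eq_empty_cart)

lemma torus_integral_const: "(LINT x|\<mu>. c) = (c::real)"
  by simp

lemma borel_imp_torus_measurable: "f \<in> borel_measurable borel \<Longrightarrow> f \<in> borel_measurable \<mu>"
  by (intro measurable_restrict_space1 measurable_completion) simp

lemma torus_ident_measurable [measurable]: "(\<lambda>x. x) \<in> \<mu> \<rightarrow>\<^sub>M borel"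
  by (intro borel_imp_torus_measurable) simp

lemma torus_prod_ident_measurable: "(\<lambda>p. p) \<in> \<mu> \<Otimes>\<^sub>M \<mu> \<rightarrow>\<^sub>M borel"
proof -
  have "(\<lambda>p. (fst p, snd p)) \<in> \<mu> \<Otimes>\<^sub>M \<mu> \<rightarrow>\<^sub>M borel \<Otimes>\<^sub>M borel"
    by (intro measurable_Pair measurable_compose[OF measurable_fst torus_ident_measurable]
        measurable_compose[OF measurable_snd torus_ident_measurable])
  then show ?thesis by (simp add: borel_prod)
qed

lemma continuous_torus_measurable:
  "continuous_on UNIV f \<Longrightarrow> f \<in> borel_measurable \<mu>"
  by (intro borel_imp_torus_measurable borel_measurable_continuous_onI)

lemma continuous_torus_prod_measurable:
  "continuous_on UNIV f \<Longrightarrow> f \<in> borel_measurable (\<mu> \<Otimes>\<^sub>M \<mu>)"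
  by (rule measurable_compose[OF torus_prod_ident_measurable borel_measurable_continuous_onI])

lemma torus_prod_fst_measurable:
  "f \<in> borel_measurable \<mu> \<Longrightarrow> (\<lambda>p. f (fst p)) \<in> borel_measurable (\<mu> \<Otimes>\<^sub>M \<mu>)"
  by (rule measurable_compose[OF measurable_fst])

lemma torus_prod_snd_measurable:
  "f \<in> borel_measurable \<mu> \<Longrightarrow> (\<lambda>p. f (snd p)) \<in> borel_measurable (\<mu> \<Otimes>\<^sub>M \<mu>)"
  by (rule measurable_compose[OF measurable_snd])

lemma integrable_mult_bounded:
  fixes f g :: "'a \<Rightarrow> real"
  assumes "integrable M f" "g \<in> borel_measurable M" "\<And>x. x \<in> space M \<Longrightarrow> \<bar>g x\<bar> \<le> B"
  shows "integrable M (\<lambda>x. f x * g x)"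
proof (rule Bochner_Integration.integrable_bound[where f="\<lambda>x. B * f x"])
  show "AE x in M. norm (f x * g x) \<le> norm (B * f x)"
  proof (rule AE_I2)
    fix x assume "x \<in> space M"
    then have "\<bar>g x\<bar> \<le> \<bar>B\<bar>" using assms(3) by fastforce
    then show "norm (f x * g x) \<le> norm (B * f x)"
      using mult_left_mono[of "\<bar>g x\<bar>" "\<bar>B\<bar>" "\<bar>f x\<bar>"] by (simp add: abs_mult mult.commute)
  qed
qed (use assms in auto)

lemma (in finite_measure) integrable_bounded:
  fixes f :: "'a \<Rightarrow> real"
  assumes "f \<in> borel_measurable M" "\<And>x. x \<in> space M \<Longrightarrow> \<bar>f x\<bar> \<le> B"
  shows "integrable M f"
  by (rule integrable_const_bound[where B=B]) (use assms in auto)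

lemma continuous_torus_integrable:
  fixes f :: "real ^ 2 \<Rightarrow> real"
  assumes "continuous_on UNIV f"
  shows "integrable \<mu> f"
  unfolding torus_def by (rule continuous_imp_integrable) (use assms continuous_on_subset in blast)

text \<open>The coordinate map to pairs carries boxes to boxes of equal content, so
  \<open>has_integral_twiddle\<close> moves the integral to a square in the product of two lines.
  Both orders of iteration are recorded because the fundamental theorem is applied in the inner
  variable.\<close>

lemma torus_integral_iterated:
  fixes f :: "real ^ 2 \<Rightarrow> real"
  assumes "continuous_on UNIV f"
  shows "(LINT x|\<mu>. f x) = integral {0..1} (\<lambda>s. integral {0..1} (\<lambda>t. f (vector [s, t])))"
    and "(LINT x|\<mu>. f x) = integral {0..1} (\<lambda>t. integral {0..1} (\<lambda>s. f (vector [s, t])))"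
proof -
  let ?g = "\<lambda>p :: real \<times> real. vector [fst p, snd p] :: real ^ 2"
  let ?h = "\<lambda>x :: real ^ 2. (x $ 1, x $ 2)"
  have cont_vec: "continuous_on UNIV (\<lambda>p. vector [a p, b p] :: real ^ 2)"
    if "continuous_on UNIV a" "continuous_on UNIV b" for a b :: "'c::topological_space \<Rightarrow> real"
  proof -
    have "(\<lambda>p. vector [a p, b p] :: real ^ 2) = (\<lambda>p. \<chi> i. if i = 1 then a p else b p)"
      by (auto simp: vec_eq_iff forall_2)
    moreover have "continuous_on UNIV (\<lambda>p. if i = 1 then a p else b p)" for i :: 2
      using that by (cases "i = 1") auto
    ultimately show ?thesis by (simp only: continuous_on_vec_lambda)
  qed
  have exists_2: "(\<exists>i::2. P i) \<longleftrightarrow> P 1 \<or> P 2" for P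
    using forall_2[of "\<lambda>i. \<not> P i"] by auto
  have gimg: "?g ` cbox u v = cbox (?g u) (?g v)" for u v
  proof (intro set_eqI iffI)
    fix x assume "x \<in> cbox (?g u) (?g v)"
    then have "?h x \<in> cbox u v" "x = ?g (?h x)"
      by (cases u, cases v, auto simp: mem_box_cart forall_2 vec_eq_iff cbox_Pair_eq)+
    then show "x \<in> ?g ` cbox u v" by blast
  qed (cases u, cases v, auto simp: mem_box_cart forall_2 cbox_Pair_eq)
  have himg: "?h ` cbox u v = cbox (?h u) (?h v)" for u v
  proof (intro set_eqI iffI)
    fix p assume "p \<in> cbox (?h u) (?h v)"
    then have "?g p \<in> cbox u v" "p = ?h (?g p)"
      by (cases p, auto simp: mem_box_cart forall_2 cbox_Pair_eq)+
    then show "p \<in> ?h ` cbox u v" by blast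
  qed (auto simp: mem_box_cart forall_2 cbox_Pair_eq)
  have "(f has_integral (LINT x|\<mu>. f x)) (cbox 0 1)"
    using has_integral_integral_lebesgue_on[OF continuous_torus_integrable[OF assms]]
    by (simp add: torus_def)
  then have "((\<lambda>p. f (?g p)) has_integral (1 / 1) *\<^sub>R (LINT x|\<mu>. f x)) (?h ` cbox 0 1)"
  proof (rule has_integral_twiddle[rotated -1])
    show "continuous (at x) ?g" for x
    proof -
      have "continuous_on UNIV ?g" by (rule cont_vec) (intro continuous_intros)+
      then show ?thesis by (simp add: continuous_on_eq_continuous_at del: split_paired_All)
    qed
    show "measure lborel (?g ` cbox u v) = 1 * measure lborel (cbox u v)" for u v
      by (cases u, cases v, unfold gimg)
        (auto simp: content_cbox_if_cart interval_eq_empty_cart content_Pair UNIV_2 exists_2 content_real_if)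
    show "\<exists>w z. ?g ` cbox u v = cbox w z" for u v using gimg by blast
    show "\<exists>w z. ?h ` cbox u v = cbox w z" for u v using himg by blast
  qed (simp_all add: vec_eq_iff forall_2)
  then have *: "((\<lambda>p. f (?g p)) has_integral (LINT x|\<mu>. f x)) (cbox (0, 0) (1, 1))"
    unfolding himg by simp
  have cont: "continuous_on UNIV (\<lambda>p. f (?g p))"
    by (rule continuous_on_compose2[OF assms cont_vec]) (auto intro: continuous_intros)
  show 1: "(LINT x|\<mu>. f x) = integral {0..1} (\<lambda>s. integral {0..1} (\<lambda>t. f (vector [s, t])))"
    using integral_prod_continuous[OF continuous_on_subset[OF cont subset_UNIV], of 0 0 1 1]
      integral_unique[OF *] by simp
  show "(LINT x|\<mu>. f x) = integral {0..1} (\<lambda>t. integral {0..1} (\<lambda>s. f (vector [s, t])))"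
  proof -
    have "continuous_on (cbox (0,0) (1,1)) (\<lambda>(s, t). f (vector [s, t]))"
      using continuous_on_subset[OF cont subset_UNIV] by (simp add: case_prod_unfold)
    from integral_swap_continuous[OF this] 1 show ?thesis by simp
  qed
qed

lemma torus_integral_product:
  fixes f g :: "real \<Rightarrow> real"
  assumes "continuous_on UNIV f" "continuous_on UNIV g"
  shows "(LINT x|\<mu>. f (x $ 1) * g (x $ 2)) = integral {0..1} f * integral {0..1} g"
proof -
  have "continuous_on UNIV (\<lambda>x::real^2. f (x $ 1) * g (x $ 2))"
    by (intro continuous_on_mult continuous_on_compose2[OF assms(1)]
        continuous_on_compose2[OF assms(2)] continuous_intros) auto
  from torus_integral_iterated(1)[OF this] show ?thesis by simp
qed

text \<open>Integration by parts without boundary terms: integrating first along direction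
  \<open>j\<close>, the fundamental theorem leaves the difference of \<open>F\<close> at the two
  ends of a period.\<close>

lemma torus_integral_derivative_zero:
  assumes F: "torus_test_function F"
  shows "(LINT x|\<mu>. frechet_derivative F (at x) (axis j 1)) = 0"
proof -
  let ?D = "\<lambda>x. frechet_derivative F (at x) (axis j 1)"
  have cont: "continuous_on UNIV ?D"
    by (intro torus_test_function_continuous_on torus_test_function_frechet_derivative F)
  have line: "integral {0..1} (\<lambda>t. ?D (x + t *\<^sub>R axis j 1)) = 0" for x
  proof -
    have "((\<lambda>t. F (x + t *\<^sub>R axis j 1)) has_vector_derivative ?D (x + t *\<^sub>R axis j 1)) (at t within {0..1})" for t
    proof -
      interpret bounded_linear "frechet_derivative F (at (x + t *\<^sub>R axis j 1))"
        using torus_test_function_has_derivative[OF F] has_derivative_bounded_linear by blast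
      have "((\<lambda>t. F (x + t *\<^sub>R axis j 1)) has_derivative
          (\<lambda>h. frechet_derivative F (at (x + t *\<^sub>R axis j 1)) (h *\<^sub>R axis j 1))) (at t within {0..1})"
        by (rule has_derivative_compose[OF _ torus_test_function_has_derivative[OF F]])
          (auto intro!: derivative_eq_intros)
      then show ?thesis by (simp add: has_vector_derivative_def scaleR)
    qed
    then have "((\<lambda>t. ?D (x + t *\<^sub>R axis j 1)) has_integral
        F (x + 1 *\<^sub>R axis j 1) - F (x + 0 *\<^sub>R axis j 1)) {0..1}"
      by (intro fundamental_theorem_of_calculus) auto
    then show ?thesis using F by (simp add: torus_test_function_def integral_unique)
  qed
  consider "j = 1" | "j = 2" using exhaust_2 by blast
  then show ?thesis
  proof cases
    case 1
    have eq: "vector [0, t] + s *\<^sub>R axis j (1::real) = vector [s, t]" for s t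
      using 1 by (auto simp: vec_eq_iff forall_2 axis_def)
    have "integral {0..1} (\<lambda>s. ?D (vector [s, t])) = 0" for t
      using line[of "vector [0, t]"] by (simp only: eq)
    then show ?thesis by (subst torus_integral_iterated(2)[OF cont]) simp
  next
    case 2
    have eq: "vector [s, 0] + t *\<^sub>R axis j (1::real) = vector [s, t]" for s t
      using 2 by (auto simp: vec_eq_iff forall_2 axis_def)
    have "integral {0..1} (\<lambda>t. ?D (vector [s, t])) = 0" for s
      using line[of "vector [s, 0]"] by (simp only: eq)
    then show ?thesis by (subst torus_integral_iterated(1)[OF cont]) simp
  qed
qed

subsection \<open>The de la Vallee-Poussin kernel\<close>

text \<open>Wallis' recursion for the integral of \<open>cos (pi * s) ^ (2 * n)\<close> over one
  period.\<close>

primrec kern_mass :: "nat \<Rightarrow> real" where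
  "kern_mass 0 = 1"
| "kern_mass (Suc n) = (2 * n + 1) / (2 * n + 2) * kern_mass n"

definition kern :: "nat \<Rightarrow> real \<Rightarrow> real" where
  "kern n s = cos (pi * s) ^ (2 * n) / kern_mass n"

text \<open>
  The periodic primitive of \<open>kern n - 1\<close>: the derivative of \<open>cos\<^sup>2\<^sup>n\<^sup>+\<^sup>1 sin\<close> is a combination of
  \<open>cos\<^sup>2\<^sup>n\<^sup>+\<^sup>2\<close> and \<open>cos\<^sup>2\<^sup>n\<close>, hence of \<open>kern (Suc n)\<close> and \<open>kern n\<close>.
\<close>

primrec kern_prim :: "nat \<Rightarrow> real \<Rightarrow> real" where
  "kern_prim 0 s = 0"
| "kern_prim (Suc n) s = kern_prim n s +
     cos (pi * s) ^ (2 * n + 1) * sin (pi * s) / (pi * (2 * n + 2) * kern_mass (Suc n))"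

lemma kern_mass_pos: "kern_mass n > 0"
  by (induction n) auto

lemma kern_nonneg: "kern n s \<ge> 0"
  using kern_mass_pos[of n] by (simp add: kern_def)

lemma kern_even: "kern n (- s) = kern n s"
  by (simp add: kern_def)

lemma kern_even_diff: "kern n (s - t) = kern n (t - s)"
  using kern_even[of n "t - s"] by simp

lemma smooth_ident_real: "smooth (\<lambda>s::real. s)"
  by (rule smooth_bounded_linear) (rule bounded_linear_ident)

lemma kern_smooth: "smooth (kern n)"
  unfolding kern_def[abs_def] divide_inverse by (intro smooth_intros smooth_ident_real)

lemma kern_prim_smooth: "smooth (kern_prim n)"
proof (induction n)
  case 0
  then show ?case using smooth_const by (simp add: fun_eq_iff[symmetric] kern_prim.simps[abs_def])
next
  case (Suc n)
  have "smooth (\<lambda>s. kern_prim n s + cos (pi * s) ^ (2 * n + 1) * sin (pi * s) *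
      inverse (pi * (2 * n + 2) * kern_mass (Suc n)))"
    by (intro smooth_intros smooth_ident_real Suc)
  moreover have "kern_prim (Suc n) = (\<lambda>s. kern_prim n s + cos (pi * s) ^ (2 * n + 1) * sin (pi * s) *
      inverse (pi * (2 * n + 2) * kern_mass (Suc n)))"
    by (rule ext) (simp add: divide_inverse)
  ultimately show ?case by simp
qed

lemma kern_periodic: "kern n (s + 1) = kern n s"
  by (simp add: kern_def distrib_left)

lemma kern_prim_periodic: "kern_prim n (s + 1) = kern_prim n s"
  by (induction n) (simp_all add: distrib_left)

lemma kern_prim_0 [simp]: "kern_prim n 0 = 0"
  by (induction n) simp_all

lemma kern_prim_derivative: "(kern_prim n has_real_derivative kern n s - 1) (at s)"
proof (induction n)
  case 0
  then show ?case by (simp add: kern_def kern_prim.simps[abs_def])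
next
  case (Suc n)
  let ?M = "kern_mass n" and ?c = "cos (pi * s)"
  have M: "?M > 0" by (rule kern_mass_pos)
  have 1: "((\<lambda>s. cos (pi * s) ^ (2 * n + 1) * sin (pi * s)) has_real_derivative
     pi * ((2 * n + 2) * ?c ^ (2 * n + 2) - (2 * n + 1) * ?c ^ (2 * n))) (at s)"
  proof -
    have "sin (pi * s) * sin (pi * s) = 1 - ?c * ?c"
      using sin_cos_squared_add[of "pi * s"] by (simp add: power2_eq_square)
    then have s: "x * (sin (pi * s) * sin (pi * s)) = x * (1 - ?c * ?c)" for x by simp
    have "((\<lambda>s. cos (pi * s) ^ (2 * n + 1) * sin (pi * s)) has_real_derivative
       ?c ^ (2 * n + 1) * (?c * pi) + (2 * n + 1) * ?c ^ (2 * n) * (- sin (pi * s) * pi) * sin (pi * s)) (at s)"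
    proof -
      have c: "((\<lambda>s. cos (pi * s)) has_real_derivative - sin (pi * s) * pi) (at s)"
        by (auto intro!: derivative_eq_intros)
      have d: "((\<lambda>s. sin (pi * s)) has_real_derivative ?c * pi) (at s)"
        by (auto intro!: derivative_eq_intros)
      from DERIV_mult'[OF DERIV_power[OF c, of "2 * n + 1"] d] show ?thesis
        by (simp add: mult_ac)
    qed
    moreover have "?c ^ (2 * n + 1) * (?c * pi) + (2 * n + 1) * ?c ^ (2 * n) * (- sin (pi * s) * pi) * sin (pi * s)
      = pi * ?c ^ (2 * n + 2) - ((2 * n + 1) * ?c ^ (2 * n) * pi) * (sin (pi * s) * sin (pi * s))"
      by (simp add: algebra_simps)
    ultimately show ?thesis unfolding s
      by (simp add: algebra_simps)
  qed
  have "((\<lambda>s. kern_prim n s + cos (pi * s) ^ (2 * n + 1) * sin (pi * s) / (pi * (2 * n + 2) * kern_mass (Suc n)))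
     has_real_derivative kern n s - 1 + pi * ((2 * n + 2) * ?c ^ (2 * n + 2) - (2 * n + 1) * ?c ^ (2 * n)) /
       (pi * (2 * n + 2) * kern_mass (Suc n))) (at s)"
    by (intro DERIV_add Suc DERIV_cdivide 1)
  \<comment> \<open>By the recursion for \<open>kern_mass\<close> the quotient equals
    \<open>kern (Suc n) s - kern n s\<close>, so the sum telescopes.\<close>
  moreover have "kern n s - 1 + pi * ((2 * n + 2) * ?c ^ (2 * n + 2) - (2 * n + 1) * ?c ^ (2 * n)) /
       (pi * (2 * n + 2) * kern_mass (Suc n)) = kern (Suc n) s - 1"
  proof -
    define N where "N = 2 * real n + 1"
    have N: "N > 0" by (simp add: N_def)
    have "c / ?M - 1 + pi * ((N + 1) * d - N * c) / (pi * (N + 1) * (N / (N + 1) * ?M))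
      = d / (N / (N + 1) * ?M) - 1" for c d
      using N M by (simp add: divide_simps) (simp add: algebra_simps)
    from this[of "?c ^ (2 * n)" "?c ^ (2 * n + 2)"] show ?thesis
      by (simp add: kern_def N_def add.commute)
  qed
  ultimately show ?case unfolding kern_prim.simps(2)[abs_def] by (simp only:)
qed

lemma kern_continuous: "continuous_on S (kern n)"
  by (rule smooth_continuous_on[OF kern_smooth])

lemma kern_reflect_continuous: "continuous_on S (\<lambda>s. kern n (c - s))"
  by (intro continuous_on_compose2[OF kern_continuous] continuous_intros) auto

lemma kern_has_integral:
  assumes "a \<le> b"
  shows "(kern n has_integral kern_prim n b - kern_prim n a + (b - a)) {a..b}"
proof -
  have "((\<lambda>s. kern_prim n s + s) has_real_derivative kern n s) (at s within {a..b})" for s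
    using DERIV_add[OF kern_prim_derivative[of n s] DERIV_ident]
    by (auto intro: has_field_derivative_at_within)
  then have "(kern n has_integral (kern_prim n b + b) - (kern_prim n a + a)) {a..b}"
    using assms
    by (intro fundamental_theorem_of_calculus) (auto simp: has_real_derivative_iff_has_vector_derivative)
  then show ?thesis by (simp add: algebra_simps)
qed

text \<open>Only the linear part of the primitive contributes over a full period, wherever the
  period begins.\<close>

lemma kern_integral_period: "integral {0..1} (\<lambda>s. kern n (c - s)) = 1"
proof -
  have "((\<lambda>s. s - kern_prim n (c - s)) has_real_derivative kern n (c - s)) (at s within {0..1})" for s
  proof -
    have "((\<lambda>s. kern_prim n (c - s)) has_real_derivative (kern n (c - s) - 1) * (- 1)) (at s)"
      by (rule DERIV_chain2[OF kern_prim_derivative]) (auto intro!: derivative_eq_intros)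
    from DERIV_diff[OF DERIV_ident this] show ?thesis
      by (auto intro: has_field_derivative_at_within)
  qed
  then have "((\<lambda>s. kern n (c - s)) has_integral (1 - kern_prim n (c - 1)) - (0 - kern_prim n (c - 0))) {0..1}"
    by (intro fundamental_theorem_of_calculus) (auto simp: has_real_derivative_iff_has_vector_derivative)
  then show ?thesis using kern_prim_periodic[of n "c - 1"] by (simp add: integral_unique)
qed

text \<open>The squared sine is the periodic substitute for the squared distance to the integers.
  Written as 1 - cos^2 it turns the integrand into a combination of two normalised kernels, so the
  moment is exact. Its decay in \<open>n\<close> is the only concentration property of the kernel
  that the approximation argument needs.\<close>

lemma kern_moment: "integral {0..1} (\<lambda>s. kern n (c - s) * (sin (pi * (c - s)))\<^sup>2) = 1 / (2 * real n + 2)"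
proof -
  have "kern n s * (sin (pi * s))\<^sup>2 = kern n s - (2 * n + 1) / (2 * n + 2) * kern (Suc n) s" for s
  proof -
    have "kern n s * (sin (pi * s))\<^sup>2 = kern n s - kern n s * (cos (pi * s))\<^sup>2"
      by (simp add: sin_squared_eq algebra_simps)
    moreover have "(2 * n + 1) / (2 * n + 2) * kern (Suc n) s = kern n s * (cos (pi * s))\<^sup>2"
    proof -
      define N where "N = 2 * real n + 1"
      have "N > 0" by (simp add: N_def)
      then have "N / (N + 1) * (c / (N / (N + 1) * m)) = c / m" for c m :: real
        by (simp add: divide_simps)
      from this[of "cos (pi * s) ^ (2 * n + 2)" "kern_mass n"] show ?thesis
        by (simp add: kern_def N_def add.commute power2_eq_square)
    qed
    ultimately show ?thesis by simp
  qed
  then have "integral {0..1} (\<lambda>s. kern n (c - s) * (sin (pi * (c - s)))\<^sup>2)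
    = integral {0..1} (\<lambda>s. kern n (c - s) - (2 * n + 1) / (2 * n + 2) * kern (Suc n) (c - s))"
    by simp
  also have "\<dots> = 1 - (2 * n + 1) / (2 * n + 2) * 1"
    using kern_integral_period by (subst integral_diff)
      (auto intro!: integrable_continuous_real continuous_intros continuous_on_compose2[OF kern_continuous])
  finally show ?thesis by (simp add: field_simps)
qed

text \<open>On the unit interval, \<open>kern_prim n s + s\<close> is a primitive of a nonnegative
  function and climbs from 0 to 1; hence \<open>kern_prim n s\<close> lies between
  \<open>- s\<close> and \<open>1 - s\<close>. The bound does not depend on \<open>n\<close>, which
  later yields a Poincare constant independent of \<open>n\<close>.\<close>

lemma kern_prim_bound: "\<bar>kern_prim n s\<bar> \<le> 1"
proof -
  have 01: "\<bar>kern_prim n s\<bar> \<le> 1" if "s \<in> {0..1}" for s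
  proof -
    have "0 \<le> kern_prim n s - kern_prim n 0 + (s - 0)"
      using that by (intro has_integral_nonneg[OF kern_has_integral]) (auto simp: kern_nonneg)
    moreover have "0 \<le> kern_prim n 1 - kern_prim n s + (1 - s)"
      using that by (intro has_integral_nonneg[OF kern_has_integral]) (auto simp: kern_nonneg)
    moreover have "kern_prim n 1 = 0" using kern_prim_periodic[of n 0] by simp
    ultimately show ?thesis using that by auto
  qed
  have "kern_prim n (s + of_int k) = kern_prim n s" for k :: int
  proof (induction k rule: int_induct[where k=0])
    case (step1 i)
    then show ?case using kern_prim_periodic[of n "s + of_int i"] by (simp add: add.assoc)
  next
    case (step2 i)
    then show ?case using kern_prim_periodic[of n "s + of_int i - 1"] by (simp add: algebra_simps)
  qed simp
  from this[of "- \<lfloor>s\<rfloor>"] show ?thesis using 01[of "s + of_int (- \<lfloor>s\<rfloor>)"]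
    by simp linarith
qed

section \<open>The tensor product kernel on the torus\<close>

definition kern2 :: "nat \<Rightarrow> real ^ 2 \<Rightarrow> real" where
  "kern2 n z = kern n (z $ 1) * kern n (z $ 2)"

lemma kern2_nonneg: "kern2 n z \<ge> 0"
  by (simp add: kern2_def kern_nonneg)

lemma kern2_diff_commute: "kern2 n (x - y) = kern2 n (y - x)"
  by (simp add: kern2_def kern_even_diff[of n "x $ 1"] kern_even_diff[of n "x $ 2"])

lemma torus_test_function_kern: "torus_test_function (\<lambda>z. kern n (z $ j))"
  by (rule torus_test_function_coordinate[OF kern_smooth kern_periodic])

lemma torus_test_function_kern_prim: "torus_test_function (\<lambda>z. kern_prim n (z $ j))"
  by (rule torus_test_function_coordinate[OF kern_prim_smooth kern_prim_periodic])

lemma torus_test_function_kern2: "torus_test_function (kern2 n)"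
  unfolding kern2_def[abs_def] by (intro torus_test_function_mult torus_test_function_kern)

lemma kern_marginal_integral: "(LINT y|\<mu>. kern n (x $ 1 - y $ 1)) = 1"
  using torus_integral_product[of "\<lambda>s. kern n (x $ 1 - s)" "\<lambda>s. 1"] kern_integral_period[of n "x $ 1"]
  by (simp add: kern_reflect_continuous)

lemma kern2_integral: "(LINT y|\<mu>. kern2 n (x - y)) = 1"
  using torus_integral_product[of "\<lambda>s. kern n (x $ 1 - s)" "\<lambda>s. kern n (x $ 2 - s)"] kern_integral_period[of n]
  by (simp add: kern2_def kern_reflect_continuous)

lemma kern2_moment:
  "(LINT y|\<mu>. kern2 n (x - y) * (sin (pi * (x $ 1 - y $ 1)))\<^sup>2) = 1 / (2 * real n + 2)"
  "(LINT y|\<mu>. kern2 n (x - y) * (sin (pi * (x $ 2 - y $ 2)))\<^sup>2) = 1 / (2 * real n + 2)"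
proof -
  note c = kern_reflect_continuous[of UNIV n]
  have c': "continuous_on UNIV (\<lambda>s. kern n (c - s) * (sin (pi * (c - s)))\<^sup>2)" for c
    by (intro c continuous_intros)
  show "(LINT y|\<mu>. kern2 n (x - y) * (sin (pi * (x $ 1 - y $ 1)))\<^sup>2) = 1 / (2 * real n + 2)"
    using torus_integral_product[OF c'[of "x $ 1"] c[of "x $ 2"]]
    by (simp add: kern2_def kern_integral_period kern_moment mult_ac)
  show "(LINT y|\<mu>. kern2 n (x - y) * (sin (pi * (x $ 2 - y $ 2)))\<^sup>2) = 1 / (2 * real n + 2)"
    using torus_integral_product[OF c[of "x $ 1"] c'[of "x $ 2"]]
    by (simp add: kern2_def kern_integral_period kern_moment mult_ac)
qed


subsection \<open>Convolution with periodic kernels\<close>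

text \<open>Off the square only the kernel is evaluated; its periodicity makes this the convolution
  on the torus.\<close>

definition conv :: "(real ^ 2 \<Rightarrow> real) \<Rightarrow> (real ^ 2 \<Rightarrow> real) \<Rightarrow> real ^ 2 \<Rightarrow> real" where
  "conv f H x = (LINT y|\<mu>. f y * H (x - y))"

lemma torus_test_function_reflect_measurable:
  "torus_test_function H \<Longrightarrow> (\<lambda>y. H (x - y)) \<in> borel_measurable \<mu>"
  by (intro continuous_torus_measurable torus_test_function_continuous_on torus_test_function_reflect)

lemma torus_test_function_measurable:
  "torus_test_function H \<Longrightarrow> H \<in> borel_measurable \<mu>"
  by (intro continuous_torus_measurable torus_test_function_continuous_on)

lemma torus_test_function_integrable:
  "torus_test_function H \<Longrightarrow> integrable \<mu> H"
  by (intro continuous_torus_integrable torus_test_function_continuous_on)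

lemma integrable_mult_test_function:
  assumes "integrable \<mu> f" "torus_test_function H"
  shows "integrable \<mu> (\<lambda>y. f y * H y)"
proof -
  obtain B where "\<And>z. \<bar>H z\<bar> \<le> B" using torus_test_function_bounded[OF assms(2)] by blast
  then show ?thesis
    by (intro integrable_mult_bounded[OF assms(1) torus_test_function_measurable[OF assms(2)]])
qed

lemma conv_integrable:
  "integrable \<mu> f \<Longrightarrow> torus_test_function H \<Longrightarrow> integrable \<mu> (\<lambda>y. f y * H (x - y))"
  by (intro integrable_mult_test_function torus_test_function_reflect)

lemma conv_bound:
  assumes "integrable \<mu> f" "torus_test_function H" "\<And>z. \<bar>H z\<bar> \<le> B"
  shows "\<bar>conv f H x\<bar> \<le> B * (LINT y|\<mu>. \<bar>f y\<bar>)"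
proof -
  have "\<bar>conv f H x\<bar> \<le> (LINT y|\<mu>. \<bar>f y * H (x - y)\<bar>)"
    unfolding conv_def by (rule integral_abs_bound)
  also have "\<dots> \<le> (LINT y|\<mu>. B * \<bar>f y\<bar>)"
    by (intro integral_mono integrable_abs conv_integrable assms integrable_mult_right)
      (use mult_right_mono[OF assms(3) abs_ge_zero] in \<open>simp add: abs_mult mult.commute\<close>)
  finally show ?thesis by simp
qed

lemma conv_add:
  assumes "integrable \<mu> f" "torus_test_function H" "torus_test_function H'"
  shows "conv f (\<lambda>z. H z + H' z) x = conv f H x + conv f H' x"
  unfolding conv_def using conv_integrable[OF assms(1,2)] conv_integrable[OF assms(1,3)]
  by (simp add: distrib_left)

lemma conv_diff:
  assumes "integrable \<mu> f" "torus_test_function H" "torus_test_function H'"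
  shows "conv f (\<lambda>z. H z - H' z) x = conv f H x - conv f H' x"
  unfolding conv_def using conv_integrable[OF assms(1,2)] conv_integrable[OF assms(1,3)]
  by (simp add: right_diff_distrib)

text \<open>Differentiation under the integral by dominated convergence along sequences: the
  normalised remainder of the kernel is at most its Lipschitz constant plus the bound on its
  derivative, so a multiple of the absolute value of \<open>f\<close> dominates.\<close>

lemma conv_has_derivative:
  assumes f: "integrable \<mu> f" and H: "torus_test_function H"
  shows "(conv f H has_derivative (\<lambda>h. conv f (\<lambda>z. frechet_derivative H (at z) h) x)) (at x)"
proof -
  let ?D = "\<lambda>z h. frechet_derivative H (at z) h"
  obtain B where B: "B > 0" "\<And>z h. \<bar>?D z h\<bar> \<le> B * norm h"
    using torus_test_function_frechet_bounded[OF H] by blast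
  obtain L where L: "L > 0" "\<And>x y. \<bar>H x - H y\<bar> \<le> L * norm (x - y)"
    using torus_test_function_lipschitz[OF H] by blast
  have D: "torus_test_function (\<lambda>z. ?D z h)" for h
    by (rule torus_test_function_frechet_derivative[OF H])
  have lin: "bounded_linear (?D z)" for z
    using torus_test_function_has_derivative[OF H] has_derivative_bounded_linear by blast
  have "bounded_linear (\<lambda>h. conv f (\<lambda>z. ?D z h) x)"
  proof (rule bounded_linear_intro)
    show "conv f (\<lambda>z. ?D z (h + k)) x = conv f (\<lambda>z. ?D z h) x + conv f (\<lambda>z. ?D z k) x" for h k
      by (subst conv_add[OF f D D, symmetric]) (simp add: linear_simps(1)[OF lin])
    show "conv f (\<lambda>z. ?D z (r *\<^sub>R h)) x = r *\<^sub>R conv f (\<lambda>z. ?D z h) x" for r h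
      unfolding conv_def by (simp add: linear_simps(5)[OF lin] mult.left_commute)
    show "norm (conv f (\<lambda>z. ?D z h) x) \<le> norm h * (B * (LINT y|\<mu>. \<bar>f y\<bar>))" for h
      using conv_bound[OF f D B(2)] by (simp add: mult_ac)
  qed
  moreover have "((\<lambda>y. (1 / norm (y - x)) *\<^sub>R (conv f H y - (conv f H x + conv f (\<lambda>z. ?D z (y - x)) x)))
      \<longlongrightarrow> 0) (at x)"
    unfolding tendsto_at_iff_sequentially comp_def
  proof (intro allI impI)
    fix X :: "nat \<Rightarrow> real ^ 2"
    assume X: "\<forall>i. X i \<in> UNIV - {x}" "X \<longlonglongrightarrow> x"
    \<comment> \<open>The first-order Taylor remainder of the kernel at \<open>x - y\<close>,
      divided by the length of the increment.\<close>
    define q where "q i y = (1 / norm (X i - x)) * (H (X i - y) - H (x - y) - ?D (x - y) (X i - x))" for i y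
    have eq: "(1 / norm (X i - x)) *\<^sub>R (conv f H (X i) - (conv f H x + conv f (\<lambda>z. ?D z (X i - x)) x))
      = (LINT y|\<mu>. f y * q i y)" for i
    proof -
      have "(LINT y|\<mu>. f y * q i y) = (LINT y|\<mu>. (1 / norm (X i - x)) *
          (f y * H (X i - y) - f y * H (x - y) - f y * ?D (x - y) (X i - x)))"
        by (rule Bochner_Integration.integral_cong) (simp_all add: q_def algebra_simps)
      then show ?thesis
        using conv_integrable[OF f H] conv_integrable[OF f D] by (simp add: conv_def)
    qed
    have "(\<lambda>i. LINT y|\<mu>. f y * q i y) \<longlonglongrightarrow> (LINT y|\<mu>. 0)"
    proof (rule integral_dominated_convergence[where w="\<lambda>y. (L + B) * \<bar>f y\<bar>"])
      have [measurable]: "f \<in> borel_measurable \<mu>" using f by simp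
      show "(\<lambda>y. f y * q i y) \<in> borel_measurable \<mu>" for i
        unfolding q_def using torus_test_function_reflect_measurable[OF H]
          torus_test_function_reflect_measurable[OF D] by measurable
      show "integrable \<mu> (\<lambda>y. (L + B) * \<bar>f y\<bar>)" using f by simp
      show "AE y in \<mu>. norm (f y * q i y) \<le> (L + B) * \<bar>f y\<bar>" for i
      proof (rule AE_I2)
        fix y
        have "\<bar>H (X i - y) - H (x - y) - ?D (x - y) (X i - x)\<bar> \<le> (L + B) * norm (X i - x)"
          using L(2)[of "X i - y" "x - y"] B(2)[of "x - y" "X i - x"]
          by (simp add: distrib_right)
        then have "\<bar>q i y\<bar> \<le> L + B" using X(1)[rule_format, of i]
          by (simp add: q_def abs_mult divide_simps)
        then show "norm (f y * q i y) \<le> (L + B) * \<bar>f y\<bar>"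
          using mult_left_mono[of "\<bar>q i y\<bar>" "L + B" "\<bar>f y\<bar>"] by (simp add: abs_mult mult.commute)
      qed
      show "AE y in \<mu>. (\<lambda>i. f y * q i y) \<longlonglongrightarrow> 0"
      proof (rule AE_I2)
        fix y
        have t: "((\<lambda>w. (1 / norm (w - (x - y))) *\<^sub>R (H w - (H (x - y) + ?D (x - y) (w - (x - y))))) \<longlongrightarrow> 0) (at (x - y))"
          using torus_test_function_has_derivative[OF H, of "x - y"] unfolding has_derivative_within by blast
        have "X i - y \<in> UNIV - {x - y}" for i using X by auto
        moreover have "(\<lambda>i. X i - y) \<longlonglongrightarrow> x - y"
          using X by (auto intro: tendsto_intros)
        ultimately have "(\<lambda>i. (1 / norm ((X i - y) - (x - y))) *\<^sub>R (H (X i - y) - (H (x - y) + ?D (x - y) ((X i - y) - (x - y))))) \<longlonglongrightarrow> 0"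
          by (rule t[unfolded tendsto_at_iff_sequentially comp_def, rule_format])
        then have "(\<lambda>i. q i y) \<longlonglongrightarrow> 0" by (simp add: q_def diff_diff_eq)
        then show "(\<lambda>i. f y * q i y) \<longlonglongrightarrow> 0" using tendsto_mult_right_zero by blast
      qed
    qed simp
    then show "(\<lambda>i. (1 / norm (X i - x)) *\<^sub>R (conv f H (X i) - (conv f H x + conv f (\<lambda>z. ?D z (X i - x)) x))) \<longlonglongrightarrow> 0"
      unfolding eq by simp
  qed
  ultimately show ?thesis by (simp add: has_derivative_within)
qed

lemma conv_frechet_derivative:
  assumes "integrable \<mu> f" "torus_test_function H"
  shows "frechet_derivative (conv f H) (at x) h = conv f (\<lambda>z. frechet_derivative H (at z) h) x"
  using frechet_derivative_at[OF conv_has_derivative[OF assms]] by metis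

text \<open>All derivatives fall on the kernel, so the induction keeps \<open>f\<close> fixed and
  ranges over all kernels.\<close>

lemma torus_test_function_conv:
  assumes f: "integrable \<mu> f" and H: "torus_test_function H"
  shows "torus_test_function (conv f H)"
  unfolding torus_test_function_def smooth_def
proof (intro conjI allI)
  show "conv f H (x + axis j 1) = conv f H x" for x j
  proof -
    have "H (x + axis j 1 - y) = H (x - y)" for y
      using H unfolding torus_test_function_def by (metis diff_add_eq)
    then show ?thesis by (simp add: conv_def)
  qed
  show "times_cont_diff k (conv f H)" for k
    using H
  proof (induction k arbitrary: H)
    case 0
    have "isCont (conv f H) x" for x
      using has_derivative_continuous[OF conv_has_derivative[OF f 0]] .
    then show ?case by (simp add: continuous_on_eq_continuous_at)
  next
    case (Suc k)
    show ?case
      by (rule times_cont_diff_SucI[OF conv_has_derivative[OF f Suc.prems]])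
        (rule Suc.IH, rule torus_test_function_frechet_derivative[OF Suc.prems])
  qed
qed

lemma integrable_torus_prod_mult:
  assumes "integrable \<mu> f" "integrable \<mu> g"
  shows "integrable (\<mu> \<Otimes>\<^sub>M \<mu>) (\<lambda>p. f (fst p) * g (snd p) :: real)"
proof (rule torus_pair.Fubini_integrable)
  show "(\<lambda>p. f (fst p) * g (snd p)) \<in> borel_measurable (\<mu> \<Otimes>\<^sub>M \<mu>)"
    using assms by (intro borel_measurable_times torus_prod_fst_measurable torus_prod_snd_measurable) auto
  show "integrable \<mu> (\<lambda>x. LINT y|\<mu>. norm (f (fst (x, y)) * g (snd (x, y))))"
    using assms by (simp add: abs_mult)
  show "AE x in \<mu>. integrable \<mu> (\<lambda>y. f (fst (x, y)) * g (snd (x, y)))"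
    using assms by simp
qed

lemma torus_test_function_prod_measurable:
  assumes "torus_test_function H"
  shows "(\<lambda>p. H (fst p - snd p)) \<in> borel_measurable (\<mu> \<Otimes>\<^sub>M \<mu>)"
  by (intro continuous_torus_prod_measurable
      continuous_on_compose2[OF torus_test_function_continuous_on[OF assms, of UNIV]] continuous_intros) auto

lemma integrable_torus_prod_conv:
  assumes "integrable \<mu> f" "integrable \<mu> g" and H: "torus_test_function H"
  shows "integrable (\<mu> \<Otimes>\<^sub>M \<mu>) (\<lambda>(x, y). f x * g y * H (x - y))"
proof -
  obtain B where B: "\<And>z. \<bar>H z\<bar> \<le> B" using torus_test_function_bounded[OF H] by blast
  show ?thesis
    unfolding case_prod_unfold
    by (rule integrable_mult_bounded[OF integrable_torus_prod_mult[OF assms(1,2)]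
          torus_test_function_prod_measurable[OF H] B])
qed

text \<open>Transposition: a convolution acting on one factor of a pairing is moved to the other
  factor, with the kernel reflected.\<close>

lemma conv_fubini:
  assumes "integrable \<mu> f" "integrable \<mu> g" "torus_test_function H"
  shows "(LINT x|\<mu>. g x * conv f H x) = (LINT y|\<mu>. f y * (LINT x|\<mu>. g x * H (x - y)))"
proof -
  have "(LINT x|\<mu>. g x * conv f H x) = (LINT x|\<mu>. LINT y|\<mu>. g x * f y * H (x - y))"
    by (simp add: conv_def mult.assoc)
  also have "\<dots> = (LINT y|\<mu>. LINT x|\<mu>. g x * f y * H (x - y))"
    using torus_pair.Fubini_integral[OF integrable_torus_prod_conv[OF assms(2,1,3)]] by simp
  also have "\<dots> = (LINT y|\<mu>. f y * (LINT x|\<mu>. g x * H (x - y)))"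
    by (simp add: mult_ac flip: integral_mult_right_zero)
  finally show ?thesis .
qed

subsection \<open>Square-integrable functions\<close>

definition sq_integrable :: "(real ^ 2 \<Rightarrow> real) \<Rightarrow> bool" where
  "sq_integrable f \<longleftrightarrow> f \<in> borel_measurable \<mu> \<and> integrable \<mu> (\<lambda>x. (f x)\<^sup>2)"

lemma sq_integrable_mult:
  assumes "sq_integrable f" "sq_integrable g"
  shows "integrable \<mu> (\<lambda>x. f x * g x)"
proof (rule Bochner_Integration.integrable_bound[where f="\<lambda>x. (f x)\<^sup>2 + (g x)\<^sup>2"])
  show "AE x in \<mu>. norm (f x * g x) \<le> norm ((f x)\<^sup>2 + (g x)\<^sup>2)"
  proof (rule AE_I2)
    fix x
    have "0 \<le> (f x - g x)\<^sup>2" "0 \<le> (f x + g x)\<^sup>2" by simp_all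
    then have "2 * \<bar>f x * g x\<bar> \<le> (f x)\<^sup>2 + (g x)\<^sup>2"
      by (simp add: power2_diff power2_sum abs_if)
    then show "norm (f x * g x) \<le> norm ((f x)\<^sup>2 + (g x)\<^sup>2)" by simp
  qed
qed (use assms in \<open>auto simp: sq_integrable_def\<close>)

lemma sq_integrable_bounded:
  assumes "f \<in> borel_measurable \<mu>" "\<And>x. \<bar>f x\<bar> \<le> B"
  shows "sq_integrable f"
proof -
  have "\<bar>(f x)\<^sup>2\<bar> \<le> B\<^sup>2" for x
    using power_mono[OF assms(2)[of x], of 2] by simp
  then show ?thesis using assms(1) unfolding sq_integrable_def
    by (auto intro!: torus.integrable_bounded[where B="B\<^sup>2"])
qed

lemma sq_integrable_test_function: "torus_test_function f \<Longrightarrow> sq_integrable f"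
  using torus_test_function_bounded[of f] sq_integrable_bounded torus_test_function_measurable by metis

lemma sq_integrable_integrable: "sq_integrable f \<Longrightarrow> integrable \<mu> f"
  using sq_integrable_mult[of f "\<lambda>x. 1"] sq_integrable_test_function[OF torus_test_function_const[of 1]]
  by simp

lemma sq_integrable_add:
  "sq_integrable f \<Longrightarrow> sq_integrable g \<Longrightarrow> sq_integrable (\<lambda>x. f x + g x)"
  using sq_integrable_mult[of f g] by (auto simp: sq_integrable_def power2_sum mult.assoc)

lemma sq_integrable_cmult: "sq_integrable f \<Longrightarrow> sq_integrable (\<lambda>x. c * f x)"
  by (auto simp: sq_integrable_def power_mult_distrib)

lemma sq_integrable_diff:
  "sq_integrable f \<Longrightarrow> sq_integrable g \<Longrightarrow> sq_integrable (\<lambda>x. f x - g x)"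
  using sq_integrable_add[OF _ sq_integrable_cmult[of g "-1"], of f] by simp

lemma sq_integrable_mult_bounded:
  assumes "sq_integrable f" "g \<in> borel_measurable \<mu>" "\<And>x. \<bar>g x\<bar> \<le> B"
  shows "sq_integrable (\<lambda>x. f x * g x)"
proof -
  have "\<bar>(g x)\<^sup>2\<bar> \<le> B\<^sup>2" for x
    using power_mono[OF assms(3)[of x], of 2] by simp
  then have "integrable \<mu> (\<lambda>x. (f x)\<^sup>2 * (g x)\<^sup>2)"
    using assms unfolding sq_integrable_def by (intro integrable_mult_bounded[where B="B\<^sup>2"]) auto
  then show ?thesis using assms by (auto simp: sq_integrable_def power_mult_distrib)
qed

lemma torus_cauchy_schwarz:
  assumes f: "sq_integrable f" and g: "sq_integrable g"
  shows "(LINT x|\<mu>. f x * g x)\<^sup>2 \<le> (LINT x|\<mu>. (f x)\<^sup>2) * (LINT x|\<mu>. (g x)\<^sup>2)"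
proof -
  define A where "A = (LINT x|\<mu>. (f x)\<^sup>2)"
  define B where "B = (LINT x|\<mu>. f x * g x)"
  define C where "C = (LINT x|\<mu>. (g x)\<^sup>2)"
  have pos: "0 \<le> A - 2 * c * B + c\<^sup>2 * C" for c
  proof -
    have "0 \<le> (LINT x|\<mu>. (f x - c * g x)\<^sup>2)" by simp
    also have "(LINT x|\<mu>. (f x - c * g x)\<^sup>2) = (LINT x|\<mu>. (f x)\<^sup>2 - 2 * c * (f x * g x) + c\<^sup>2 * (g x)\<^sup>2)"
      by (rule Bochner_Integration.integral_cong) (simp_all add: power2_diff power_mult_distrib algebra_simps)
    also have "\<dots> = A - 2 * c * B + c\<^sup>2 * C"
      using f g sq_integrable_mult[OF f g] by (simp add: A_def B_def C_def sq_integrable_def)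
    finally show ?thesis .
  qed
  show ?thesis
  proof (cases "C = 0")
    case True
    have "B = 0"
    proof (rule ccontr)
      assume "B \<noteq> 0"
      \<comment> \<open>This value of the parameter makes the expression, which is affine when
        \<open>C = 0\<close>, equal to -1.\<close>
      then show False using pos[of "(A + 1) / (2 * B)"] True by simp
    qed
    then show ?thesis using True by (simp add: B_def C_def)
  next
    case False
    then have "C > 0" by (simp add: C_def less_le)
    then have "A - B\<^sup>2 / C \<ge> 0"
      using pos[of "B / C"] by (simp add: power2_eq_square divide_simps)
    then show ?thesis using \<open>C > 0\<close> by (simp add: A_def B_def C_def field_simps)
  qed
qed

lemma torus_cauchy_schwarz_abs:
  assumes "sq_integrable f" "sq_integrable g"
  shows "\<bar>LINT x|\<mu>. f x * g x\<bar> \<le> sqrt (LINT x|\<mu>. (f x)\<^sup>2) * sqrt (LINT x|\<mu>. (g x)\<^sup>2)"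
  using real_le_rsqrt[of "\<bar>LINT x|\<mu>. f x * g x\<bar>", unfolded power2_abs, OF torus_cauchy_schwarz[OF assms]]
  by (simp only: real_sqrt_mult)

text \<open>With \<open>w\<close> as a probability density this says that the variance about the
  weighted mean \<open>c\<close> is nonnegative.\<close>

lemma torus_weighted_jensen:
  assumes f: "sq_integrable f" and w: "torus_test_function w" "\<And>x. w x \<ge> 0" "(LINT x|\<mu>. w x) = 1"
  shows "(LINT x|\<mu>. f x * w x)\<^sup>2 \<le> (LINT x|\<mu>. (f x)\<^sup>2 * w x)"
proof -
  define c where "c = (LINT x|\<mu>. f x * w x)"
  have i: "integrable \<mu> (\<lambda>x. (f x)\<^sup>2 * w x)" "integrable \<mu> (\<lambda>x. f x * w x)"
    using f sq_integrable_integrable[OF f]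
    by (auto intro!: integrable_mult_test_function w simp: sq_integrable_def)
  have "0 \<le> (LINT x|\<mu>. (f x - c)\<^sup>2 * w x)" using w(2) by simp
  also have "(LINT x|\<mu>. (f x - c)\<^sup>2 * w x) = (LINT x|\<mu>. (f x)\<^sup>2 * w x - 2 * c * (f x * w x) + c\<^sup>2 * w x)"
    by (simp add: power2_diff algebra_simps)
  also have "\<dots> = (LINT x|\<mu>. (f x)\<^sup>2 * w x) - 2 * c * c + c\<^sup>2"
    using i torus_test_function_integrable[OF w(1)] by (simp add: w(3) c_def)
  finally show ?thesis by (simp add: c_def power2_eq_square)
qed


subsection \<open>Approximation by the kernel\<close>

lemma power_sum3_le:
  fixes a b c :: real
  assumes "a \<ge> 0" "b \<ge> 0" "c \<ge> 0"
  shows "(a + b + c) ^ p \<le> 3 ^ p * (a ^ p + b ^ p + c ^ p)"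
proof -
  define m where "m = max a (max b c)"
  have "m ^ p \<le> a ^ p + b ^ p + c ^ p"
    using assms by (auto simp: m_def max_def)
  moreover have "(a + b + c) ^ p \<le> (3 * m) ^ p"
    using assms by (intro power_mono) (auto simp: m_def)
  ultimately show ?thesis by (simp add: power_mult_distrib) (smt (verit) mult_left_mono zero_le_power)
qed

lemma torus_interior_AE: "AE x in \<mu>. x \<in> box 0 1"
proof -
  have "negligible (cbox 0 (1::real^2) - box 0 1)" by (rule negligible_frontier_interval)
  then have "AE x in lebesgue. x \<notin> cbox 0 1 - box 0 (1::real^2)"
    by (intro AE_not_in) (simp add: negligible_iff_null_sets)
  then show ?thesis by (subst AE_restrict_space_iff) (auto simp: torus_def)
qed

text \<open>Measurability provides continuous functions converging almost everywhere; clipping at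
  \<open>M\<close> supplies the dominating constant. Vanishing on the boundary is imposed so that
  the approximant takes equal values at boundary points identified on the torus.\<close>

lemma torus_bounded_approximation:
  fixes f :: "real ^ 2 \<Rightarrow> real"
  assumes f: "f \<in> borel_measurable \<mu>" and bound: "\<And>x. \<bar>f x\<bar> \<le> M" and "p \<ge> 1" "e > 0"
  obtains g where "continuous_on UNIV g" "\<And>x. \<bar>g x\<bar> \<le> M" "\<And>x. x \<in> torus - box 0 1 \<Longrightarrow> g x = 0"
    "(LINT x|\<mu>. \<bar>f x - g x\<bar> ^ p) < e"
proof -
  have M: "M \<ge> 0" using bound[of 0] by linarith
  have "f measurable_on torus"
    using f by (simp add: measurable_on_iff_borel_measurable)
  then obtain N g where N: "negligible N" and g: "\<And>n. continuous_on UNIV (g n)"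
    "\<And>x. x \<notin> N \<Longrightarrow> (\<lambda>n. g n x) \<longlonglongrightarrow> (if x \<in> torus then f x else 0)"
    unfolding measurable_on_def by blast
  \<comment> \<open>The product of coordinates is positive exactly inside the square when restricted
    to it, so these ramps are 0 on its boundary and eventually 1 at each interior point.\<close>
  define \<eta> :: "nat \<Rightarrow> real^2 \<Rightarrow> real" where
    "\<eta> n x = min 1 (n * max 0 (x $ 1 * (1 - x $ 1) * (x $ 2 * (1 - x $ 2))))" for n x
  define h where "h n x = max (- M) (min M (g n x)) * \<eta> n x" for n x
  have \<eta>01: "0 \<le> \<eta> n x" "\<eta> n x \<le> 1" for n x by (auto simp: \<eta>_def)
  have conth: "continuous_on UNIV (h n)" for n
    unfolding h_def \<eta>_def by (intro continuous_intros g)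
  have boundh: "\<bar>h n x\<bar> \<le> M" for n x
  proof -
    have "\<bar>h n x\<bar> \<le> M * 1" unfolding h_def abs_mult
      using \<eta>01[of n x] M by (intro mult_mono) auto
    then show ?thesis by simp
  qed
  have zero: "h n x = 0" if "x \<in> torus - box 0 1" for n x
  proof -
    have "x $ 1 \<in> {0, 1} \<or> x $ 2 \<in> {0, 1}"
      using that by (auto simp: torus_def mem_box_cart forall_2)
    then show ?thesis by (auto simp: h_def \<eta>_def)
  qed
  have lim: "AE x in \<mu>. (\<lambda>n. \<bar>f x - h n x\<bar> ^ p) \<longlonglongrightarrow> 0"
  proof -
    have "AE x in lebesgue. x \<notin> N"
      using N by (intro AE_not_in) (simp add: negligible_iff_null_sets)
    then have "AE x in \<mu>. x \<notin> N" by (subst AE_restrict_space_iff) auto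
    then show ?thesis using torus_interior_AE
    proof eventually_elim
      case (elim x)
      then have "x \<in> torus" using box_subset_cbox by (auto simp: torus_def)
      then have "(\<lambda>n. g n x) \<longlonglongrightarrow> f x" using g(2)[OF elim(1)] by simp
      then have "(\<lambda>n. max (- M) (min M (g n x))) \<longlonglongrightarrow> max (- M) (min M (f x))"
        by (intro tendsto_intros)
      also have "max (- M) (min M (f x)) = f x" using bound[of x] M by (auto simp: max_def min_def)
      finally have 1: "(\<lambda>n. max (- M) (min M (g n x))) \<longlonglongrightarrow> f x" .
      define c where "c = x $ 1 * (1 - x $ 1) * (x $ 2 * (1 - x $ 2))"
      have "c > 0" using elim by (auto simp: c_def mem_box_cart)
      obtain n0 where n0: "real n0 * c > 1" using reals_Archimedean3[OF \<open>c > 0\<close>] by blast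
      have "\<eta> n x = 1" if "n \<ge> n0" for n
      proof -
        have "1 < real n * c" using n0 that \<open>c > 0\<close>
          by (smt (verit) mult_right_mono of_nat_mono)
        then show ?thesis using \<open>c > 0\<close> by (simp add: \<eta>_def c_def[symmetric])
      qed
      then have "(\<lambda>n. \<eta> n x) \<longlonglongrightarrow> 1"
        by (intro tendsto_eventually) (auto simp: eventually_sequentially)
      from tendsto_mult[OF 1 this] have "(\<lambda>n. h n x) \<longlonglongrightarrow> f x" by (simp add: h_def)
      then have "(\<lambda>n. \<bar>f x - h n x\<bar> ^ p) \<longlonglongrightarrow> \<bar>f x - f x\<bar> ^ p"
        by (intro tendsto_intros)
      then show ?case using \<open>p \<ge> 1\<close> by (simp add: power_0_left)
    qed
  qed
  have "(\<lambda>n. LINT x|\<mu>. \<bar>f x - h n x\<bar> ^ p) \<longlonglongrightarrow> (LINT x|\<mu>. 0)"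
  proof (rule integral_dominated_convergence[where w="\<lambda>x. (2 * M) ^ p"])
    show "(\<lambda>x. \<bar>f x - h n x\<bar> ^ p) \<in> borel_measurable \<mu>" for n
      using f continuous_torus_measurable[OF conth[of n]] by measurable
    show "AE x in \<mu>. norm (\<bar>f x - h n x\<bar> ^ p) \<le> (2 * M) ^ p" for n
    proof (rule AE_I2)
      fix x
      have "\<bar>f x - h n x\<bar> \<le> 2 * M" using bound[of x] boundh[of n x] by linarith
      then show "norm (\<bar>f x - h n x\<bar> ^ p) \<le> (2 * M) ^ p"
        using power_mono[of "\<bar>f x - h n x\<bar>" "2 * M" p] by simp
    qed
  qed (use lim in auto)
  then have "\<forall>\<^sub>F n in sequentially. (LINT x|\<mu>. \<bar>f x - h n x\<bar> ^ p) < e"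
    using \<open>e > 0\<close> by (simp add: order_tendsto_iff)
  then obtain n where "(LINT x|\<mu>. \<bar>f x - h n x\<bar> ^ p) < e"
    by (auto simp: eventually_sequentially)
  then show thesis using that conth boundh zero by blast
qed

text \<open>Truncation at height \<open>m\<close> reduces the claim to the bounded case; the
  truncation error is dominated by the integrable power of \<open>f\<close> itself.\<close>

lemma torus_density:
  fixes f :: "real ^ 2 \<Rightarrow> real"
  assumes f: "f \<in> borel_measurable \<mu>" "integrable \<mu> (\<lambda>x. \<bar>f x\<bar> ^ p)" and "p \<ge> 1" "e > 0"
  obtains g where "continuous_on UNIV g" "\<And>x. x \<in> torus - box 0 1 \<Longrightarrow> g x = 0"
    "integrable \<mu> (\<lambda>x. \<bar>f x - g x\<bar> ^ p)" "(LINT x|\<mu>. \<bar>f x - g x\<bar> ^ p) < e"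
proof -
  define F where "F m x = max (- real m) (min (real m) (f x))" for m :: nat and x
  have Fm: "F m \<in> borel_measurable \<mu>" for m using f(1) unfolding F_def by measurable
  have Fb: "\<bar>F m x\<bar> \<le> real m" for m x by (auto simp: F_def)
  have "(\<lambda>m. LINT x|\<mu>. \<bar>f x - F m x\<bar> ^ p) \<longlonglongrightarrow> (LINT x|\<mu>. 0)"
  proof (rule integral_dominated_convergence[where w="\<lambda>x. \<bar>f x\<bar> ^ p"])
    show "(\<lambda>x. \<bar>f x - F m x\<bar> ^ p) \<in> borel_measurable \<mu>" for m
      using f(1) Fm[of m] by measurable
    show "AE x in \<mu>. norm (\<bar>f x - F m x\<bar> ^ p) \<le> \<bar>f x\<bar> ^ p" for m
    proof (rule AE_I2)
      fix x
      have "\<bar>f x - F m x\<bar> \<le> \<bar>f x\<bar>" by (auto simp: F_def max_def min_def)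
      then show "norm (\<bar>f x - F m x\<bar> ^ p) \<le> \<bar>f x\<bar> ^ p" by (simp add: power_mono)
    qed
    show "AE x in \<mu>. (\<lambda>m. \<bar>f x - F m x\<bar> ^ p) \<longlonglongrightarrow> 0"
    proof (rule AE_I2, rule tendsto_eventually)
      fix x
      obtain m0 :: nat where "real m0 \<ge> \<bar>f x\<bar>" using real_arch_simple by blast
      then have "F m x = f x" if "m \<ge> m0" for m using that by (auto simp: F_def max_def min_def)
      then show "\<forall>\<^sub>F m in sequentially. \<bar>f x - F m x\<bar> ^ p = 0"
        using \<open>p \<ge> 1\<close> by (auto simp: eventually_sequentially intro!: exI[of _ m0])
    qed
  qed (use f in auto)
  then have "\<forall>\<^sub>F m in sequentially. (LINT x|\<mu>. \<bar>f x - F m x\<bar> ^ p) < e / (2 * 3 ^ p)"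
    using \<open>e > 0\<close> by (simp add: order_tendsto_iff)
  then obtain m where m: "(LINT x|\<mu>. \<bar>f x - F m x\<bar> ^ p) < e / (2 * 3 ^ p)"
    by (auto simp: eventually_sequentially)
  \<comment> \<open>The factor \<open>3 ^ p\<close> is lost again when \<open>power_sum3_le\<close>
    combines the truncation error with the approximation error.\<close>
  have e': "e / (2 * 3 ^ p) > 0" using \<open>e > 0\<close> by simp
  obtain g where g: "continuous_on UNIV g" "\<And>x. \<bar>g x\<bar> \<le> real m" "\<And>x. x \<in> torus - box 0 1 \<Longrightarrow> g x = 0"
    "(LINT x|\<mu>. \<bar>F m x - g x\<bar> ^ p) < e / (2 * 3 ^ p)"
    using torus_bounded_approximation[OF Fm Fb[of m] \<open>p \<ge> 1\<close> e'] by blast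
  have [measurable]: "g \<in> borel_measurable \<mu>" by (rule continuous_torus_measurable[OF g(1)])
  note [measurable] = f(1) Fm
  have i1: "integrable \<mu> (\<lambda>x. \<bar>f x - F m x\<bar> ^ p)"
  proof (rule Bochner_Integration.integrable_bound[OF f(2)])
    show "AE x in \<mu>. norm (\<bar>f x - F m x\<bar> ^ p) \<le> norm (\<bar>f x\<bar> ^ p)"
    proof (rule AE_I2)
      fix x
      have "\<bar>f x - F m x\<bar> \<le> \<bar>f x\<bar>" by (auto simp: F_def max_def min_def)
      then show "norm (\<bar>f x - F m x\<bar> ^ p) \<le> norm (\<bar>f x\<bar> ^ p)" by (simp add: power_mono)
    qed
  qed measurable
  have i2: "integrable \<mu> (\<lambda>x. \<bar>F m x - g x\<bar> ^ p)"
  proof (rule torus.integrable_bounded[where B="(2 * m) ^ p"])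
    fix x
    have "\<bar>F m x - g x\<bar> \<le> 2 * m" using Fb[of m x] g(2)[of x] by linarith
    then show "\<bar>\<bar>F m x - g x\<bar> ^ p\<bar> \<le> (2 * m) ^ p"
      using power_mono[of "\<bar>F m x - g x\<bar>" "real (2 * m)" p] by simp
  qed measurable
  have le: "\<bar>f x - g x\<bar> ^ p \<le> 3 ^ p * (\<bar>f x - F m x\<bar> ^ p + \<bar>F m x - g x\<bar> ^ p)" for x
  proof -
    have "\<bar>f x - g x\<bar> ^ p \<le> (\<bar>f x - F m x\<bar> + \<bar>F m x - g x\<bar> + 0) ^ p" by (intro power_mono) auto
    also have "\<dots> \<le> 3 ^ p * (\<bar>f x - F m x\<bar> ^ p + \<bar>F m x - g x\<bar> ^ p + 0 ^ p)" by (rule power_sum3_le) auto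
    finally show ?thesis using \<open>p \<ge> 1\<close> by (simp add: power_0_left)
  qed
  have i3: "integrable \<mu> (\<lambda>x. \<bar>f x - g x\<bar> ^ p)"
  proof (rule Bochner_Integration.integrable_bound[where
        f="\<lambda>x. 3 ^ p * (\<bar>f x - F m x\<bar> ^ p + \<bar>F m x - g x\<bar> ^ p)"])
    show "AE x in \<mu>. norm (\<bar>f x - g x\<bar> ^ p) \<le> norm (3 ^ p * (\<bar>f x - F m x\<bar> ^ p + \<bar>F m x - g x\<bar> ^ p))"
      using le by (auto intro!: AE_I2 order_trans[OF _ abs_ge_self] simp del: abs_mult)
  qed (use i1 i2 in simp_all)
  have "(LINT x|\<mu>. \<bar>f x - g x\<bar> ^ p) \<le> (LINT x|\<mu>. 3 ^ p * (\<bar>f x - F m x\<bar> ^ p + \<bar>F m x - g x\<bar> ^ p))"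
  proof (rule integral_mono)
    show "integrable \<mu> (\<lambda>x. 3 ^ p * (\<bar>f x - F m x\<bar> ^ p + \<bar>F m x - g x\<bar> ^ p))" using i1 i2 by simp
    show "integrable \<mu> (\<lambda>x. \<bar>f x - g x\<bar> ^ p)" by (rule i3)
  qed (rule le)
  also have "\<dots> = 3 ^ p * ((LINT x|\<mu>. \<bar>f x - F m x\<bar> ^ p) + (LINT x|\<mu>. \<bar>F m x - g x\<bar> ^ p))"
    using i1 i2 by simp
  also have "\<dots> < 3 ^ p * (e / (2 * 3 ^ p) + e / (2 * 3 ^ p))"
    by (intro mult_strict_left_mono add_strict_mono m g(4)) simp
  also have "\<dots> = e" by (simp add: field_simps)
  finally show thesis using that g i3 by blast
qed

text \<open>The pairs at which \<open>g\<close> oscillates by at least \<open>e\<close> form a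
  compact set. There the sum of squared sines is positive: if it vanished, the points would coincide
  modulo integers, hence be equal or both lie on the boundary, where \<open>g\<close> is 0. Dividing
  the maximal oscillation by the minimum of that sum gives \<open>C\<close>.\<close>

lemma torus_modulus_of_continuity:
  fixes g :: "real ^ 2 \<Rightarrow> real"
  assumes g: "continuous_on UNIV g" "\<And>x. x \<in> torus - box 0 1 \<Longrightarrow> g x = 0" and "p \<ge> 1" "e > 0"
  obtains C where "C \<ge> 0" "\<And>x y. x \<in> torus \<Longrightarrow> y \<in> torus \<Longrightarrow>
    \<bar>g x - g y\<bar> ^ p \<le> e + C * ((sin (pi * (x $ 1 - y $ 1)))\<^sup>2 + (sin (pi * (x $ 2 - y $ 2)))\<^sup>2)"
proof -
  define s where "s q = (sin (pi * (fst q $ 1 - snd q $ 1)))\<^sup>2 + (sin (pi * (fst q $ 2 - snd q $ 2)))\<^sup>2"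
    for q :: "(real^2) \<times> (real^2)"
  define h where "h q = \<bar>g (fst q) - g (snd q)\<bar> ^ p" for q
  have sc: "continuous_on S s" for S unfolding s_def by (intro continuous_intros)
  have hc: "continuous_on S h" for S unfolding h_def
    by (intro continuous_intros continuous_on_compose2[OF g(1)]) auto
  have s0: "s q \<ge> 0" for q by (simp add: s_def)
  define S where "S = (torus \<times> torus) \<inter> h -` {e..}"
  have cpt: "compact (torus \<times> torus)" by (intro compact_Times) (auto simp: torus_def)
  then have "compact S" unfolding S_def
    by (intro compact_Int_closed closed_vimage hc) auto
  have pos: "s q > 0" if "q \<in> S" for q
  proof (rule ccontr)
    assume "\<not> s q > 0"
    then have "sin (pi * (fst q $ 1 - snd q $ 1)) = 0" "sin (pi * (fst q $ 2 - snd q $ 2)) = 0"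
      using s0[of q] by (auto simp: s_def add_nonneg_eq_0_iff sum_power2_gt_zero_iff)
    then have int: "fst q $ i - snd q $ i \<in> \<int>" for i
      using exhaust_2[of i] by (auto simp: sin_zero_iff_int2 Ints_def)
    have T: "fst q \<in> torus" "snd q \<in> torus" using that by (auto simp: S_def)
    have cases: "fst q $ i = snd q $ i \<or> fst q $ i \<in> {0,1} \<and> snd q $ i \<in> {0,1}" for i
    proof -
      obtain k :: int where k: "fst q $ i - snd q $ i = of_int k" using int[of i] by (auto elim: Ints_cases)
      have b: "0 \<le> fst q $ i" "fst q $ i \<le> 1" "0 \<le> snd q $ i" "snd q $ i \<le> 1"
        using T by (auto simp: torus_def mem_box_cart)
      then have "- 1 \<le> k" "k \<le> 1" using k by linarith+
      then consider "k = -1" | "k = 0" | "k = 1" by linarith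
      then show ?thesis using k b by cases auto
    qed
    have "g (fst q) = g (snd q)"
    proof (cases "fst q = snd q")
      case False
      then obtain i where "fst q $ i \<noteq> snd q $ i" by (auto simp: vec_eq_iff)
      then have "fst q $ i \<in> {0,1}" "snd q $ i \<in> {0,1}" using cases[of i] by auto
      then have "fst q \<in> torus - box 0 1" "snd q \<in> torus - box 0 1"
        using T by (auto simp: mem_box_cart intro!: exI[of _ i])
      then show ?thesis using g(2) by simp
    qed simp
    then show False using that \<open>e > 0\<close> \<open>p \<ge> 1\<close> by (auto simp: S_def h_def power_0_left)
  qed
  obtain d where d: "d > 0" "\<And>q. q \<in> S \<Longrightarrow> s q \<ge> d"
  proof (cases "S = {}")
    case False
    then obtain q0 where "q0 \<in> S" "\<And>q. q \<in> S \<Longrightarrow> s q0 \<le> s q"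
      using continuous_attains_inf[OF \<open>compact S\<close> False sc] by blast
    then show ?thesis using that pos by blast
  qed (use that[of 1] in auto)
  obtain B where B: "B > 0" "\<And>q. q \<in> torus \<times> torus \<Longrightarrow> \<bar>h q\<bar> \<le> B"
    using compact_imp_bounded[OF compact_continuous_image[OF hc cpt]] unfolding bounded_pos
    by (metis imageI real_norm_def)
  show thesis
  proof (rule that)
    show "B / d \<ge> 0" using B d by simp
    fix x y assume xy: "x \<in> torus" "y \<in> torus"
    have "h (x, y) \<le> e + B / d * s (x, y)"
    proof (cases "h (x, y) \<ge> e")
      case True
      then have "(x, y) \<in> S" using xy by (simp add: S_def)
      then have "B \<le> B / d * s (x, y)" using d B by (simp add: divide_simps mult_left_mono)
      then show ?thesis using B(2)[of "(x, y)"] xy \<open>e > 0\<close> by simp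
    next
      case False
      moreover have "B / d * s (x, y) \<ge> 0" using B d s0 by simp
      ultimately show ?thesis by linarith
    qed
    then show "\<bar>g x - g y\<bar> ^ p \<le> e + B / d * ((sin (pi * (x $ 1 - y $ 1)))\<^sup>2 + (sin (pi * (x $ 2 - y $ 2)))\<^sup>2)"
      by (simp add: h_def s_def)
  qed
qed


text \<open>The kernel has unit mass in either variable, so each occurrence of \<open>r\<close>
  contributes its own integral; the two sine moments contribute \<open>C / (2 * n + 2)\<close> each.
  The integrand has the shape of the upper bound used for \<open>kern2_energy\<close>.\<close>

lemma kern2_sum3_integral:
  assumes r: "integrable \<mu> r"
  shows "integrable (\<mu> \<Otimes>\<^sub>M \<mu>) (\<lambda>(x, y). kern2 n (x - y) * (r x + (a + C * ((sin (pi * (x $ 1 - y $ 1)))\<^sup>2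
      + (sin (pi * (x $ 2 - y $ 2)))\<^sup>2)) + r y))" (is "integrable _ ?F")
    and "(LINT p|(\<mu> \<Otimes>\<^sub>M \<mu>). (case p of (x, y) \<Rightarrow> kern2 n (x - y) * (r x + (a + C * ((sin (pi * (x $ 1 - y $ 1)))\<^sup>2
      + (sin (pi * (x $ 2 - y $ 2)))\<^sup>2)) + r y))) = 2 * (LINT x|\<mu>. r x) + a + C / (n + 1)"
proof -
  let ?s = "\<lambda>j z. kern2 n z * (sin (pi * (z $ j)))\<^sup>2"
  have tK: "torus_test_function (kern2 n)" by (rule torus_test_function_kern2)
  have ts: "torus_test_function (?s j)" for j
  proof -
    have "torus_test_function (\<lambda>z. (sin (pi * (z $ j)))\<^sup>2)"
      by (rule torus_test_function_coordinate[where g="\<lambda>s. (sin (pi * s))\<^sup>2"])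
        (intro smooth_intros smooth_ident_real, simp add: distrib_left)
    then show ?thesis by (intro torus_test_function_mult tK)
  qed
  have one: "integrable \<mu> (\<lambda>x. 1 :: real)" by simp
  note i1 = integrable_torus_prod_conv[OF r one tK] and i2 = integrable_torus_prod_conv[OF one r tK]
    and i3 = integrable_torus_prod_conv[OF one one tK] and i4 = integrable_torus_prod_conv[OF one one ts[of 1]]
    and i5 = integrable_torus_prod_conv[OF one one ts[of 2]]
  have eq: "?F = (\<lambda>p. (case p of (x, y) \<Rightarrow> r x * 1 * kern2 n (x - y)) + (case p of (x, y) \<Rightarrow> 1 * r y * kern2 n (x - y))
     + a * (case p of (x, y) \<Rightarrow> 1 * 1 * kern2 n (x - y)) + C * (case p of (x, y) \<Rightarrow> 1 * 1 * ?s 1 (x - y))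
     + C * (case p of (x, y) \<Rightarrow> 1 * 1 * ?s 2 (x - y)))"
    by (auto simp: fun_eq_iff algebra_simps)
  show "integrable (\<mu> \<Otimes>\<^sub>M \<mu>) ?F"
    unfolding eq by (intro Bochner_Integration.integrable_add integrable_mult_right i1 i2 i3 i4 i5)
  have e1: "(LINT p|(\<mu> \<Otimes>\<^sub>M \<mu>). (case p of (x, y) \<Rightarrow> r x * 1 * kern2 n (x - y))) = (LINT x|\<mu>. r x)"
    using torus_pair.integral_fst[OF i1] by (simp add: kern2_integral)
  have "(LINT x|\<mu>. kern2 n (x - y)) = 1" for y
    using kern2_integral[of n y] by (simp add: kern2_diff_commute)
  then have e2: "(LINT p|(\<mu> \<Otimes>\<^sub>M \<mu>). (case p of (x, y) \<Rightarrow> 1 * r y * kern2 n (x - y))) = (LINT x|\<mu>. r x)"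
    using torus_pair.integral_snd[OF i2] by simp
  have e3: "(LINT p|(\<mu> \<Otimes>\<^sub>M \<mu>). (case p of (x, y) \<Rightarrow> 1 * 1 * kern2 n (x - y))) = 1"
    using torus_pair.integral_fst[OF i3] by (simp add: kern2_integral)
  have e4: "(LINT p|(\<mu> \<Otimes>\<^sub>M \<mu>). (case p of (x, y) \<Rightarrow> 1 * 1 * ?s 1 (x - y))) = 1 / (2 * real n + 2)"
    using torus_pair.integral_fst[OF i4] by (simp add: kern2_moment)
  have e5: "(LINT p|(\<mu> \<Otimes>\<^sub>M \<mu>). (case p of (x, y) \<Rightarrow> 1 * 1 * ?s 2 (x - y))) = 1 / (2 * real n + 2)"
    using torus_pair.integral_fst[OF i5] by (simp add: kern2_moment)
  have "has_bochner_integral (\<mu> \<Otimes>\<^sub>M \<mu>) ?F ((LINT x|\<mu>. r x) + (LINT x|\<mu>. r x) + a * 1 +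
      C * (1 / (2 * real n + 2)) + C * (1 / (2 * real n + 2)))"
    unfolding eq
    by (intro has_bochner_integral_add has_bochner_integral_mult_right has_bochner_integral_iff[THEN iffD2] conjI
        i1 i2 i3 i4 i5 e1 e2 e3 e4 e5)
  then have "(LINT p|(\<mu> \<Otimes>\<^sub>M \<mu>). ?F p) = (LINT x|\<mu>. r x) + (LINT x|\<mu>. r x) + a * 1 +
      C * (1 / (2 * real n + 2)) + C * (1 / (2 * real n + 2))"
    by (rule has_bochner_integral_integral_eq)
  then show "(LINT p|(\<mu> \<Otimes>\<^sub>M \<mu>). ?F p) = 2 * (LINT x|\<mu>. r x) + a + C / (n + 1)"
    by (simp add: divide_simps) (simp add: algebra_simps)
qed

text \<open>The mean oscillation of \<open>f\<close> at the scale of the kernel. It dominates the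
  mollification error both in L^1, for \<open>p = 1\<close>, and in squared L^2, for
  \<open>p = 2\<close>, so one density argument serves both.\<close>

definition kern2_energy :: "nat \<Rightarrow> nat \<Rightarrow> (real ^ 2 \<Rightarrow> real) \<Rightarrow> real" where
  "kern2_energy p n f = (LINT q|(\<mu> \<Otimes>\<^sub>M \<mu>). (case q of (x, y) \<Rightarrow> kern2 n (x - y) * \<bar>f x - f y\<bar> ^ p))"

lemma integrable_kern2_energy:
  assumes f: "f \<in> borel_measurable \<mu>" "integrable \<mu> (\<lambda>x. \<bar>f x\<bar> ^ p)" and p: "p \<ge> 1"
  shows "integrable (\<mu> \<Otimes>\<^sub>M \<mu>) (\<lambda>(x, y). kern2 n (x - y) * \<bar>f x - f y\<bar> ^ p)"
proof (rule Bochner_Integration.integrable_bound)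
  let ?G = "\<lambda>(x, y). kern2 n (x - y) * (3 ^ p * \<bar>f x\<bar> ^ p + (0 + 0 * ((sin (pi * (x $ 1 - y $ 1)))\<^sup>2
      + (sin (pi * (x $ 2 - y $ 2)))\<^sup>2)) + 3 ^ p * \<bar>f y\<bar> ^ p)"
  show "integrable (\<mu> \<Otimes>\<^sub>M \<mu>) ?G"
    by (rule kern2_sum3_integral(1)) (use f in simp)
  show "(\<lambda>(x, y). kern2 n (x - y) * \<bar>f x - f y\<bar> ^ p) \<in> borel_measurable (\<mu> \<Otimes>\<^sub>M \<mu>)"
    unfolding case_prod_unfold
    using torus_test_function_prod_measurable[OF torus_test_function_kern2] torus_prod_fst_measurable[OF f(1)]
      torus_prod_snd_measurable[OF f(1)] by (intro borel_measurable_times borel_measurable_power borel_measurable_abs borel_measurable_diff)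
  have "\<bar>f x - f y\<bar> ^ p \<le> 3 ^ p * \<bar>f x\<bar> ^ p + 3 ^ p * \<bar>f y\<bar> ^ p" for x y
  proof -
    have "\<bar>f x - f y\<bar> ^ p \<le> (\<bar>f x\<bar> + 0 + \<bar>f y\<bar>) ^ p" by (intro power_mono) auto
    also have "\<dots> \<le> 3 ^ p * (\<bar>f x\<bar> ^ p + 0 ^ p + \<bar>f y\<bar> ^ p)" by (rule power_sum3_le) auto
    finally show ?thesis using p by (simp add: power_0_left distrib_left)
  qed
  then show "AE q in \<mu> \<Otimes>\<^sub>M \<mu>. norm (case q of (x, y) \<Rightarrow> kern2 n (x - y) * \<bar>f x - f y\<bar> ^ p) \<le> norm (?G q)"
    by (intro AE_I2) (auto simp: abs_mult kern2_nonneg intro!: mult_left_mono)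
qed

lemma kern2_energy_tendsto_0:
  assumes f: "f \<in> borel_measurable \<mu>" "integrable \<mu> (\<lambda>x. \<bar>f x\<bar> ^ p)" and p: "p \<ge> 1"
  shows "(\<lambda>n. kern2_energy p n f) \<longlonglongrightarrow> 0"
proof -
  have nonneg: "kern2_energy p n f \<ge> 0" for n
    unfolding kern2_energy_def by (intro Bochner_Integration.integral_nonneg) (auto simp: kern2_nonneg)
  have small: "\<exists>N. \<forall>n\<ge>N. kern2_energy p n f < e" if "e > 0" for e
  proof -
    \<comment> \<open>The budget: two copies of the integral of \<open>r\<close> cost less than e/2
      and the constant term costs e/4, leaving e/4 for the term that decays like 1/(n+1).\<close>
    define d where "d = e / (4 * 3 ^ p)"
    have d: "d > 0" using that by (simp add: d_def)
    obtain g where g: "continuous_on UNIV g" "\<And>x. x \<in> torus - box 0 1 \<Longrightarrow> g x = 0"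
      "integrable \<mu> (\<lambda>x. \<bar>f x - g x\<bar> ^ p)" "(LINT x|\<mu>. \<bar>f x - g x\<bar> ^ p) < d"
      using torus_density[OF f p d] by blast
    obtain C where C: "C \<ge> 0" "\<And>x y. x \<in> torus \<Longrightarrow> y \<in> torus \<Longrightarrow>
      \<bar>g x - g y\<bar> ^ p \<le> d + C * ((sin (pi * (x $ 1 - y $ 1)))\<^sup>2 + (sin (pi * (x $ 2 - y $ 2)))\<^sup>2)"
      using torus_modulus_of_continuity[OF g(1,2) p d] by blast
    define r where "r x = 3 ^ p * \<bar>f x - g x\<bar> ^ p" for x
    have r: "integrable \<mu> r" using g(3) by (simp add: r_def[abs_def])
    have pw: "\<bar>f x - f y\<bar> ^ p \<le> r x + (3 ^ p * d + 3 ^ p * C * ((sin (pi * (x $ 1 - y $ 1)))\<^sup>2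
      + (sin (pi * (x $ 2 - y $ 2)))\<^sup>2)) + r y" if "x \<in> torus" "y \<in> torus" for x y
    proof -
      have "\<bar>f x - f y\<bar> ^ p \<le> (\<bar>f x - g x\<bar> + \<bar>g x - g y\<bar> + \<bar>f y - g y\<bar>) ^ p"
        by (intro power_mono) auto
      also have "\<dots> \<le> 3 ^ p * (\<bar>f x - g x\<bar> ^ p + \<bar>g x - g y\<bar> ^ p + \<bar>f y - g y\<bar> ^ p)"
        by (rule power_sum3_le) auto
      also have "\<dots> \<le> 3 ^ p * (\<bar>f x - g x\<bar> ^ p + (d + C * ((sin (pi * (x $ 1 - y $ 1)))\<^sup>2
          + (sin (pi * (x $ 2 - y $ 2)))\<^sup>2)) + \<bar>f y - g y\<bar> ^ p)"
        using C(2)[OF that] by (intro mult_left_mono add_mono) auto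
      finally show ?thesis by (simp add: r_def algebra_simps)
    qed
    have le: "kern2_energy p n f \<le> 2 * (LINT x|\<mu>. r x) + 3 ^ p * d + 3 ^ p * C / (n + 1)" for n
    proof -
      have "kern2_energy p n f \<le> (LINT q|(\<mu> \<Otimes>\<^sub>M \<mu>). (case q of (x, y) \<Rightarrow> kern2 n (x - y) *
          (r x + (3 ^ p * d + 3 ^ p * C * ((sin (pi * (x $ 1 - y $ 1)))\<^sup>2 + (sin (pi * (x $ 2 - y $ 2)))\<^sup>2)) + r y)))"
        unfolding kern2_energy_def
      proof (rule integral_mono[OF integrable_kern2_energy[OF f p] kern2_sum3_integral(1)[OF r]])
        fix q assume "q \<in> space (\<mu> \<Otimes>\<^sub>M \<mu>)"
        then have "fst q \<in> torus" "snd q \<in> torus" by (auto simp: space_pair_measure)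
        from mult_left_mono[OF pw[OF this] kern2_nonneg[of n "fst q - snd q"]]
        show "(case q of (x, y) \<Rightarrow> kern2 n (x - y) * \<bar>f x - f y\<bar> ^ p) \<le> (case q of (x, y) \<Rightarrow> kern2 n (x - y) *
          (r x + (3 ^ p * d + 3 ^ p * C * ((sin (pi * (x $ 1 - y $ 1)))\<^sup>2 + (sin (pi * (x $ 2 - y $ 2)))\<^sup>2)) + r y))"
          by (simp only: case_prod_unfold)
      qed
      then show ?thesis unfolding kern2_sum3_integral(2)[OF r] .
    qed
    have "2 * (LINT x|\<mu>. r x) < 2 * (3 ^ p * d)" using g(4) by (simp add: r_def[abs_def])
    moreover have "3 ^ p * d = e / 4" by (simp add: d_def)
    ultimately have le': "kern2_energy p n f < 3 * (e / 4) + 3 ^ p * C / (n + 1)" for n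
      using le[of n] by linarith
    obtain N :: nat where N: "real N > 3 ^ p * C / (e / 4)" using reals_Archimedean2 by blast
    have tail: "3 ^ p * C / (n + 1) \<le> e / 4" if "n \<ge> N" for n
    proof -
      have "3 ^ p * C / (e / 4) \<le> real n + 1" using N that by linarith
      then show ?thesis using \<open>e > 0\<close> by (simp add: divide_simps mult_ac add.commute)
    qed
    have "a < e" if "a < 3 * (e / 4) + c" "c \<le> e / 4" for a c
      using that by linarith
    from this[OF le' tail] have "kern2_energy p n f < e" if "n \<ge> N" for n
      using that by blast
    then show ?thesis by blast
  qed
  show ?thesis
  proof (rule LIMSEQ_I)
    fix e :: real assume "0 < e"
    then show "\<exists>N. \<forall>n\<ge>N. norm (kern2_energy p n f - 0) < e"
      using small[of e] nonneg by simp
  qed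
qed

section \<open>Convergence and boundedness of mollification\<close>

lemma conv_kern2_diff:
  assumes "integrable \<mu> f"
  shows "conv f (kern2 n) x - f x = (LINT y|\<mu>. (f y - f x) * kern2 n (x - y))"
proof -
  have "(LINT y|\<mu>. (f y - f x) * kern2 n (x - y)) = (LINT y|\<mu>. f y * kern2 n (x - y) - f x * kern2 n (x - y))"
    by (simp add: algebra_simps)
  also have "\<dots> = conv f (kern2 n) x - f x"
    using conv_integrable[OF assms torus_test_function_kern2]
      conv_integrable[OF _ torus_test_function_kern2, of "\<lambda>_. 1"]
    by (subst Bochner_Integration.integral_diff) (simp_all add: conv_def kern2_integral)
  finally show ?thesis by simp
qed

lemma conv_measurable:
  "integrable \<mu> f \<Longrightarrow> torus_test_function H \<Longrightarrow> conv f H \<in> borel_measurable \<mu>"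
  by (intro torus_test_function_measurable torus_test_function_conv)

lemma kern2_conv_tendsto_L1:
  assumes f: "integrable \<mu> f"
  shows "(\<lambda>n. LINT x|\<mu>. \<bar>conv f (kern2 n) x - f x\<bar>) \<longlonglongrightarrow> 0"
proof (rule tendsto_sandwich[OF _ _ tendsto_const])
  have f': "f \<in> borel_measurable \<mu>" "integrable \<mu> (\<lambda>x. \<bar>f x\<bar> ^ 1)" using f by auto
  show "(\<lambda>n. kern2_energy 1 n f) \<longlonglongrightarrow> 0" by (rule kern2_energy_tendsto_0[OF f']) simp
  have "(LINT x|\<mu>. \<bar>conv f (kern2 n) x - f x\<bar>) \<le> kern2_energy 1 n f" for n
  proof -
    note i = integrable_kern2_energy[OF f', of n]
    have "(LINT x|\<mu>. \<bar>conv f (kern2 n) x - f x\<bar>) \<le> (LINT x|\<mu>. LINT y|\<mu>. kern2 n (x - y) * \<bar>f x - f y\<bar> ^ 1)"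
    proof (rule integral_mono)
      show "integrable \<mu> (\<lambda>x. \<bar>conv f (kern2 n) x - f x\<bar>)"
        using f torus_test_function_integrable[OF torus_test_function_conv[OF f torus_test_function_kern2]] by auto
      show "integrable \<mu> (\<lambda>x. LINT y|\<mu>. kern2 n (x - y) * \<bar>f x - f y\<bar> ^ 1)"
        using torus_pair.integrable_fst[OF i] by simp
      fix x
      show "\<bar>conv f (kern2 n) x - f x\<bar> \<le> (LINT y|\<mu>. kern2 n (x - y) * \<bar>f x - f y\<bar> ^ 1)"
        unfolding conv_kern2_diff[OF f]
        by (rule order_trans[OF integral_abs_bound])
          (simp add: abs_mult kern2_nonneg abs_minus_commute mult.commute)
    qed
    then show ?thesis using torus_pair.integral_fst[OF i] by (simp add: kern2_energy_def)
  qed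
  then show "\<forall>\<^sub>F n in sequentially. (LINT x|\<mu>. \<bar>conv f (kern2 n) x - f x\<bar>) \<le> kern2_energy 1 n f" by simp
qed simp

text \<open>The mollification error at \<open>x\<close> is an average of \<open>f y - f x\<close>
  against the density \<open>kern2 n (x - y)\<close>, so Jensen bounds its square by the averaged
  square, whose integral is the energy for exponent 2.\<close>

lemma kern2_conv_tendsto_L2:
  assumes f: "sq_integrable f"
  shows "(\<lambda>n. LINT x|\<mu>. (conv f (kern2 n) x - f x)\<^sup>2) \<longlonglongrightarrow> 0"
proof (rule tendsto_sandwich[OF _ _ tendsto_const])
  have f': "f \<in> borel_measurable \<mu>" "integrable \<mu> (\<lambda>x. \<bar>f x\<bar> ^ 2)"
    using f by (auto simp: sq_integrable_def)
  note f1 = sq_integrable_integrable[OF f]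
  show "(\<lambda>n. kern2_energy 2 n f) \<longlonglongrightarrow> 0" by (rule kern2_energy_tendsto_0[OF f']) simp
  have "(LINT x|\<mu>. (conv f (kern2 n) x - f x)\<^sup>2) \<le> kern2_energy 2 n f" for n
  proof -
    note i = integrable_kern2_energy[OF f', of n]
    have tK: "torus_test_function (\<lambda>y. kern2 n (x - y))" for x
      by (rule torus_test_function_reflect[OF torus_test_function_kern2])
    have sq: "sq_integrable (\<lambda>x. conv f (kern2 n) x - f x)"
      by (intro sq_integrable_diff f sq_integrable_test_function torus_test_function_conv f1 torus_test_function_kern2)
    have "(LINT x|\<mu>. (conv f (kern2 n) x - f x)\<^sup>2) \<le> (LINT x|\<mu>. LINT y|\<mu>. kern2 n (x - y) * \<bar>f x - f y\<bar> ^ 2)"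
    proof (rule integral_mono)
      show "integrable \<mu> (\<lambda>x. (conv f (kern2 n) x - f x)\<^sup>2)"
        using sq by (simp add: sq_integrable_def)
      show "integrable \<mu> (\<lambda>x. LINT y|\<mu>. kern2 n (x - y) * \<bar>f x - f y\<bar> ^ 2)"
        using torus_pair.integrable_fst[OF i] by simp
      fix x
      have "sq_integrable (\<lambda>y. f y - f x)"
        by (intro sq_integrable_diff f sq_integrable_test_function torus_test_function_const)
      from torus_weighted_jensen[OF this tK[of x]]
      have "(conv f (kern2 n) x - f x)\<^sup>2 \<le> (LINT y|\<mu>. (f y - f x)\<^sup>2 * kern2 n (x - y))"
        by (simp add: conv_kern2_diff[OF f1] kern2_nonneg kern2_integral)
      then show "(conv f (kern2 n) x - f x)\<^sup>2 \<le> (LINT y|\<mu>. kern2 n (x - y) * \<bar>f x - f y\<bar> ^ 2)"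
        by (simp add: mult.commute power2_commute)
    qed
    then show ?thesis using torus_pair.integral_fst[OF i] by (simp add: kern2_energy_def)
  qed
  then show "\<forall>\<^sub>F n in sequentially. (LINT x|\<mu>. (conv f (kern2 n) x - f x)\<^sup>2) \<le> kern2_energy 2 n f" by simp
qed simp

text \<open>Jensen under the density \<open>w\<close>, followed by Fubini, gives constant 1.
  Domination by a density covers both the mollifier, with \<open>w\<close> equal to
  \<open>H\<close>, and the signed kernels of the potential.\<close>

lemma weighted_conv_L2_bound:
  assumes f: "sq_integrable f" and H: "torus_test_function H" "torus_test_function w" "\<And>z. \<bar>H z\<bar> \<le> w z"
    and w: "\<And>x. (LINT y|\<mu>. w (x - y)) = 1" "\<And>y. (LINT x|\<mu>. w (x - y)) = 1"
  shows "(LINT x|\<mu>. (conv f H x)\<^sup>2) \<le> (LINT x|\<mu>. (f x)\<^sup>2)"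
proof -
  have f2: "integrable \<mu> (\<lambda>x. (f x)\<^sup>2)" using f by (simp add: sq_integrable_def)
  note f1 = sq_integrable_integrable[OF f]
  have wn: "w z \<ge> 0" for z using H(3)[of z] by linarith
  have fa: "sq_integrable (\<lambda>y. \<bar>f y\<bar>)" using f by (auto simp: sq_integrable_def)
  have pw: "(conv f H x)\<^sup>2 \<le> conv (\<lambda>y. (f y)\<^sup>2) w x" for x
  proof -
    have "\<bar>conv f H x\<bar> \<le> (LINT y|\<mu>. \<bar>f y * H (x - y)\<bar>)"
      unfolding conv_def by (rule integral_abs_bound)
    also have "\<dots> \<le> (LINT y|\<mu>. \<bar>f y\<bar> * w (x - y))"
      by (intro integral_mono integrable_abs conv_integrable f1 H)
        (use H(3) in \<open>auto simp: abs_mult intro!: mult_left_mono\<close>)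
    finally have "(conv f H x)\<^sup>2 \<le> (LINT y|\<mu>. \<bar>f y\<bar> * w (x - y))\<^sup>2"
      by (metis abs_le_square_iff abs_of_nonneg order_trans abs_ge_zero)
    also have "\<dots> \<le> (LINT y|\<mu>. \<bar>f y\<bar>\<^sup>2 * w (x - y))"
      by (rule torus_weighted_jensen[OF fa torus_test_function_reflect[OF H(2)]]) (auto simp: wn w)
    finally show ?thesis by (simp add: conv_def)
  qed
  have "(LINT x|\<mu>. (conv f H x)\<^sup>2) \<le> (LINT x|\<mu>. conv (\<lambda>y. (f y)\<^sup>2) w x)"
  proof (rule integral_mono[OF _ _ pw])
    show "integrable \<mu> (\<lambda>x. (conv f H x)\<^sup>2)"
      using sq_integrable_test_function[OF torus_test_function_conv[OF f1 H(1)]] by (simp add: sq_integrable_def)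
    show "integrable \<mu> (conv (\<lambda>y. (f y)\<^sup>2) w)"
      by (rule torus_test_function_integrable[OF torus_test_function_conv[OF f2 H(2)]])
  qed
  also have "\<dots> = (LINT y|\<mu>. (f y)\<^sup>2)"
    using conv_fubini[OF f2 _ H(2), of "\<lambda>_. 1"] w by simp
  finally show ?thesis .
qed

lemma kern2_conv_L2_bound:
  assumes "sq_integrable f"
  shows "(LINT x|\<mu>. (conv f (kern2 n) x)\<^sup>2) \<le> (LINT x|\<mu>. (f x)\<^sup>2)"
proof (rule weighted_conv_L2_bound[OF assms torus_test_function_kern2 torus_test_function_kern2[of n]])
  show "(LINT x|\<mu>. kern2 n (x - y)) = 1" for y
    using kern2_integral[of n y] by (simp add: kern2_diff_commute)
qed (simp_all add: kern2_nonneg kern2_integral)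


subsection \<open>The mollified magnetic potential\<close>

abbreviation partial :: "2 \<Rightarrow> (real ^ 2 \<Rightarrow> real) \<Rightarrow> real ^ 2 \<Rightarrow> real" where
  "partial j H x \<equiv> frechet_derivative H (at x) (axis j 1)"

lemma torus_test_function_partial:
  "torus_test_function H \<Longrightarrow> torus_test_function (partial j H)"
  by (rule torus_test_function_frechet_derivative)

lemma partial_coordinate_product:
  assumes "\<And>s. (g has_real_derivative g' s) (at s)" "\<And>s. (h has_real_derivative h' s) (at s)"
  shows "partial 1 (\<lambda>z. g (z $ 1) * h (z $ 2)) z = g' (z $ 1) * h (z $ 2)"
    and "partial 2 (\<lambda>z. g (z $ 1) * h (z $ 2)) z = g (z $ 1) * h' (z $ 2)"
proof -
  have g: "((\<lambda>z. g (z $ 1)) has_derivative (\<lambda>v. g' (z $ 1) * v $ 1)) (at z)"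
    by (rule has_derivative_compose[OF bounded_linear_imp_has_derivative[OF bounded_linear_vec_nth]
          assms(1)[THEN has_field_derivative_imp_has_derivative]])
  have h: "((\<lambda>z. h (z $ 2)) has_derivative (\<lambda>v. h' (z $ 2) * v $ 2)) (at z)"
    by (rule has_derivative_compose[OF bounded_linear_imp_has_derivative[OF bounded_linear_vec_nth]
          assms(2)[THEN has_field_derivative_imp_has_derivative]])
  note D = frechet_derivative_at[OF has_derivative_mult[OF g h], symmetric]
  show "partial 1 (\<lambda>z. g (z $ 1) * h (z $ 2)) z = g' (z $ 1) * h (z $ 2)"
    by (subst D) (simp add: axis_def)
  show "partial 2 (\<lambda>z. g (z $ 1) * h (z $ 2)) z = g (z $ 1) * h' (z $ 2)"
    by (subst D) (simp add: axis_def)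
qed

lemma partial_reflect:
  assumes "torus_test_function H"
  shows "partial j (\<lambda>y. H (x - y)) y = - partial j H (x - y)"
proof -
  have "((\<lambda>y. H (x - y)) has_derivative (\<lambda>v. frechet_derivative H (at (x - y)) (- v))) (at y)"
    by (rule has_derivative_compose[OF _ torus_test_function_has_derivative[OF assms]])
      (auto intro!: derivative_eq_intros)
  from frechet_derivative_at[OF this, symmetric]
  have "partial j (\<lambda>y. H (x - y)) y = frechet_derivative H (at (x - y)) (- axis j 1)" by simp
  also have "\<dots> = - partial j H (x - y)"
    by (rule linear_neg[OF bounded_linear.linear[OF
          has_derivative_bounded_linear[OF torus_test_function_has_derivative[OF assms]]]])
  finally show ?thesis .
qed

lemma partial_mult:
  assumes "torus_test_function f" "torus_test_function g"
  shows "partial j (\<lambda>x. f x * g x) x = f x * partial j g x + partial j f x * g x"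
  using frechet_derivative_at[OF has_derivative_mult[OF assms[THEN torus_test_function_has_derivative]], symmetric]
  by (rule fun_cong)

lemma partial_sin:
  assumes "torus_test_function f"
  shows "partial j (\<lambda>x. sin (f x)) x = cos (f x) * partial j f x"
proof -
  have "((\<lambda>x. sin (f x)) has_derivative (\<lambda>v. frechet_derivative f (at x) v * cos (f x))) (at x)"
    by (rule has_derivative_sin[OF torus_test_function_has_derivative[OF assms]])
  from frechet_derivative_at[OF this, symmetric] show ?thesis by simp
qed

lemma partial_minus_cos:
  assumes "torus_test_function f"
  shows "partial j (\<lambda>x. - cos (f x)) x = sin (f x) * partial j f x"
proof -
  have "((\<lambda>x. - cos (f x)) has_derivative (\<lambda>v. - (frechet_derivative f (at x) v * - sin (f x)))) (at x)"
    by (rule has_derivative_minus[OF has_derivative_cos[OF torus_test_function_has_derivative[OF assms]]])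
  from frechet_derivative_at[OF this, symmetric] show ?thesis by simp
qed

definition div_free :: "(real ^ 2 \<Rightarrow> real) \<Rightarrow> (real ^ 2 \<Rightarrow> real) \<Rightarrow> bool" where
  "div_free f g \<longleftrightarrow> (\<forall>\<psi>. torus_test_function \<psi> \<longrightarrow>
     (LINT x|\<mu>. f x * partial 1 \<psi> x + g x * partial 2 \<psi> x) = 0)"

definition shear_kernel :: "nat \<Rightarrow> real ^ 2 \<Rightarrow> real" where
  "shear_kernel n z = kern n (z $ 1) * kern_prim n (z $ 2)"

definition line_kernel :: "nat \<Rightarrow> real ^ 2 \<Rightarrow> real" where
  "line_kernel n z = kern_prim n (z $ 1)"

text \<open>
  The vector kernel \<open>G = (shear_kernel n, - line_kernel n)\<close> solves
  \<open>curl\<^sub>y G(x - y) = 1 - kern2 n (x - y)\<close>. Its product structure makes this explicit: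
  \<open>1 - k(z\<^sub>1) k(z\<^sub>2) = (1 - k(z\<^sub>1)) + k(z\<^sub>1) (1 - k(z\<^sub>2))\<close>.
\<close>

definition potential :: "nat \<Rightarrow> (real ^ 2 \<Rightarrow> real) \<Rightarrow> (real ^ 2 \<Rightarrow> real) \<Rightarrow> real ^ 2 \<Rightarrow> real" where
  "potential n f g x = conv f (shear_kernel n) x - conv g (line_kernel n) x"

lemma torus_test_function_shear_kernel: "torus_test_function (shear_kernel n)"
  unfolding shear_kernel_def[abs_def]
  by (intro torus_test_function_mult torus_test_function_kern torus_test_function_kern_prim)

lemma torus_test_function_line_kernel: "torus_test_function (line_kernel n)"
  unfolding line_kernel_def[abs_def] by (rule torus_test_function_kern_prim)

lemma torus_test_function_potential:
  "integrable \<mu> f \<Longrightarrow> integrable \<mu> g \<Longrightarrow> torus_test_function (potential n f g)"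
  unfolding potential_def[abs_def]
  by (intro torus_test_function_diff torus_test_function_conv torus_test_function_shear_kernel
      torus_test_function_line_kernel)

lemma kern_differentiable: "(kern n has_real_derivative deriv (kern n) s) (at s)"
proof -
  have "(kern n has_derivative frechet_derivative (kern n) (at s)) (at s)"
    by (rule smooth_has_derivative[OF kern_smooth])
  then show ?thesis
    by (metis DERIV_deriv_iff_real_differentiable differentiable_def)
qed

lemma partial_shear_kernel:
  "partial 1 (shear_kernel n) z = deriv (kern n) (z $ 1) * kern_prim n (z $ 2)"
  "partial 2 (shear_kernel n) z = kern n (z $ 1) * (kern n (z $ 2) - 1)"
  unfolding shear_kernel_def[abs_def]
  by (rule partial_coordinate_product[OF kern_differentiable kern_prim_derivative])+

lemma partial_line_kernel:
  "partial 1 (line_kernel n) z = kern n (z $ 1) - 1"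
  "partial 2 (line_kernel n) z = 0"
  using partial_coordinate_product[OF kern_prim_derivative[of n] DERIV_const[of 1], of z]
  by (simp_all add: line_kernel_def[abs_def])

text \<open>Testing \<open>div_free\<close> with a reflected kernel trades one partial derivative
  for the other. With \<open>line_kernel\<close> it removes the one-variable marginal from the
  second derivative; with \<open>shear_kernel\<close> it rewrites the first, where the marginal
  terms of \<open>g\<close> cancel. The zero means dispose of the constant 1 in
  \<open>kern n (z $ 1) - 1\<close>.\<close>

lemma partial_potential:
  assumes f: "integrable \<mu> f" and g: "integrable \<mu> g" and "div_free f g"
    and mean: "(LINT x|\<mu>. f x) = 0" "(LINT x|\<mu>. g x) = 0"
  shows "partial 1 (potential n f g) x = - conv g (kern2 n) x"
    and "partial 2 (potential n f g) x = conv f (kern2 n) x"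
proof -
  note ts = torus_test_function_shear_kernel[of n] and tl = torus_test_function_line_kernel[of n]
    and tk = torus_test_function_kern2[of n] and tk1 = torus_test_function_kern[of n 1]
  have D: "partial j (potential n f g) x = conv f (partial j (shear_kernel n)) x - conv g (partial j (line_kernel n)) x" for j
  proof -
    have "(potential n f g has_derivative (\<lambda>h. conv f (\<lambda>z. frechet_derivative (shear_kernel n) (at z) h) x
       - conv g (\<lambda>z. frechet_derivative (line_kernel n) (at z) h) x)) (at x)"
      unfolding potential_def[abs_def]
      by (intro has_derivative_diff conv_has_derivative f g ts tl)
    from frechet_derivative_at[OF this, symmetric] show ?thesis by simp
  qed
  have test: "conv f (partial 1 H) x + conv g (partial 2 H) x = 0" if H: "torus_test_function H" for H
  proof -
    have "(LINT y|\<mu>. f y * partial 1 (\<lambda>y. H (x - y)) y + g y * partial 2 (\<lambda>y. H (x - y)) y) = 0"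
      using \<open>div_free f g\<close> torus_test_function_reflect[OF H] by (simp add: div_free_def)
    then have "(LINT y|\<mu>. - (f y * partial 1 H (x - y) + g y * partial 2 H (x - y))) = 0"
      by (simp add: partial_reflect[OF H])
    then have "(LINT y|\<mu>. f y * partial 1 H (x - y) + g y * partial 2 H (x - y)) = 0"
      by (simp only: Bochner_Integration.integral_minus neg_equal_0_iff_equal)
    then show ?thesis
      using conv_integrable[OF f torus_test_function_partial[OF H]]
        conv_integrable[OF g torus_test_function_partial[OF H]] by (simp add: conv_def)
  qed
  have k1: "conv f (\<lambda>z. kern n (z $ 1)) x = 0"
  proof -
    have "conv f (\<lambda>z. kern n (z $ 1) - 1) x = 0"
      using test[OF tl] by (simp add: partial_line_kernel) (simp add: conv_def)
    then show ?thesis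
      using conv_diff[OF f tk1 torus_test_function_const[of 1]] mean by (simp add: conv_def)
  qed
  have split: "conv h (\<lambda>z. kern n (z $ 1) * (kern n (z $ 2) - 1)) x = conv h (kern2 n) x - conv h (\<lambda>z. kern n (z $ 1)) x"
    if "integrable \<mu> h" for h
    using conv_diff[OF that tk tk1, of x] by (simp add: kern2_def[abs_def] right_diff_distrib)
  show "partial 2 (potential n f g) x = conv f (kern2 n) x"
    unfolding D partial_shear_kernel partial_line_kernel split[OF f] k1 by (simp add: conv_def)
  have "conv g (\<lambda>z. kern n (z $ 1) - 1) x = conv g (\<lambda>z. kern n (z $ 1)) x"
    using conv_diff[OF g tk1 torus_test_function_const[of 1], of x] mean by (simp add: conv_def)
  moreover have "conv f (partial 1 (shear_kernel n)) x = - (conv g (kern2 n) x - conv g (\<lambda>z. kern n (z $ 1)) x)"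
    using test[OF ts] unfolding partial_shear_kernel(2) split[OF g] by linarith
  ultimately show "partial 1 (potential n f g) x = - conv g (kern2 n) x"
    unfolding D partial_line_kernel by simp
qed

text \<open>A Poincare inequality with a constant independent of \<open>n\<close>: by
  \<open>kern_prim_bound\<close> the two kernels are dominated by the densities
  \<open>kern n (z $ 1)\<close> and 1, and the square of a difference costs a factor 2.\<close>

lemma potential_L2_bound:
  assumes f: "sq_integrable f" and g: "sq_integrable g"
  shows "(LINT x|\<mu>. (potential n f g x)\<^sup>2) \<le> 2 * ((LINT x|\<mu>. (f x)\<^sup>2) + (LINT x|\<mu>. (g x)\<^sup>2))"
proof -
  note ts = torus_test_function_shear_kernel[of n] and tl = torus_test_function_line_kernel[of n]
  note f1 = sq_integrable_integrable[OF f] and g1 = sq_integrable_integrable[OF g]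
  have swap: "kern n (x $ 1 - y $ 1) = kern n (y $ 1 - x $ 1)" for x y :: "real^2" by (rule kern_even_diff)
  have 1: "(LINT x|\<mu>. (conv f (shear_kernel n) x)\<^sup>2) \<le> (LINT x|\<mu>. (f x)\<^sup>2)"
  proof (rule weighted_conv_L2_bound[OF f ts torus_test_function_kern[of n 1]])
    show "\<bar>shear_kernel n z\<bar> \<le> kern n (z $ 1)" for z
      using mult_left_mono[OF kern_prim_bound[of n "z $ 2"] kern_nonneg[of n "z $ 1"]]
      by (simp add: shear_kernel_def abs_mult kern_nonneg)
    show "(LINT y|\<mu>. kern n ((x - y) $ 1)) = 1" for x
      using kern_marginal_integral[of n x] by simp
    show "(LINT x|\<mu>. kern n ((x - y) $ 1)) = 1" for y
      using kern_marginal_integral[of n y] by (simp add: kern_even_diff[of n _ "y $ 1"])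
  qed
  have 2: "(LINT x|\<mu>. (conv g (line_kernel n) x)\<^sup>2) \<le> (LINT x|\<mu>. (g x)\<^sup>2)"
    by (rule weighted_conv_L2_bound[OF g tl torus_test_function_const[of 1]])
      (simp_all add: line_kernel_def kern_prim_bound)
  have sq: "integrable \<mu> (\<lambda>x. (conv f (shear_kernel n) x)\<^sup>2)" "integrable \<mu> (\<lambda>x. (conv g (line_kernel n) x)\<^sup>2)"
    using sq_integrable_test_function[OF torus_test_function_conv[OF f1 ts]]
      sq_integrable_test_function[OF torus_test_function_conv[OF g1 tl]] by (auto simp: sq_integrable_def)
  have "(LINT x|\<mu>. (potential n f g x)\<^sup>2)
    \<le> (LINT x|\<mu>. 2 * ((conv f (shear_kernel n) x)\<^sup>2 + (conv g (line_kernel n) x)\<^sup>2))"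
  proof (rule integral_mono)
    show "integrable \<mu> (\<lambda>x. (potential n f g x)\<^sup>2)"
      using sq_integrable_test_function[OF torus_test_function_potential[OF f1 g1]] by (simp add: sq_integrable_def)
    fix x
    have "(p - q)\<^sup>2 \<le> 2 * (p\<^sup>2 + q\<^sup>2)" for p q :: real
      using zero_le_power2[of "p + q"] by (simp add: power2_sum power2_diff)
    then show "(potential n f g x)\<^sup>2 \<le> 2 * ((conv f (shear_kernel n) x)\<^sup>2 + (conv g (line_kernel n) x)\<^sup>2)"
      unfolding potential_def .
  qed (use sq in simp)
  also have "\<dots> = 2 * ((LINT x|\<mu>. (conv f (shear_kernel n) x)\<^sup>2) + (LINT x|\<mu>. (conv g (line_kernel n) x)\<^sup>2))"
    using sq by simp
  also have "\<dots> \<le> 2 * ((LINT x|\<mu>. (f x)\<^sup>2) + (LINT x|\<mu>. (g x)\<^sup>2))"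
    using 1 2 by simp
  finally show ?thesis .
qed

section \<open>The cosine energy of a potential\<close>

definition cos_energy :: "(real ^ 2 \<Rightarrow> real) \<Rightarrow> real" where
  "cos_energy a = (LINT x|\<mu>. 1 - cos (a x))"

lemma one_minus_cos_le: "1 - cos x \<le> x\<^sup>2 / 2" for x :: real
proof -
  have "1 - cos x = 2 * (sin (x / 2))\<^sup>2"
    using cos_double_sin[of "x / 2"] by simp
  also have "\<dots> \<le> 2 * (x / 2)\<^sup>2"
    using abs_le_square_iff[of "sin (x / 2)" "x / 2"] abs_sin_x_le_abs_x[of "x / 2"] by simp
  finally show ?thesis by (simp add: power2_eq_square)
qed

lemma cos_energy_le:
  assumes "torus_test_function a"
  shows "cos_energy a \<le> (LINT x|\<mu>. (a x)\<^sup>2) / 2"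
proof -
  have "cos_energy a \<le> (LINT x|\<mu>. (a x)\<^sup>2 / 2)"
    unfolding cos_energy_def
  proof (rule integral_mono)
    show "integrable \<mu> (\<lambda>x. 1 - cos (a x))"
      by (intro torus_test_function_integrable torus_test_function_diff torus_test_function_const
          torus_test_function_cos assms)
    show "integrable \<mu> (\<lambda>x. (a x)\<^sup>2 / 2)"
      using sq_integrable_test_function[OF assms] by (simp add: sq_integrable_def)
  qed (rule one_minus_cos_le)
  then show ?thesis by simp
qed

lemma cos_energy_nonneg: "cos_energy a \<ge> 0"
  unfolding cos_energy_def by (intro Bochner_Integration.integral_nonneg) simp

lemma sq_le_two_one_minus_cos:
  "(sin x)\<^sup>2 \<le> 2 * (1 - cos x)" "(1 - cos x)\<^sup>2 \<le> 2 * (1 - cos x)" for x :: real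
proof -
  have "(1 - cos x) * (1 + cos x) \<le> (1 - cos x) * 2" "(1 - cos x) * (1 - cos x) \<le> (1 - cos x) * 2"
    using cos_ge_minus_one[of x] by (intro mult_left_mono; simp)+
  then show "(sin x)\<^sup>2 \<le> 2 * (1 - cos x)" "(1 - cos x)\<^sup>2 \<le> 2 * (1 - cos x)"
    unfolding sin_squared_eq by (simp_all add: power2_eq_square algebra_simps)
qed

text \<open>
  Split \<open>\<partial>\<^sub>j a = cos a \<partial>\<^sub>j a + (1 - cos a) \<partial>\<^sub>j a\<close>; the first summand is \<open>\<partial>\<^sub>j (sin a)\<close> and is integrated by
  parts, and both \<open>sin\<^sup>2 a\<close> and \<open>(1 - cos a)\<^sup>2\<close> are at most \<open>2 (1 - cos a)\<close>.
\<close>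

lemma cos_energy_controls_gradient:
  assumes a: "torus_test_function a" and \<psi>: "torus_test_function \<psi>"
    and S: "\<And>x. \<bar>\<psi> x\<bar> \<le> S" and S': "\<And>x. \<bar>partial j \<psi> x\<bar> \<le> S'"
  shows "\<bar>LINT x|\<mu>. partial j a x * \<psi> x\<bar>
    \<le> sqrt (2 * cos_energy a) * (S' + S * sqrt (LINT x|\<mu>. (partial j a x)\<^sup>2))"
proof -
  note ts = torus_test_function_sin[OF a] and tc = torus_test_function_cos[OF a]
    and tD = torus_test_function_partial[OF a] and tD' = torus_test_function_partial[OF \<psi>]
  have t1c: "torus_test_function (\<lambda>x. 1 - cos (a x))"
    by (intro torus_test_function_diff torus_test_function_const tc)
  have S0: "S \<ge> 0" "S' \<ge> 0" using S[of 0] S'[of 0] by linarith+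
  define E where "E = 2 * cos_energy a"
  have E: "(LINT x|\<mu>. 2 * (1 - cos (a x))) = E" by (simp only: E_def cos_energy_def integral_mult_right_zero)
  have Ei: "integrable \<mu> (\<lambda>x. 2 * (1 - cos (a x)))"
    by (intro integrable_mult_right torus_test_function_integrable t1c)
  have sinE: "(LINT x|\<mu>. (sin (a x))\<^sup>2) \<le> E"
    unfolding E[symmetric] using sq_integrable_test_function[OF ts] Ei
    by (intro integral_mono sq_le_two_one_minus_cos(1)) (simp_all add: sq_integrable_def)
  have cosE: "(LINT x|\<mu>. (1 - cos (a x))\<^sup>2) \<le> E"
    unfolding E[symmetric] using sq_integrable_test_function[OF t1c] Ei
    by (intro integral_mono sq_le_two_one_minus_cos(2)) (simp_all add: sq_integrable_def)
  have "0 = (LINT x|\<mu>. sin (a x) * partial j \<psi> x + cos (a x) * partial j a x * \<psi> x)"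
    using torus_integral_derivative_zero[OF torus_test_function_mult[OF ts \<psi>], of j]
    by (simp add: partial_mult[OF ts \<psi>] partial_sin[OF a])
  also have "\<dots> = (LINT x|\<mu>. sin (a x) * partial j \<psi> x) + (LINT x|\<mu>. cos (a x) * partial j a x * \<psi> x)"
    by (intro Bochner_Integration.integral_add torus_test_function_integrable torus_test_function_mult ts tc tD tD' \<psi>)
  finally have ibp: "(LINT x|\<mu>. cos (a x) * partial j a x * \<psi> x) = - (LINT x|\<mu>. sin (a x) * partial j \<psi> x)"
    by linarith
  have "(LINT x|\<mu>. partial j a x * \<psi> x)
    = (LINT x|\<mu>. cos (a x) * partial j a x * \<psi> x + (1 - cos (a x)) * (partial j a x * \<psi> x))"
    by (simp add: algebra_simps)
  also have "\<dots> = (LINT x|\<mu>. cos (a x) * partial j a x * \<psi> x) + (LINT x|\<mu>. (1 - cos (a x)) * (partial j a x * \<psi> x))"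
    by (intro Bochner_Integration.integral_add torus_test_function_integrable torus_test_function_mult t1c tc tD \<psi>)
  finally have "\<bar>LINT x|\<mu>. partial j a x * \<psi> x\<bar>
    \<le> \<bar>LINT x|\<mu>. sin (a x) * partial j \<psi> x\<bar> + \<bar>LINT x|\<mu>. (1 - cos (a x)) * (partial j a x * \<psi> x)\<bar>"
    unfolding ibp by linarith
  also have "\<bar>LINT x|\<mu>. sin (a x) * partial j \<psi> x\<bar> \<le> sqrt E * S'"
  proof -
    have "\<bar>LINT x|\<mu>. sin (a x) * partial j \<psi> x\<bar> \<le> sqrt (LINT x|\<mu>. (sin (a x))\<^sup>2) * sqrt (LINT x|\<mu>. (partial j \<psi> x)\<^sup>2)"
      by (intro torus_cauchy_schwarz_abs sq_integrable_test_function ts tD')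
    also have "\<dots> \<le> sqrt E * S'"
    proof (intro mult_mono)
      have "(partial j \<psi> x)\<^sup>2 \<le> S'\<^sup>2" for x
        using power_mono[OF S'[of x], of 2] by simp
      then have "(LINT x|\<mu>. (partial j \<psi> x)\<^sup>2) \<le> (LINT x|\<mu>. S'\<^sup>2)"
        using sq_integrable_test_function[OF tD'] by (intro integral_mono) (simp_all add: sq_integrable_def)
      then show "sqrt (LINT x|\<mu>. (partial j \<psi> x)\<^sup>2) \<le> S'"
        using S0 by (intro real_le_lsqrt) simp_all
    qed (use sinE cos_energy_nonneg in \<open>simp_all add: E_def\<close>)
    finally show ?thesis .
  qed
  also have "\<bar>LINT x|\<mu>. (1 - cos (a x)) * (partial j a x * \<psi> x)\<bar> \<le> sqrt E * (S * sqrt (LINT x|\<mu>. (partial j a x)\<^sup>2))"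
  proof -
    have "\<bar>LINT x|\<mu>. (1 - cos (a x)) * (partial j a x * \<psi> x)\<bar>
      \<le> sqrt (LINT x|\<mu>. (1 - cos (a x))\<^sup>2) * sqrt (LINT x|\<mu>. (partial j a x * \<psi> x)\<^sup>2)"
      by (intro torus_cauchy_schwarz_abs sq_integrable_test_function torus_test_function_mult t1c tD \<psi>)
    also have "\<dots> \<le> sqrt E * (S * sqrt (LINT x|\<mu>. (partial j a x)\<^sup>2))"
    proof (intro mult_mono)
      have "(partial j a x * \<psi> x)\<^sup>2 \<le> S\<^sup>2 * (partial j a x)\<^sup>2" for x
        using mult_right_mono[OF power_mono[OF S[of x], of 2], of "(partial j a x)\<^sup>2"]
        by (simp add: power_mult_distrib mult.commute)
      then have "(LINT x|\<mu>. (partial j a x * \<psi> x)\<^sup>2) \<le> (LINT x|\<mu>. S\<^sup>2 * (partial j a x)\<^sup>2)"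
        using sq_integrable_test_function[OF tD] sq_integrable_test_function[OF torus_test_function_mult[OF tD \<psi>]]
        by (intro integral_mono) (simp_all add: sq_integrable_def)
      then have "sqrt (LINT x|\<mu>. (partial j a x * \<psi> x)\<^sup>2) \<le> sqrt (S\<^sup>2 * (LINT x|\<mu>. (partial j a x)\<^sup>2))"
        by simp
      then show "sqrt (LINT x|\<mu>. (partial j a x * \<psi> x)\<^sup>2) \<le> S * sqrt (LINT x|\<mu>. (partial j a x)\<^sup>2)"
        using S0 by (simp add: real_sqrt_mult)
    qed (use cosE cos_energy_nonneg in \<open>simp_all add: E_def\<close>)
    finally show ?thesis .
  qed
  finally show ?thesis by (simp add: E_def distrib_left)
qed

text \<open>The planar cross product, the only independent entry of the antisymmetric matrix f
  \<otimes> g - g \<otimes> f. If (f1, f2) is the rotated gradient of a, with f1 =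
  \<open>partial 2 a\<close> and f2 = - \<open>partial 1 a\<close>, it equals g \<cdot> grad
  a.\<close>

definition flux :: "(real ^ 2 \<Rightarrow> real) \<Rightarrow> (real ^ 2 \<Rightarrow> real) \<Rightarrow> (real ^ 2 \<Rightarrow> real) \<Rightarrow> (real ^ 2 \<Rightarrow> real) \<Rightarrow> real ^ 2 \<Rightarrow> real" where
  "flux f1 f2 g1 g2 x = f1 x * g2 x - g1 x * f2 x"

text \<open>When \<open>w\<close> is the flux of b and u, the mean of \<open>w\<close> minus its
  mollification is the formal time derivative of the mollified potential; this integral is then the
  rate of change of the cosine energy.\<close>

definition flux_defect :: "nat \<Rightarrow> (real ^ 2 \<Rightarrow> real) \<Rightarrow> (real ^ 2 \<Rightarrow> real) \<Rightarrow> (real ^ 2 \<Rightarrow> real) \<Rightarrow> real" where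
  "flux_defect n f1 f2 w = (LINT x|\<mu>. sin (potential n f1 f2 x) * ((LINT y|\<mu>. w y) - conv w (kern2 n) x))"

lemma flux_integrable:
  "sq_integrable f1 \<Longrightarrow> sq_integrable f2 \<Longrightarrow> sq_integrable g1 \<Longrightarrow> sq_integrable g2 \<Longrightarrow>
    integrable \<mu> (flux f1 f2 g1 g2)"
  unfolding flux_def[abs_def] by (intro Bochner_Integration.integrable_diff sq_integrable_mult)

text \<open>
  Testing \<open>div g = 0\<close> with \<open>- cos a\<^sub>n\<close> and with \<open>a\<^sub>n\<close> itself shows that the flux of the mollified field
  is orthogonal to \<open>sin a\<^sub>n\<close> and to \<open>1\<close>; what remains are mollification errors.
\<close>

lemma flux_defect_tendsto_0:
  assumes f: "sq_integrable f1" "sq_integrable f2" and g: "sq_integrable g1" "sq_integrable g2"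
    and divf: "div_free f1 f2" and divg: "div_free g1 g2"
    and mean: "(LINT x|\<mu>. f1 x) = 0" "(LINT x|\<mu>. f2 x) = 0"
  shows "(\<lambda>n. flux_defect n f1 f2 (flux f1 f2 g1 g2)) \<longlonglongrightarrow> 0"
proof -
  note fi = f[THEN sq_integrable_integrable] and gi = g[THEN sq_integrable_integrable]
  define w where "w = flux f1 f2 g1 g2"
  have wi: "integrable \<mu> w" unfolding w_def by (rule flux_integrable[OF f g])
  define a where "a n = potential n f1 f2" for n
  have ta: "torus_test_function (a n)" for n unfolding a_def by (rule torus_test_function_potential[OF fi])
  define r1 where "r1 n x = conv f1 (kern2 n) x - f1 x" for n x
  define r2 where "r2 n x = conv f2 (kern2 n) x - f2 x" for n x
  have r: "sq_integrable (r1 n)" "sq_integrable (r2 n)" for n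
    unfolding r1_def[abs_def] r2_def[abs_def]
    by (intro sq_integrable_diff f sq_integrable_test_function torus_test_function_conv fi torus_test_function_kern2)+
  define E where "E n = sqrt (LINT x|\<mu>. (g2 x)\<^sup>2) * sqrt (LINT x|\<mu>. (r1 n x)\<^sup>2)
    + sqrt (LINT x|\<mu>. (g1 x)\<^sup>2) * sqrt (LINT x|\<mu>. (r2 n x)\<^sup>2)" for n
  have key: "\<bar>LINT x|\<mu>. \<eta> x * w x\<bar> \<le> E n" if \<eta>: "torus_test_function \<eta>" "\<And>x. \<bar>\<eta> x\<bar> \<le> 1"
    and G: "torus_test_function G" "\<And>j x. partial j G x = \<eta> x * partial j (a n) x" for \<eta> G n
  proof -
    have "(LINT x|\<mu>. \<eta> x * (g2 x * conv f1 (kern2 n) x - g1 x * conv f2 (kern2 n) x)) = 0"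
    proof -
      have "(LINT x|\<mu>. g1 x * partial 1 G x + g2 x * partial 2 G x) = 0"
        using divg G(1) by (simp add: div_free_def)
      moreover have "partial 1 (a n) x = - conv f2 (kern2 n) x" "partial 2 (a n) x = conv f1 (kern2 n) x" for x
        unfolding a_def by (rule partial_potential[OF fi divf mean])+
      ultimately show ?thesis by (simp add: G(2) algebra_simps)
    qed
    moreover have i1: "integrable \<mu> (\<lambda>x. (g2 x * \<eta> x) * r1 n x)" "integrable \<mu> (\<lambda>x. (g1 x * \<eta> x) * r2 n x)"
      by (intro sq_integrable_mult sq_integrable_mult_bounded[OF _ torus_test_function_measurable[OF \<eta>(1)] \<eta>(2)] g r)+
    moreover have "\<eta> x * w x = \<eta> x * (g2 x * conv f1 (kern2 n) x - g1 x * conv f2 (kern2 n) x)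
        - (g2 x * \<eta> x) * r1 n x + (g1 x * \<eta> x) * r2 n x" for x
      by (simp add: w_def flux_def r1_def r2_def algebra_simps)
    moreover have "integrable \<mu> (\<lambda>x. \<eta> x * (g2 x * conv f1 (kern2 n) x - g1 x * conv f2 (kern2 n) x))"
    proof -
      have "integrable \<mu> (\<lambda>x. (g2 x * conv f1 (kern2 n) x - g1 x * conv f2 (kern2 n) x) * \<eta> x)"
        by (intro integrable_mult_test_function[OF _ \<eta>(1)] Bochner_Integration.integrable_diff
            integrable_mult_test_function gi torus_test_function_conv fi torus_test_function_kern2)
      then show ?thesis by (simp add: mult.commute)
    qed
    ultimately have "(LINT x|\<mu>. \<eta> x * w x) = - (LINT x|\<mu>. (g2 x * \<eta> x) * r1 n x) + (LINT x|\<mu>. (g1 x * \<eta> x) * r2 n x)"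
      by simp
    moreover have "\<bar>LINT x|\<mu>. (h x * \<eta> x) * r x\<bar> \<le> sqrt (LINT x|\<mu>. (h x)\<^sup>2) * sqrt (LINT x|\<mu>. (r x)\<^sup>2)"
      if h: "sq_integrable h" and r: "sq_integrable r" for h r
    proof -
      have h\<eta>: "sq_integrable (\<lambda>x. h x * \<eta> x)"
        by (rule sq_integrable_mult_bounded[OF h torus_test_function_measurable[OF \<eta>(1)] \<eta>(2)])
      have "(LINT x|\<mu>. (h x * \<eta> x)\<^sup>2) \<le> (LINT x|\<mu>. (h x)\<^sup>2)"
      proof (rule integral_mono)
        fix x
        have "(\<eta> x)\<^sup>2 \<le> 1" using \<eta>(2)[of x] by (simp add: abs_square_le_1)
        then show "(h x * \<eta> x)\<^sup>2 \<le> (h x)\<^sup>2"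
          using mult_left_mono[of "(\<eta> x)\<^sup>2" 1 "(h x)\<^sup>2"] by (simp add: power_mult_distrib)
      qed (use h h\<eta> in \<open>simp_all add: sq_integrable_def\<close>)
      then show ?thesis
        by (intro order_trans[OF torus_cauchy_schwarz_abs[OF h\<eta> r]] mult_right_mono) simp_all
    qed
    from this[OF g(2) r(1)[of n]] this[OF g(1) r(2)[of n]]
    have "\<bar>LINT x|\<mu>. (g2 x * \<eta> x) * r1 n x\<bar> + \<bar>LINT x|\<mu>. (g1 x * \<eta> x) * r2 n x\<bar> \<le> E n" by (simp add: E_def)
    ultimately show ?thesis by linarith
  qed
  have bound: "\<bar>flux_defect n f1 f2 w\<bar> \<le> 2 * E n + (LINT x|\<mu>. \<bar>conv w (kern2 n) x - w x\<bar>)" for n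
  proof -
    have ts: "torus_test_function (\<lambda>x. sin (a n x))" by (rule torus_test_function_sin[OF ta])
    have 1: "\<bar>LINT x|\<mu>. w x\<bar> \<le> E n"
      using key[OF torus_test_function_const[of 1] _ ta, of n] by simp
    have 2: "\<bar>LINT x|\<mu>. sin (a n x) * w x\<bar> \<le> E n"
      by (rule key[OF ts abs_sin_le_one torus_test_function_minus[OF torus_test_function_cos[OF ta]]
            partial_minus_cos[OF ta]])
    have i1: "integrable \<mu> (\<lambda>x. sin (a n x) * (LINT y|\<mu>. w y))"
      using torus_test_function_integrable[OF ts] by simp
    have i2: "integrable \<mu> (\<lambda>x. sin (a n x) * w x)"
      using integrable_mult_test_function[OF wi ts] by (simp add: mult.commute)
    have i3: "integrable \<mu> (\<lambda>x. conv w (kern2 n) x - w x)"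
      using wi torus_test_function_integrable[OF torus_test_function_conv[OF wi torus_test_function_kern2]] by simp
    have i3': "integrable \<mu> (\<lambda>x. sin (a n x) * (conv w (kern2 n) x - w x))"
      using integrable_mult_test_function[OF i3 ts] by (simp add: mult.commute)
    have "flux_defect n f1 f2 w = (LINT x|\<mu>. sin (a n x) * (LINT y|\<mu>. w y) - sin (a n x) * w x
        - sin (a n x) * (conv w (kern2 n) x - w x))"
      by (simp add: flux_defect_def a_def algebra_simps)
    also have "\<dots> = (LINT x|\<mu>. sin (a n x)) * (LINT y|\<mu>. w y) - (LINT x|\<mu>. sin (a n x) * w x)
        - (LINT x|\<mu>. sin (a n x) * (conv w (kern2 n) x - w x))"
      using i1 i2 i3' by simp
    finally have "\<bar>flux_defect n f1 f2 w\<bar> \<le> \<bar>(LINT x|\<mu>. sin (a n x)) * (LINT y|\<mu>. w y)\<bar> + \<bar>LINT x|\<mu>. sin (a n x) * w x\<bar>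
        + \<bar>LINT x|\<mu>. sin (a n x) * (conv w (kern2 n) x - w x)\<bar>" by linarith
    also have "\<bar>(LINT x|\<mu>. sin (a n x)) * (LINT y|\<mu>. w y)\<bar> \<le> 1 * E n"
      unfolding abs_mult
    proof (intro mult_mono 1)
      have "\<bar>LINT x|\<mu>. sin (a n x)\<bar> \<le> (LINT x|\<mu>. \<bar>sin (a n x)\<bar>)" by (rule integral_abs_bound)
      also have "\<dots> \<le> (LINT x|\<mu>. 1)"
        using torus_test_function_integrable[OF ts] by (intro integral_mono) simp_all
      finally show "\<bar>LINT x|\<mu>. sin (a n x)\<bar> \<le> 1" by simp
    qed simp_all
    \<comment> \<open>As a combination of products of square-integrable functions, \<open>w\<close>
      is only known to be integrable. Boundedness of the sine is what makes convergence of its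
      mollification in L^1 sufficient.\<close>
    also have "\<bar>LINT x|\<mu>. sin (a n x) * (conv w (kern2 n) x - w x)\<bar> \<le> (LINT x|\<mu>. \<bar>conv w (kern2 n) x - w x\<bar>)"
    proof (rule order_trans[OF integral_abs_bound], rule integral_mono)
      fix x
      show "\<bar>sin (a n x) * (conv w (kern2 n) x - w x)\<bar> \<le> \<bar>conv w (kern2 n) x - w x\<bar>"
        unfolding abs_mult by (rule mult_left_le_one_le) simp_all
    qed (use i3 i3' in simp_all)
    finally show ?thesis using 2 by linarith
  qed
  have r0: "(\<lambda>n. LINT x|\<mu>. (r1 n x)\<^sup>2) \<longlonglongrightarrow> 0" "(\<lambda>n. LINT x|\<mu>. (r2 n x)\<^sup>2) \<longlonglongrightarrow> 0"
    unfolding r1_def r2_def by (intro kern2_conv_tendsto_L2 f)+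
  have "E \<longlonglongrightarrow> sqrt (LINT x|\<mu>. (g2 x)\<^sup>2) * sqrt 0 + sqrt (LINT x|\<mu>. (g1 x)\<^sup>2) * sqrt 0"
    unfolding E_def[abs_def] by (intro tendsto_intros r0)
  then have "(\<lambda>n. 2 * E n + (LINT x|\<mu>. \<bar>conv w (kern2 n) x - w x\<bar>)) \<longlonglongrightarrow> 2 * 0 + 0"
    by (intro tendsto_intros kern2_conv_tendsto_L1 wi) simp
  then have lim: "(\<lambda>n. 2 * E n + (LINT x|\<mu>. \<bar>conv w (kern2 n) x - w x\<bar>)) \<longlonglongrightarrow> 0"
    by (simp only: mult_zero_right add_0_right)
  have "(\<lambda>n. flux_defect n f1 f2 w) \<longlonglongrightarrow> 0"
    by (rule Lim_null_comparison[OF always_eventually lim]) (simp only: real_norm_def bound, simp)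
  then show ?thesis by (simp only: w_def)
qed


subsection \<open>Functions of time\<close>

lemma finite_measure_Ico: "finite_measure (lebesgue_on {a..<b::real})"
  by (intro finite_measure_lebesgue_on bounded_set_imp_lmeasurable) auto

text \<open>Lets integrals computed on a compact interval, where the fundamental theorem is
  available, be read on the open or half-open time interval.\<close>

lemma has_bochner_integral_lebesgue_on_superset:
  fixes f :: "real \<Rightarrow> real"
  assumes "(f has_integral I) {a..b}" "continuous_on {a..b} f" "{a..b} \<subseteq> S" "S \<in> sets lebesgue"
    and zero: "\<And>t. t \<in> S - {a..b} \<Longrightarrow> f t = 0"
  shows "has_bochner_integral (lebesgue_on S) f I"
proof -
  have "integrable (lebesgue_on {a..b}) f"
    by (rule continuous_imp_integrable_real) (rule assms)
  moreover have "(LINT t|lebesgue_on {a..b}. f t) = I"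
    using calculation assms(1) by (simp add: lebesgue_integral_eq_integral integral_unique)
  ultimately have "has_bochner_integral (lebesgue_on {a..b}) f I" by (simp add: has_bochner_integral_iff)
  then have "has_bochner_integral lebesgue (\<lambda>t. indicator {a..b} t *\<^sub>R f t) I"
    by (subst (asm) has_bochner_integral_restrict_space) (auto simp: mult.commute)
  also have "(\<lambda>t. indicator {a..b} t *\<^sub>R f t) = (\<lambda>t. indicator S t *\<^sub>R f t)"
    using assms(3) zero by (auto simp: fun_eq_iff indicator_def)
  finally show ?thesis using assms(4) by (subst has_bochner_integral_restrict_space) (auto simp: mult.commute)
qed

lemma integral_indicator_Ico:
  fixes s t T :: real
  assumes "0 \<le> s" "s \<le> t" "t < T"
  shows "has_bochner_integral (lebesgue_on {0..<T}) (indicator {s..<t}) (t - s)"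
proof -
  have "emeasure (lebesgue_on {0..<T}) {s..<t} = ennreal (t - s)"
    using assms by (subst emeasure_restrict_space) auto
  moreover have "{s..<t} \<in> sets (lebesgue_on {0..<T})"
    using assms by (subst sets_restrict_space_iff) auto
  ultimately show ?thesis
    using has_bochner_integral_real_indicator[of "{s..<t}" "lebesgue_on {0..<T}"] assms
    by (simp add: measure_def)
qed

lemma time_integral_bound:
  fixes g :: "real \<Rightarrow> real"
  assumes "0 \<le> s" "s \<le> t" "t < T" and g: "\<And>r. r \<in> {0..<T} \<Longrightarrow> r \<in> {s..<t} \<Longrightarrow> \<bar>g r\<bar> \<le> C"
  shows "\<bar>LINT r|lebesgue_on {0..<T}. indicator {s..<t} r * g r\<bar> \<le> C * (t - s)"
proof (cases "integrable (lebesgue_on {0..<T}) (\<lambda>r. indicator {s..<t} r * g r)")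
  case True
  note h = integral_indicator_Ico[OF assms(1-3)]
  have "\<bar>LINT r|lebesgue_on {0..<T}. indicator {s..<t} r * g r\<bar> \<le> (LINT r|lebesgue_on {0..<T}. \<bar>indicator {s..<t} r * g r\<bar>)"
    by (rule integral_abs_bound)
  also have "\<dots> \<le> (LINT r|lebesgue_on {0..<T}. C * indicator {s..<t} r)"
  proof (rule integral_mono)
    show "integrable (lebesgue_on {0..<T}) (\<lambda>r. C * indicator {s..<t} r)"
      using h by (auto simp: has_bochner_integral_iff)
    fix r assume "r \<in> space (lebesgue_on {0..<T})"
    then show "\<bar>indicator {s..<t} r * g r\<bar> \<le> C * indicator {s..<t} r"
      using g[of r] by (auto simp: indicator_def)
  qed (use True in simp)
  also have "\<dots> = C * (t - s)" using h by (simp add: has_bochner_integral_iff)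
  finally show ?thesis .
next
  case False
  \<comment> \<open>A non-integrable integrand has integral 0 by convention, so nonnegativity of the
    right-hand side is all that remains.\<close>
  have "0 \<le> C * (t - s)"
  proof (cases "s = t")
    case False
    then have "\<bar>g s\<bar> \<le> C" using assms by (intro g) auto
    then show ?thesis using assms by simp
  qed simp
  then show ?thesis using False by (simp add: not_integrable_integral_eq)
qed

lemma time_integrable:
  assumes "g \<in> borel_measurable (lebesgue_on {0..<T::real})" "\<And>t. t \<in> {0..<T} \<Longrightarrow> \<bar>g t\<bar> \<le> (B::real)"
  shows "integrable (lebesgue_on {0..<T}) g"
  by (rule finite_measure.integrable_bounded[OF finite_measure_Ico, where B=B]) (use assms in auto)

lemma time_integrable_indicator:
  assumes "g \<in> borel_measurable (lebesgue_on {0..<T::real})" "\<And>t. t \<in> {0..<T} \<Longrightarrow> \<bar>g t\<bar> \<le> (B::real)"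
    "0 \<le> s" "s \<le> t" "t < T"
  shows "integrable (lebesgue_on {0..<T}) (\<lambda>r. indicator {s..<t} r * g r)"
proof -
  have m: "(indicator {s..<t} :: real \<Rightarrow> real) \<in> borel_measurable (lebesgue_on {0..<T})"
    using integral_indicator_Ico[OF assms(3-5)] by (auto simp: has_bochner_integral_iff)
  have "integrable (lebesgue_on {0..<T}) (\<lambda>r. g r * indicator {s..<t} r)"
    by (rule integrable_mult_bounded[OF time_integrable[OF assms(1,2)] m, where B=1]) (auto simp: indicator_def)
  then show ?thesis by (simp add: mult.commute)
qed

text \<open>A quadratic modulus forces derivative 0 relative to \<open>S\<close>, endpoints
  included. Applied to a quantity minus the integral of its expected rate, it replaces a chain rule
  in time when that rate is only measurable.\<close>

lemma quadratic_modulus_imp_constant: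
  fixes D :: "real \<Rightarrow> real"
  assumes "convex S" and D: "\<And>s t. s \<in> S \<Longrightarrow> t \<in> S \<Longrightarrow> s \<le> t \<Longrightarrow> \<bar>D t - D s\<bar> \<le> C * (t - s)\<^sup>2"
    and "s \<in> S" "t \<in> S"
  shows "D t = D s"
proof -
  have "\<exists>c. \<forall>x\<in>S. D x = c"
  proof (rule has_derivative_zero_constant[OF \<open>convex S\<close>])
    fix x assume x: "x \<in> S"
    have "((\<lambda>y. (D y - D x) /\<^sub>R norm (y - x)) \<longlongrightarrow> 0) (at x within S)"
    proof (rule Lim_null_comparison)
      show "\<forall>\<^sub>F y in at x within S. norm ((D y - D x) /\<^sub>R norm (y - x)) \<le> \<bar>C\<bar> * norm (y - x)"
        unfolding eventually_at_filter
      proof (rule always_eventually, intro allI impI)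
        fix y assume y: "y \<noteq> x" "y \<in> S"
        have "\<bar>D y - D x\<bar> \<le> C * (y - x)\<^sup>2"
        proof (cases "x \<le> y")
          case False
          then show ?thesis using D[of y x] x y by (simp add: abs_minus_commute power2_commute)
        qed (use D[of x y] x y in simp)
        also have "\<dots> \<le> \<bar>C\<bar> * (norm (y - x) * norm (y - x))"
          by (simp add: power2_eq_square mult_right_mono)
        finally show "norm ((D y - D x) /\<^sub>R norm (y - x)) \<le> \<bar>C\<bar> * norm (y - x)"
          using y by (simp add: divide_simps mult.assoc)
      qed
      show "((\<lambda>y. \<bar>C\<bar> * norm (y - x)) \<longlongrightarrow> 0) (at x within S)"
        by (rule tendsto_eq_intros | simp)+
    qed
    then show "(D has_derivative (\<lambda>h. 0)) (at x within S)"
      by (simp add: has_derivative_at_within)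
  qed
  then show ?thesis using assms by metis
qed

section \<open>Smooth cutoffs in time\<close>

lemma flat_exp_pos: "s > 0 \<Longrightarrow> flat_exp m s > 0"
  by (simp add: flat_exp_def)

lemma flat_exp_nonneg: "flat_exp m s \<ge> 0"
  by (simp add: flat_exp_def)

lemma flat_exp_eq_0: "s \<le> 0 \<Longrightarrow> flat_exp m s = 0"
  by (simp add: flat_exp_def)

lemma flat_exp_0_le_1: "flat_exp 0 s \<le> 1"
  by (simp add: flat_exp_def)

lemma flat_exp_2_le: "s > 0 \<Longrightarrow> flat_exp 2 s \<le> 1 / s\<^sup>2"
  by (simp add: flat_exp_def divide_right_mono)

lemma flat_exp_0_scaled_tendsto:
  assumes "s > 0"
  shows "(\<lambda>n. flat_exp 0 (real (Suc n) * s)) \<longlonglongrightarrow> 1"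
proof -
  have "(\<lambda>n. - (inverse (real (Suc n)) * (1 / s))) \<longlonglongrightarrow> - (0 * (1 / s))"
    by (intro tendsto_intros LIMSEQ_inverse_real_of_nat)
  then have "(\<lambda>n. exp (- (inverse (real (Suc n)) * (1 / s)))) \<longlonglongrightarrow> exp (- (0 * (1 / s)))"
    by (rule tendsto_exp)
  moreover have "flat_exp 0 (real (Suc n) * s) = exp (- (inverse (real (Suc n)) * (1 / s)))" for n
    using assms by (simp add: flat_exp_def divide_inverse)
  ultimately show ?thesis by simp
qed

text \<open>Zero from \<tau> on and increasing with \<open>n\<close> to 1 before \<tau>, so these
  are admissible approximations of the indicator of times before \<tau>, nonvanishing at time 0. The
  factor \<open>Suc n\<close> keeps the scale positive for \<open>n = 0\<close>.\<close>

definition time_cutoff :: "nat \<Rightarrow> real \<Rightarrow> real \<Rightarrow> real" where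
  "time_cutoff n \<tau> t = flat_exp 0 (real (Suc n) * (\<tau> - t))"

lemma time_cutoff_derivative:
  "(time_cutoff n \<tau> has_real_derivative - (real (Suc n) * flat_exp 2 (real (Suc n) * (\<tau> - t)))) (at t)"
proof -
  have "(time_cutoff n \<tau> has_real_derivative flat_exp 2 (real (Suc n) * (\<tau> - t)) * - real (Suc n)) (at t)"
    unfolding time_cutoff_def[abs_def]
    by (rule DERIV_chain2[where g="\<lambda>t. real (Suc n) * (\<tau> - t)"],
        use flat_exp_has_derivative[of 0 "real (Suc n) * (\<tau> - t)"] in \<open>simp add: numeral_2_eq_2\<close>)
      (auto intro!: derivative_eq_intros)
  then show ?thesis by (rule DERIV_cong) (simp only: mult_minus_right mult.commute)
qed

lemma smooth_time_cutoff: "smooth (time_cutoff n \<tau>)"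
proof -
  have "smooth (\<lambda>t. flat_exp 0 (- real (Suc n) * t + real (Suc n) * \<tau>))"
    by (rule smooth_affine[OF bounded_linear_mult_right smooth_flat_exp])
  moreover have "- real (Suc n) * t + real (Suc n) * \<tau> = real (Suc n) * (\<tau> - t)" for t
    by (simp add: algebra_simps)
  ultimately show ?thesis by (simp only: time_cutoff_def[abs_def])
qed

text \<open>
  The derivatives of \<open>time_cutoff n \<tau>\<close> are an approximate identity concentrating at \<open>\<tau>\<close> from the left.
\<close>

lemma weak_time_derivative:
  fixes f g :: "real \<Rightarrow> real"
  assumes f: "continuous_on {0..<T} f"
    and g: "g \<in> borel_measurable (lebesgue_on {0..<T})" "\<And>t. t \<in> {0..<T} \<Longrightarrow> \<bar>g t\<bar> \<le> B"
    and weak: "\<And>\<theta>. smooth \<theta> \<Longrightarrow> (\<exists>K. compact K \<and> K \<subseteq> {0..<T} \<and> (\<forall>t\<in>{0..<T} - K. \<theta> t = 0)) \<Longrightarrow>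
      (LINT t|lebesgue_on {0..<T}. f t * deriv \<theta> t + g t * \<theta> t) + f0 * \<theta> 0 = 0"
    and \<tau>: "0 < \<tau>" "\<tau> < T"
  shows "f \<tau> = f0 + (LINT t|lebesgue_on {0..<T}. indicator {0..<\<tau>} t * g t)"
proof -
  let ?\<nu> = "lebesgue_on {0..<T}"
  interpret finite_measure ?\<nu> by (rule finite_measure_Ico)
  define \<theta> where "\<theta> n = time_cutoff n \<tau>" for n
  define h where "h n t = real (Suc n) * flat_exp 2 (real (Suc n) * (\<tau> - t))" for n t
  have cont_h: "continuous_on S (h n)" for S n
    unfolding h_def by (intro continuous_intros continuous_on_compose2[OF smooth_continuous_on[OF smooth_flat_exp, of UNIV]]) auto
  have hn: "h n t \<ge> 0" for n t by (simp add: h_def flat_exp_nonneg)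
  have D\<theta>: "deriv (\<theta> n) t = - h n t" for n t
    unfolding \<theta>_def h_def by (rule DERIV_imp_deriv[OF time_cutoff_derivative])
  have h0: "h n t = 0" if "t \<ge> \<tau>" for n t
    using that by (simp add: h_def flat_exp_eq_0 mult_nonneg_nonpos)
  have \<theta>0: "\<theta> n t = 0" if "t \<ge> \<tau>" for n t
    using that by (simp add: \<theta>_def time_cutoff_def flat_exp_eq_0 mult_nonneg_nonpos)
  have mass: "has_bochner_integral ?\<nu> (h n) (\<theta> n 0)" for n
  proof (rule has_bochner_integral_lebesgue_on_superset[where a=0 and b=\<tau>])
    have "(h n has_integral (- \<theta> n \<tau>) - (- \<theta> n 0)) {0..\<tau>}"
    proof (rule fundamental_theorem_of_calculus)
      show "((\<lambda>t. - \<theta> n t) has_vector_derivative h n t) (at t within {0..\<tau>})" for t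
        using DERIV_minus[OF time_cutoff_derivative[of n \<tau> t]]
        by (auto simp: \<theta>_def h_def has_real_derivative_iff_has_vector_derivative
            intro: has_vector_derivative_at_within)
    qed (use \<tau> in simp)
    then show "(h n has_integral \<theta> n 0) {0..\<tau>}" using \<theta>0[of \<tau> n] by simp
  qed (use \<tau> cont_h h0 in auto)
  have \<theta>lim: "(\<lambda>n. \<theta> n 0) \<longlonglongrightarrow> 1"
    using flat_exp_0_scaled_tendsto[OF \<tau>(1)] by (simp add: \<theta>_def time_cutoff_def)
  have \<theta>01: "0 \<le> \<theta> n t" "\<theta> n t \<le> 1" for n t
    by (auto simp: \<theta>_def time_cutoff_def flat_exp_nonneg flat_exp_0_le_1)
  have fm: "f \<in> borel_measurable ?\<nu>"
    by (rule continuous_imp_measurable_on_sets_lebesgue[OF f]) simp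
  have hm: "h n \<in> borel_measurable ?\<nu>" for n using mass[of n] by (auto simp: has_bochner_integral_iff)
  have \<theta>m: "\<theta> n \<in> borel_measurable ?\<nu>" for n
    by (rule continuous_imp_measurable_on_sets_lebesgue)
      (auto simp: \<theta>_def intro: smooth_continuous_on smooth_time_cutoff)
  have "compact (f ` {0..\<tau>})"
    by (rule compact_continuous_image[OF continuous_on_subset[OF f]]) (use \<tau> in auto)
  then obtain F where F: "\<And>t. t \<in> {0..\<tau>} \<Longrightarrow> \<bar>f t\<bar> \<le> F"
    using compact_imp_bounded bounded_iff by (metis imageI real_norm_def)
  have fh: "integrable ?\<nu> (\<lambda>t. f t * h n t)" for n
  proof (rule Bochner_Integration.integrable_bound[where f="\<lambda>t. F * h n t"])
    show "AE t in ?\<nu>. norm (f t * h n t) \<le> norm (F * h n t)"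
    proof (rule AE_I2)
      fix t assume "t \<in> space ?\<nu>"
      then show "norm (f t * h n t) \<le> norm (F * h n t)"
        using F[of t] h0[of t n] hn[of n t] by (cases "t \<le> \<tau>") (auto simp: abs_mult intro!: mult_right_mono)
    qed
  qed (use mass[of n] fm hm in \<open>auto simp: has_bochner_integral_iff\<close>)
  have g\<theta>: "integrable ?\<nu> (\<lambda>t. g t * \<theta> n t)" for n
    by (rule integrable_mult_bounded[OF time_integrable[OF g] \<theta>m, where B=1]) (use \<theta>01 in auto)
  have eq: "(LINT t|?\<nu>. f t * h n t) = (LINT t|?\<nu>. g t * \<theta> n t) + f0 * \<theta> n 0" for n
  proof -
    have "(LINT t|?\<nu>. f t * deriv (\<theta> n) t + g t * \<theta> n t) + f0 * \<theta> n 0 = 0"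
    proof (rule weak)
      show "smooth (\<theta> n)" unfolding \<theta>_def by (rule smooth_time_cutoff)
      show "\<exists>K. compact K \<and> K \<subseteq> {0..<T} \<and> (\<forall>t\<in>{0..<T} - K. \<theta> n t = 0)"
        by (rule exI[of _ "{0..\<tau>}"]) (use \<tau> \<theta>0 in auto)
    qed
    then show ?thesis using fh[of n] g\<theta>[of n] by (simp add: D\<theta>)
  qed
  have gl: "(\<lambda>n. LINT t|?\<nu>. g t * \<theta> n t) \<longlonglongrightarrow> (LINT t|?\<nu>. indicator {0..<\<tau>} t * g t)"
  proof (rule integral_dominated_convergence[where w="\<lambda>t. B"])
    show "AE t in ?\<nu>. (\<lambda>n. g t * \<theta> n t) \<longlonglongrightarrow> indicator {0..<\<tau>} t * g t"
    proof (rule AE_I2)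
      fix t assume t: "t \<in> space ?\<nu>"
      show "(\<lambda>n. g t * \<theta> n t) \<longlonglongrightarrow> indicator {0..<\<tau>} t * g t"
      proof (cases "t < \<tau>")
        case True
        then have "(\<lambda>n. g t * \<theta> n t) \<longlonglongrightarrow> g t * 1"
          unfolding \<theta>_def time_cutoff_def by (intro tendsto_intros flat_exp_0_scaled_tendsto) simp
        then show ?thesis using True t by simp
      qed (simp add: \<theta>0)
    qed
    show "AE t in ?\<nu>. norm (g t * \<theta> n t) \<le> B" for n
    proof (rule AE_I2)
      fix t assume "t \<in> space ?\<nu>"
      then have "\<bar>g t\<bar> * \<bar>\<theta> n t\<bar> \<le> B * 1" using g(2)[of t] \<theta>01[of n t] by (intro mult_mono) auto
      then show "norm (g t * \<theta> n t) \<le> B" by (simp add: abs_mult)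
    qed
    show "(\<lambda>t. g t * \<theta> n t) \<in> borel_measurable ?\<nu>" for n using g\<theta>[of n] by auto
    show "(\<lambda>t. indicator {0..<\<tau>} t * g t) \<in> borel_measurable ?\<nu>"
      using time_integrable_indicator[OF g, of 0 \<tau>] \<tau> by auto
  qed simp
  have fl: "(\<lambda>n. LINT t|?\<nu>. f t * h n t) \<longlonglongrightarrow> f \<tau>"
  proof -
    have diff: "(\<lambda>n. (LINT t|?\<nu>. f t * h n t) - f \<tau> * \<theta> n 0) \<longlonglongrightarrow> 0"
    proof (rule LIMSEQ_I)
      fix e :: real assume "e > 0"
      then have "e / 2 > 0" by simp
      then obtain d where d: "d > 0" "\<And>t. t \<in> {0..<T} \<Longrightarrow> dist t \<tau> < d \<Longrightarrow> dist (f t) (f \<tau>) < e / 2"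
        using f[unfolded continuous_on_iff, rule_format, of \<tau> "e / 2"] \<tau> by auto
      have F0: "F \<ge> 0" using F[of 0] \<tau> by force
      \<comment> \<open>Near \<tau> continuity of \<open>f\<close> is used. Further away,
        \<open>flat_exp_2_le\<close> decays like the inverse square of its argument, which beats the
        prefactor \<open>Suc n\<close>.\<close>
      have pw: "\<bar>f t - f \<tau>\<bar> * h n t \<le> e / 2 * h n t + 2 * F / (d\<^sup>2 * real (Suc n))" if "t \<in> {0..<T}" for n t
      proof -
        consider "t \<ge> \<tau>" | "t < \<tau>" "dist t \<tau> < d" | "t < \<tau>" "d \<le> \<tau> - t" by (force simp: dist_real_def)
        then show ?thesis
        proof cases
          case 1
          then show ?thesis using h0 F0 by simp
        next
          case 2
          then have "\<bar>f t - f \<tau>\<bar> * h n t \<le> e / 2 * h n t"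
            using d(2)[OF that] hn by (intro mult_right_mono) (auto simp: dist_real_def)
          moreover have "0 \<le> 2 * F / (d\<^sup>2 * real (Suc n))" using F0 by simp
          ultimately show ?thesis by linarith
        next
          case 3
          let ?N = "real (Suc n)"
          have "\<bar>f t - f \<tau>\<bar> \<le> 2 * F" using F[of t] F[of \<tau>] 3 that \<tau> by auto
          moreover have "h n t \<le> 1 / (d\<^sup>2 * ?N)"
          proof -
            have pos: "?N * (\<tau> - t) > 0" using 3 by simp
            have "h n t \<le> ?N * (1 / (?N * (\<tau> - t))\<^sup>2)"
              unfolding h_def by (intro mult_left_mono flat_exp_2_le pos) simp
            also have "\<dots> \<le> ?N * (1 / (?N * d)\<^sup>2)"
              using 3 d(1) by (intro mult_left_mono divide_left_mono power_mono mult_pos_pos) auto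
            also have "\<dots> = 1 / (d\<^sup>2 * ?N)"
              by (simp only: power_mult_distrib) (simp add: power2_eq_square divide_simps)
            finally show ?thesis .
          qed
          ultimately have "\<bar>f t - f \<tau>\<bar> * h n t \<le> 2 * F * (1 / (d\<^sup>2 * ?N))"
            using hn F0 by (intro mult_mono) auto
          moreover have "0 \<le> e / 2 * h n t" using \<open>e > 0\<close> hn by simp
          ultimately show ?thesis by simp
        qed
      qed
      have bd: "\<bar>(LINT t|?\<nu>. f t * h n t) - f \<tau> * \<theta> n 0\<bar> \<le> e / 2 + 2 * F / (d\<^sup>2 * real (Suc n)) * T" for n
      proof -
        have i: "integrable ?\<nu> (h n)" and m: "(LINT t|?\<nu>. h n t) = \<theta> n 0" using mass[of n] by (auto simp: has_bochner_integral_iff)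
        have "(LINT t|?\<nu>. f t * h n t) - f \<tau> * \<theta> n 0 = (LINT t|?\<nu>. f t * h n t - f \<tau> * h n t)"
          using fh[of n] i m by simp
        also have "\<bar>\<dots>\<bar> \<le> (LINT t|?\<nu>. \<bar>f t * h n t - f \<tau> * h n t\<bar>)" by (rule integral_abs_bound)
        also have "\<dots> \<le> (LINT t|?\<nu>. e / 2 * h n t + 2 * F / (d\<^sup>2 * real (Suc n)))"
        proof (rule integral_mono)
          fix t assume t: "t \<in> space ?\<nu>"
          have "\<bar>f t * h n t - f \<tau> * h n t\<bar> = \<bar>f t - f \<tau>\<bar> * h n t"
            using hn[of n t] by (simp add: abs_mult left_diff_distrib[symmetric])
          then show "\<bar>f t * h n t - f \<tau> * h n t\<bar> \<le> e / 2 * h n t + 2 * F / (d\<^sup>2 * real (Suc n))"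
            using pw[of t n] t by simp
        qed (use fh[of n] i in auto)
        also have "\<dots> = e / 2 * \<theta> n 0 + 2 * F / (d\<^sup>2 * real (Suc n)) * T"
          using i m \<tau> by (simp add: measure_restrict_space)
        also have "\<dots> \<le> e / 2 + 2 * F / (d\<^sup>2 * real (Suc n)) * T"
          using mult_left_mono[OF \<theta>01(2)[of n 0], of "e / 2"] \<open>e > 0\<close> by simp
        finally show ?thesis .
      qed
      have "(\<lambda>n. 2 * F / d\<^sup>2 * T * inverse (real (Suc n))) \<longlonglongrightarrow> 2 * F / d\<^sup>2 * T * 0"
        by (intro tendsto_intros LIMSEQ_inverse_real_of_nat)
      then have "(\<lambda>n. 2 * F / (d\<^sup>2 * real (Suc n)) * T) \<longlonglongrightarrow> 0"
        by (simp add: divide_inverse mult_ac)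
      then have "\<forall>\<^sub>F n in sequentially. 2 * F / (d\<^sup>2 * real (Suc n)) * T < e / 2"
        by (rule order_tendstoD(2)) (use \<open>e > 0\<close> in simp)
      then obtain N where N: "\<And>n. n \<ge> N \<Longrightarrow> 2 * F / (d\<^sup>2 * real (Suc n)) * T < e / 2"
        by (auto simp: eventually_sequentially)
      show "\<exists>N. \<forall>n\<ge>N. norm ((LINT t|?\<nu>. f t * h n t) - f \<tau> * \<theta> n 0 - 0) < e"
      proof (intro exI allI impI)
        fix n assume n: "n \<ge> N"
        have "a < e" if "a \<le> e / 2 + c" "c < e / 2" for a c using that by linarith
        from this[OF bd N[OF n]] show "norm ((LINT t|?\<nu>. f t * h n t) - f \<tau> * \<theta> n 0 - 0) < e"
          by (simp only: real_norm_def diff_0_right)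
      qed
    qed
    have "(\<lambda>n. ((LINT t|?\<nu>. f t * h n t) - f \<tau> * \<theta> n 0) + f \<tau> * \<theta> n 0) \<longlonglongrightarrow> 0 + f \<tau> * 1"
      by (intro tendsto_add diff tendsto_mult tendsto_const \<theta>lim)
    then show ?thesis by simp
  qed
  have "(\<lambda>n. LINT t|?\<nu>. f t * h n t) \<longlonglongrightarrow> (LINT t|?\<nu>. indicator {0..<\<tau>} t * g t) + f0 * 1"
    unfolding eq by (intro tendsto_add gl tendsto_mult tendsto_const \<theta>lim)
  from LIMSEQ_unique[OF fl this] show ?thesis by simp
qed


subsection \<open>Weakly continuous paths\<close>

text \<open>The norm bound is required at every time; for members of \<open>Cw_L2\<close> it is
  recovered from the almost-everywhere bound by weak lower semicontinuity.\<close>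

definition weak_path :: "real \<Rightarrow> real \<Rightarrow> (real \<Rightarrow> real ^ 2 \<Rightarrow> real) \<Rightarrow> bool" where
  "weak_path T M v \<longleftrightarrow>
     (\<forall>t\<in>{0..<T}. sq_integrable (v t) \<and> (LINT x|\<mu>. (v t x)\<^sup>2) \<le> M) \<and>
     (\<forall>h. sq_integrable h \<longrightarrow> continuous_on {0..<T} (\<lambda>t. LINT x|\<mu>. v t x * h x))"

lemma weak_pathD:
  assumes "weak_path T M v"
  shows "t \<in> {0..<T} \<Longrightarrow> sq_integrable (v t)"
    and "t \<in> {0..<T} \<Longrightarrow> (LINT x|\<mu>. (v t x)\<^sup>2) \<le> M"
    and "sq_integrable h \<Longrightarrow> continuous_on {0..<T} (\<lambda>t. LINT x|\<mu>. v t x * h x)"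
  using assms by (auto simp: weak_path_def)

lemma weak_path_integrable: "weak_path T M v \<Longrightarrow> t \<in> {0..<T} \<Longrightarrow> integrable \<mu> (v t)"
  by (intro sq_integrable_integrable weak_pathD(1))

lemma weak_path_L1_bound:
  assumes "weak_path T M v" "t \<in> {0..<T}"
  shows "(LINT x|\<mu>. \<bar>v t x\<bar>) \<le> sqrt M"
proof -
  have "sq_integrable (\<lambda>x. \<bar>v t x\<bar>)"
    using weak_pathD(1)[OF assms] by (auto simp: sq_integrable_def)
  from torus_cauchy_schwarz_abs[OF this sq_integrable_test_function[OF torus_test_function_const[of 1]]]
  have "(LINT x|\<mu>. \<bar>v t x\<bar>) \<le> sqrt (LINT x|\<mu>. (v t x)\<^sup>2)" by simp
  also have "\<dots> \<le> sqrt M" using weak_pathD(2)[OF assms] by simp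
  finally show ?thesis .
qed

text \<open>Weak times strong convergence: along a sequence of times \<open>q\<close> converges
  pointwise and boundedly, hence strongly in L^2, while \<open>v\<close> converges weakly with
  bounded norms.\<close>

lemma weak_path_pairing_continuous:
  assumes v: "weak_path T M v"
    and q: "\<And>t. t \<in> {0..<T} \<Longrightarrow> q t \<in> borel_measurable \<mu>" "\<And>t x. t \<in> {0..<T} \<Longrightarrow> \<bar>q t x\<bar> \<le> B"
      "\<And>x. continuous_on {0..<T} (\<lambda>t. q t x)"
  shows "continuous_on {0..<T} (\<lambda>t. LINT x|\<mu>. v t x * q t x)"
  unfolding continuous_on_sequentially
proof (intro allI ballI impI, elim conjE)
  fix s t assume t: "t \<in> {0..<T}" and s: "\<forall>n. s n \<in> {0..<T}" "s \<longlonglongrightarrow> t"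
  have qs: "sq_integrable (q r)" if "r \<in> {0..<T}" for r
    by (rule sq_integrable_bounded[OF q(1)[OF that] q(2)[OF that]])
  have d: "sq_integrable (\<lambda>x. q (s n) x - q t x)" for n
    by (intro sq_integrable_diff qs t s(1)[rule_format])
  have lim2: "(\<lambda>n. LINT x|\<mu>. (q (s n) x - q t x)\<^sup>2) \<longlonglongrightarrow> (LINT x|\<mu>. 0)"
  proof (rule integral_dominated_convergence[where w="\<lambda>x. (2 * B)\<^sup>2"])
    show "AE x in \<mu>. (\<lambda>n. (q (s n) x - q t x)\<^sup>2) \<longlonglongrightarrow> 0"
    proof (rule AE_I2)
      fix x
      have "(\<lambda>n. q (s n) x) \<longlonglongrightarrow> q t x"
        using q(3)[of x] t s unfolding continuous_on_sequentially comp_def by blast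
      then have "(\<lambda>n. (q (s n) x - q t x)\<^sup>2) \<longlonglongrightarrow> (q t x - q t x)\<^sup>2" by (intro tendsto_intros)
      then show "(\<lambda>n. (q (s n) x - q t x)\<^sup>2) \<longlonglongrightarrow> 0" by simp
    qed
    show "AE x in \<mu>. norm ((q (s n) x - q t x)\<^sup>2) \<le> (2 * B)\<^sup>2" for n
    proof (rule AE_I2)
      fix x
      have "\<bar>q (s n) x - q t x\<bar> \<le> 2 * B" using q(2)[OF t, of x] q(2)[of "s n" x] s(1) by force
      from power_mono[OF this, of 2] show "norm ((q (s n) x - q t x)\<^sup>2) \<le> (2 * B)\<^sup>2" by simp
    qed
  qed (use d in \<open>auto simp: sq_integrable_def\<close>)
  have "(\<lambda>n. LINT x|\<mu>. v (s n) x * (q (s n) x - q t x)) \<longlonglongrightarrow> 0"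
  proof (rule Lim_null_comparison)
    have "(\<lambda>n. sqrt M * sqrt (LINT x|\<mu>. (q (s n) x - q t x)\<^sup>2)) \<longlonglongrightarrow> sqrt M * sqrt (LINT x|\<mu>. 0)"
      by (intro tendsto_intros lim2)
    then show "(\<lambda>n. sqrt M * sqrt (LINT x|\<mu>. (q (s n) x - q t x)\<^sup>2)) \<longlonglongrightarrow> 0" by simp
    show "\<forall>\<^sub>F n in sequentially. norm (LINT x|\<mu>. v (s n) x * (q (s n) x - q t x))
      \<le> sqrt M * sqrt (LINT x|\<mu>. (q (s n) x - q t x)\<^sup>2)"
    proof (rule always_eventually, rule allI)
      fix n
      have "norm (LINT x|\<mu>. v (s n) x * (q (s n) x - q t x))
        \<le> sqrt (LINT x|\<mu>. (v (s n) x)\<^sup>2) * sqrt (LINT x|\<mu>. (q (s n) x - q t x)\<^sup>2)"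
        using torus_cauchy_schwarz_abs[OF weak_pathD(1)[OF v s(1)[rule_format]] d[of n]] by simp
      also have "\<dots> \<le> sqrt M * sqrt (LINT x|\<mu>. (q (s n) x - q t x)\<^sup>2)"
        using weak_pathD(2)[OF v s(1)[rule_format]] by (intro mult_right_mono) simp_all
      finally show "norm (LINT x|\<mu>. v (s n) x * (q (s n) x - q t x))
        \<le> sqrt M * sqrt (LINT x|\<mu>. (q (s n) x - q t x)\<^sup>2)" .
    qed
  qed
  moreover have "(\<lambda>n. LINT x|\<mu>. v (s n) x * q t x) \<longlonglongrightarrow> (LINT x|\<mu>. v t x * q t x)"
    using weak_pathD(3)[OF v qs[OF t]] t s unfolding continuous_on_sequentially comp_def by blast
  ultimately have "(\<lambda>n. (LINT x|\<mu>. v (s n) x * (q (s n) x - q t x)) + (LINT x|\<mu>. v (s n) x * q t x))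
      \<longlonglongrightarrow> 0 + (LINT x|\<mu>. v t x * q t x)" by (rule tendsto_add)
  moreover have "(LINT x|\<mu>. v (s n) x * (q (s n) x - q t x)) + (LINT x|\<mu>. v (s n) x * q t x)
      = (LINT x|\<mu>. v (s n) x * q (s n) x)" for n
    using sq_integrable_mult[OF weak_pathD(1)[OF v s(1)[rule_format]] d[of n]]
      sq_integrable_mult[OF weak_pathD(1)[OF v s(1)[rule_format]] qs[OF t]]
    by (subst Bochner_Integration.integral_add[symmetric]) (simp_all add: algebra_simps)
  ultimately show "((\<lambda>t. LINT x|\<mu>. v t x * q t x) \<circ> s) \<longlonglongrightarrow> (LINT x|\<mu>. v t x * q t x)"
    by (simp add: comp_def)
qed

lemma weak_path_conv_continuous:
  assumes "weak_path T M v" "torus_test_function H"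
  shows "continuous_on {0..<T} (\<lambda>t. conv (v t) H x)"
  unfolding conv_def
  by (rule weak_pathD(3)[OF assms(1) sq_integrable_test_function[OF torus_test_function_reflect[OF assms(2)]]])

text \<open>
  Products of two weakly continuous paths need not be weakly continuous, but mollifying one factor
  makes them so; hence the pairing below is a pointwise limit of continuous functions of time.
\<close>

lemma weak_path_product_measurable:
  assumes v: "weak_path T M v" and w: "weak_path T M w"
    and h: "\<And>t. t \<in> {0..<T} \<Longrightarrow> h t \<in> borel_measurable \<mu>" "\<And>t x. t \<in> {0..<T} \<Longrightarrow> \<bar>h t x\<bar> \<le> B"
      "\<And>x. continuous_on {0..<T} (\<lambda>t. h t x)"
  shows "(\<lambda>t. LINT x|\<mu>. v t x * w t x * h t x) \<in> borel_measurable (lebesgue_on {0..<T})"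
proof (rule borel_measurable_LIMSEQ_real)
  let ?G = "\<lambda>m t. LINT x|\<mu>. w t x * (conv (v t) (kern2 m) x * h t x)"
  note tk = torus_test_function_kern2
  show "?G m \<in> borel_measurable (lebesgue_on {0..<T})" for m
  proof (rule continuous_imp_measurable_on_sets_lebesgue)
    obtain K where K: "K > 0" "\<And>z. \<bar>kern2 m z\<bar> \<le> K" using torus_test_function_bounded[OF tk] by blast
    show "continuous_on {0..<T} (?G m)"
    proof (rule weak_path_pairing_continuous[OF w, where B="K * sqrt M * B"])
      fix t assume t: "t \<in> {0..<T}"
      note vi = weak_path_integrable[OF v t]
      show "(\<lambda>x. conv (v t) (kern2 m) x * h t x) \<in> borel_measurable \<mu>"
        by (intro borel_measurable_times h(1)[OF t] conv_measurable[OF vi tk])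
      fix x
      have "\<bar>conv (v t) (kern2 m) x\<bar> \<le> K * (LINT y|\<mu>. \<bar>v t y\<bar>)"
        by (rule conv_bound[OF vi tk K(2)])
      also have "\<dots> \<le> K * sqrt M"
        using weak_path_L1_bound[OF v t] K(1) by (intro mult_left_mono) auto
      finally have c: "\<bar>conv (v t) (kern2 m) x\<bar> \<le> K * sqrt M" .
      show "\<bar>conv (v t) (kern2 m) x * h t x\<bar> \<le> K * sqrt M * B"
        unfolding abs_mult using order_trans[OF abs_ge_zero c] by (intro mult_mono c h(2)[OF t]) simp_all
    next
      fix x show "continuous_on {0..<T} (\<lambda>t. conv (v t) (kern2 m) x * h t x)"
        by (intro continuous_on_mult weak_path_conv_continuous[OF v tk] h(3))
    qed
  qed simp
  fix t assume "t \<in> space (lebesgue_on {0..<T})"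
  then have t: "t \<in> {0..<T}" by simp
  note vt = weak_pathD(1)[OF v t] and wt = weak_pathD(1)[OF w t]
  have wh: "sq_integrable (\<lambda>x. w t x * h t x)"
    by (rule sq_integrable_mult_bounded[OF wt h(1)[OF t] h(2)[OF t]])
  define r where "r m x = conv (v t) (kern2 m) x - v t x" for m x
  have rs: "sq_integrable (r m)" for m unfolding r_def[abs_def]
    by (intro sq_integrable_diff vt sq_integrable_test_function torus_test_function_conv sq_integrable_integrable tk)
  have "(\<lambda>m. LINT x|\<mu>. (r m x)\<^sup>2) \<longlonglongrightarrow> 0" unfolding r_def by (rule kern2_conv_tendsto_L2[OF vt])
  then have "(\<lambda>m. sqrt (LINT x|\<mu>. (w t x * h t x)\<^sup>2) * sqrt (LINT x|\<mu>. (r m x)\<^sup>2))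
      \<longlonglongrightarrow> sqrt (LINT x|\<mu>. (w t x * h t x)\<^sup>2) * sqrt 0"
    by (intro tendsto_intros)
  then have l: "(\<lambda>m. sqrt (LINT x|\<mu>. (w t x * h t x)\<^sup>2) * sqrt (LINT x|\<mu>. (r m x)\<^sup>2)) \<longlonglongrightarrow> 0" by simp
  have "(\<lambda>m. LINT x|\<mu>. (w t x * h t x) * r m x) \<longlonglongrightarrow> 0"
    by (rule Lim_null_comparison[OF always_eventually l])
      (use torus_cauchy_schwarz_abs[OF wh rs] in simp)
  then have "(\<lambda>m. (LINT x|\<mu>. (w t x * h t x) * r m x) + (LINT x|\<mu>. (w t x * h t x) * v t x))
      \<longlonglongrightarrow> 0 + (LINT x|\<mu>. (w t x * h t x) * v t x)"
    by (intro tendsto_add tendsto_const)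
  moreover have "(LINT x|\<mu>. (w t x * h t x) * r m x) + (LINT x|\<mu>. (w t x * h t x) * v t x) = ?G m t" for m
    using sq_integrable_mult[OF wh rs] sq_integrable_mult[OF wh vt]
    by (subst Bochner_Integration.integral_add[symmetric]) (simp_all add: r_def algebra_simps)
  ultimately show "(\<lambda>m. ?G m t) \<longlonglongrightarrow> (LINT x|\<mu>. v t x * w t x * h t x)"
    by (simp add: mult_ac)
qed

section \<open>Lipschitz and Taylor estimates for sine and cosine\<close>

lemma sin_diff_le: "\<bar>sin x - sin y\<bar> \<le> \<bar>x - y\<bar>" for x y :: real
proof -
  have "\<bar>sin x - sin y\<bar> = 2 * \<bar>sin ((x - y) / 2)\<bar> * \<bar>cos ((x + y) / 2)\<bar>"
    by (simp add: sin_diff_sin abs_mult)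
  also have "\<dots> \<le> 2 * \<bar>(x - y) / 2\<bar> * 1"
    by (intro mult_mono abs_sin_x_le_abs_x) simp_all
  finally show ?thesis by simp
qed

text \<open>The second-order Taylor estimate for 1 - cos. The addition theorem separates the
  increment \<open>d\<close>, and the two remainders contribute at most d^2/2 each.\<close>

lemma cos_taylor_le: "\<bar>cos y - cos x - sin y * (x - y)\<bar> \<le> (x - y)\<^sup>2" for x y :: real
proof -
  define d where "d = x - y"
  have "\<bar>sin d - d\<bar> \<le> d\<^sup>2 / 2"
    using Maclaurin_sin_bound[of d 2] by (simp add: numeral_2_eq_2 sin_coeff_def)
  moreover have "\<bar>1 - cos d\<bar> \<le> d\<^sup>2 / 2" using one_minus_cos_le[of d] cos_le_one[of d] by simp
  ultimately have "\<bar>cos y\<bar> * \<bar>1 - cos d\<bar> \<le> 1 * (d\<^sup>2 / 2)" "\<bar>sin y\<bar> * \<bar>sin d - d\<bar> \<le> 1 * (d\<^sup>2 / 2)"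
    by (intro mult_mono; simp)+
  moreover have "cos y - cos x - sin y * d = cos y * (1 - cos d) + sin y * (sin d - d)"
  proof -
    have "x = y + d" by (simp add: d_def)
    then show ?thesis by (simp add: cos_add algebra_simps)
  qed
  ultimately show ?thesis unfolding d_def[symmetric]
    using abs_triangle_ineq[of "cos y * (1 - cos d)" "sin y * (sin d - d)"] by (simp add: abs_mult)
qed

subsection \<open>Conservation along the flow\<close>

text \<open>The induction equation in scalar components, tested with products of a space field and a
  time function. The antisymmetric matrix meets the Jacobian of the test field only through its
  curl, and the slice of \<open>b\<close> at time 0 serves as initial datum. All conditions on
  slices hold at every time.\<close>

locale induction_flow =
  fixes T M :: real and b1 b2 u1 u2 :: "real \<Rightarrow> real ^ 2 \<Rightarrow> real"
  assumes T_pos: "0 < T"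
    and paths: "weak_path T M b1" "weak_path T M b2" "weak_path T M u1" "weak_path T M u2"
    and div_free_b: "\<And>t. t \<in> {0..<T} \<Longrightarrow> div_free (b1 t) (b2 t)"
    and div_free_u: "\<And>t. t \<in> {0..<T} \<Longrightarrow> div_free (u1 t) (u2 t)"
    and mean_b: "\<And>t. t \<in> {0..<T} \<Longrightarrow> (LINT x|\<mu>. b1 t x) = 0" "\<And>t. t \<in> {0..<T} \<Longrightarrow> (LINT x|\<mu>. b2 t x) = 0"
    and weak_eq: "\<And>\<phi>1 \<phi>2 \<theta>. torus_test_function \<phi>1 \<Longrightarrow> torus_test_function \<phi>2 \<Longrightarrow> smooth \<theta> \<Longrightarrow>
      (\<exists>K. compact K \<and> K \<subseteq> {0..<T} \<and> (\<forall>t\<in>{0..<T} - K. \<theta> t = 0)) \<Longrightarrow>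
      (LINT t|lebesgue_on {0..<T}. (LINT x|\<mu>. b1 t x * \<phi>1 x + b2 t x * \<phi>2 x) * deriv \<theta> t +
        (LINT x|\<mu>. flux (b1 t) (b2 t) (u1 t) (u2 t) x * (partial 2 \<phi>1 x - partial 1 \<phi>2 x)) * \<theta> t) +
      (LINT x|\<mu>. b1 0 x * \<phi>1 x + b2 0 x * \<phi>2 x) * \<theta> 0 = 0"
begin

abbreviation "time \<equiv> lebesgue_on {0..<T}"

definition W :: "real \<Rightarrow> real ^ 2 \<Rightarrow> real" where
  "W t = flux (b1 t) (b2 t) (u1 t) (u2 t)"

lemmas sq = paths[THEN weak_pathD(1)]
lemmas M_bound = paths[THEN weak_pathD(2)]

lemma M_nonneg: "M \<ge> 0"
  using order_trans[OF _ M_bound(1)[of 0]] T_pos by simp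

lemma W_integrable: "t \<in> {0..<T} \<Longrightarrow> integrable \<mu> (W t)"
  unfolding W_def by (intro flux_integrable sq)

text \<open>The flux is a difference of two products, and by Cauchy-Schwarz each has L^1 norm at
  most \<open>M\<close>.\<close>

lemma W_pairing_bound:
  assumes t: "t \<in> {0..<T}" and h: "h \<in> borel_measurable \<mu>" "\<And>x. \<bar>h x\<bar> \<le> B"
  shows "\<bar>LINT x|\<mu>. W t x * h x\<bar> \<le> 2 * M * B"
proof -
  have B: "B \<ge> 0" using h(2)[of 0] by linarith
  have prod: "\<bar>LINT x|\<mu>. f x * (g x * h x)\<bar> \<le> M * B"
    if f: "sq_integrable f" "(LINT x|\<mu>. (f x)\<^sup>2) \<le> M" and g: "sq_integrable g" "(LINT x|\<mu>. (g x)\<^sup>2) \<le> M" for f g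
  proof -
    have gh: "sq_integrable (\<lambda>x. g x * h x)" by (rule sq_integrable_mult_bounded[OF g(1) h])
    have "(LINT x|\<mu>. (g x * h x)\<^sup>2) \<le> (LINT x|\<mu>. B\<^sup>2 * (g x)\<^sup>2)"
    proof (rule integral_mono)
      fix x
      have "(h x)\<^sup>2 \<le> B\<^sup>2" using power_mono[OF h(2)[of x], of 2] by simp
      then show "(g x * h x)\<^sup>2 \<le> B\<^sup>2 * (g x)\<^sup>2"
        using mult_left_mono[of "(h x)\<^sup>2" "B\<^sup>2" "(g x)\<^sup>2"] by (simp add: power_mult_distrib mult.commute)
    qed (use gh g(1) in \<open>simp_all add: sq_integrable_def\<close>)
    also have "\<dots> \<le> B\<^sup>2 * M" using g(2) by (simp add: mult_left_mono)
    finally have "sqrt (LINT x|\<mu>. (g x * h x)\<^sup>2) \<le> B * sqrt M"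
      using B by (metis real_sqrt_le_iff real_sqrt_mult real_sqrt_abs abs_of_nonneg)
    then have "sqrt (LINT x|\<mu>. (f x)\<^sup>2) * sqrt (LINT x|\<mu>. (g x * h x)\<^sup>2) \<le> sqrt M * (B * sqrt M)"
      using f(2) M_nonneg by (intro mult_mono) simp_all
    also have "\<dots> = M * B" using M_nonneg by simp
    finally show ?thesis using torus_cauchy_schwarz_abs[OF f(1) gh] by linarith
  qed
  have i: "integrable \<mu> (\<lambda>x. f x * (g x * h x))" if "sq_integrable f" "sq_integrable g" for f g
    by (intro sq_integrable_mult that sq_integrable_mult_bounded[OF that(2) h])
  have "(LINT x|\<mu>. W t x * h x) = (LINT x|\<mu>. b1 t x * (u2 t x * h x) - u1 t x * (b2 t x * h x))"
    by (simp add: W_def flux_def algebra_simps)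
  also have "\<dots> = (LINT x|\<mu>. b1 t x * (u2 t x * h x)) - (LINT x|\<mu>. u1 t x * (b2 t x * h x))"
    by (intro Bochner_Integration.integral_diff i sq t)
  finally show ?thesis
    using prod[OF sq(1)[OF t] M_bound(1)[OF t] sq(4)[OF t] M_bound(4)[OF t]]
      prod[OF sq(3)[OF t] M_bound(3)[OF t] sq(2)[OF t] M_bound(2)[OF t]] by linarith
qed

lemma W_pairing_measurable:
  assumes h: "\<And>t. t \<in> {0..<T} \<Longrightarrow> h t \<in> borel_measurable \<mu>" "\<And>t x. t \<in> {0..<T} \<Longrightarrow> \<bar>h t x\<bar> \<le> B"
      "\<And>x. continuous_on {0..<T} (\<lambda>t. h t x)"
  shows "(\<lambda>t. LINT x|\<mu>. W t x * h t x) \<in> borel_measurable time"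
proof -
  have "(\<lambda>t. (LINT x|\<mu>. b1 t x * u2 t x * h t x) - (LINT x|\<mu>. u1 t x * b2 t x * h t x)) \<in> borel_measurable time"
    by (intro borel_measurable_diff weak_path_product_measurable[OF paths(1,4) h]
        weak_path_product_measurable[OF paths(3,2) h])
  moreover have "(LINT x|\<mu>. b1 t x * u2 t x * h t x) - (LINT x|\<mu>. u1 t x * b2 t x * h t x) = (LINT x|\<mu>. W t x * h t x)"
    if t: "t \<in> {0..<T}" for t
  proof -
    have i: "integrable \<mu> (\<lambda>x. f x * g x * h t x)" if "sq_integrable f" "sq_integrable g" for f g
      using sq_integrable_mult[OF that(1) sq_integrable_mult_bounded[OF that(2) h(1)[OF t] h(2)[OF t]]]
      by (simp add: mult.assoc)
    show ?thesis
      by (subst Bochner_Integration.integral_diff[symmetric, OF i[OF sq(1)[OF t] sq(4)[OF t]] i[OF sq(3)[OF t] sq(2)[OF t]]])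
        (simp add: W_def flux_def algebra_simps)
  qed
  ultimately show ?thesis by (subst (asm) measurable_cong) simp_all
qed

text \<open>Weak continuity makes the pairing with a fixed test field continuous in time. This is
  why \<open>weak_time_derivative\<close> gives the integrated equation at every pair of
  times.\<close>

lemma pairing_evolution:
  assumes t1: "torus_test_function \<phi>1" and t2: "torus_test_function \<phi>2" and st: "0 \<le> s" "s \<le> t" "t < T"
  shows "(LINT x|\<mu>. b1 t x * \<phi>1 x + b2 t x * \<phi>2 x) - (LINT x|\<mu>. b1 s x * \<phi>1 x + b2 s x * \<phi>2 x)
    = (LINT r|time. indicator {s..<t} r * (LINT x|\<mu>. W r x * (partial 2 \<phi>1 x - partial 1 \<phi>2 x)))"
proof -
  define f where "f t = (LINT x|\<mu>. b1 t x * \<phi>1 x + b2 t x * \<phi>2 x)" for t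
  define c where "c x = partial 2 \<phi>1 x - partial 1 \<phi>2 x" for x
  define g where "g r = (LINT x|\<mu>. W r x * c x)" for r
  have tc: "torus_test_function c"
    unfolding c_def[abs_def] by (intro torus_test_function_diff torus_test_function_partial t1 t2)
  obtain B where B: "\<And>x. \<bar>c x\<bar> \<le> B" using torus_test_function_bounded[OF tc] by blast
  have gm: "g \<in> borel_measurable time"
    unfolding g_def[abs_def]
    by (rule W_pairing_measurable[where B=B]) (auto intro: torus_test_function_measurable tc B)
  have gb: "\<bar>g r\<bar> \<le> 2 * M * B" if "r \<in> {0..<T}" for r
    unfolding g_def by (rule W_pairing_bound[OF that torus_test_function_measurable[OF tc] B])
  have fsplit: "f t = (LINT x|\<mu>. b1 t x * \<phi>1 x) + (LINT x|\<mu>. b2 t x * \<phi>2 x)" if "t \<in> {0..<T}" for t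
    unfolding f_def
    by (intro Bochner_Integration.integral_add sq_integrable_mult sq that sq_integrable_test_function t1 t2)
  have "continuous_on {0..<T} (\<lambda>t. (LINT x|\<mu>. b1 t x * \<phi>1 x) + (LINT x|\<mu>. b2 t x * \<phi>2 x))"
    by (intro continuous_on_add weak_pathD(3)[OF paths(1)] weak_pathD(3)[OF paths(2)] sq_integrable_test_function t1 t2)
  then have fc: "continuous_on {0..<T} f" by (subst continuous_on_cong[OF refl fsplit])
  have F: "f \<tau> = f 0 + (LINT r|time. indicator {0..<\<tau>} r * g r)" if \<tau>: "0 \<le> \<tau>" "\<tau> < T" for \<tau>
  proof (cases "\<tau> = 0")
    case False
    show ?thesis
    proof (rule weak_time_derivative[OF fc gm gb])
      fix \<theta> :: "real \<Rightarrow> real" assume "smooth \<theta>" "\<exists>K. compact K \<and> K \<subseteq> {0..<T} \<and> (\<forall>t\<in>{0..<T} - K. \<theta> t = 0)"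
      from weak_eq[OF t1 t2 this]
      show "(LINT t|time. f t * deriv \<theta> t + g t * \<theta> t) + f 0 * \<theta> 0 = 0"
        by (simp only: f_def g_def c_def W_def)
    qed (use \<tau> False in auto)
  qed simp
  have i: "integrable time (\<lambda>r. indicator {a..<e} r * g r)" if "0 \<le> a" "a \<le> e" "e < T" for a e
    by (rule time_integrable_indicator[OF gm gb that])
  have "f t - f s = (LINT r|time. indicator {0..<t} r * g r) - (LINT r|time. indicator {0..<s} r * g r)"
    using F[of t] F[of s] st by simp
  also have "\<dots> = (LINT r|time. indicator {0..<t} r * g r - indicator {0..<s} r * g r)"
    using i[of 0 t] i[of 0 s] st by simp
  also have "\<dots> = (LINT r|time. indicator {s..<t} r * g r)"
    using st by (intro Bochner_Integration.integral_cong) (auto simp: indicator_def)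
  finally show ?thesis by (simp only: f_def g_def c_def)
qed

section \<open>Time regularity of the mollified potential\<close>

definition A :: "nat \<Rightarrow> real \<Rightarrow> real ^ 2 \<Rightarrow> real" where
  "A n t = potential n (b1 t) (b2 t)"

lemma A_test_function: "t \<in> {0..<T} \<Longrightarrow> torus_test_function (A n t)"
  unfolding A_def by (intro torus_test_function_potential sq_integrable_integrable sq)

text \<open>The curl of the vector kernel behind \<open>potential\<close>. Convolving the flux with
  it yields the mean minus the mollification, the formal time derivative of
  \<open>A n\<close>.\<close>

definition curl_kernel :: "nat \<Rightarrow> real ^ 2 \<Rightarrow> real" where
  "curl_kernel n z = 1 - kern2 n z"

lemma curl_kernel_test_function: "torus_test_function (curl_kernel n)"
  unfolding curl_kernel_def[abs_def]
  by (intro torus_test_function_diff torus_test_function_const torus_test_function_kern2)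

lemma curl_kernel_eq: "curl_kernel n z = - partial 2 (shear_kernel n) z - partial 1 (line_kernel n) z"
  by (simp add: curl_kernel_def kern2_def partial_shear_kernel partial_line_kernel algebra_simps)

text \<open>Unlike the supremum bound used in \<open>A_lipschitz\<close>, this one is independent of
  \<open>n\<close>; through \<open>psi_bound\<close> and \<open>rate_bound\<close> it supplies the
  dominating constant for the limit under the time integral.\<close>

lemma curl_kernel_L1: "(LINT y|\<mu>. \<bar>curl_kernel n (y - x)\<bar>) \<le> 2"
proof -
  have i: "integrable \<mu> (\<lambda>y. kern2 n (y - x))" "integrable \<mu> (\<lambda>y. \<bar>curl_kernel n (y - x)\<bar>)"
    by (intro integrable_abs torus_test_function_integrable torus_test_function_shift torus_test_function_kern2
        curl_kernel_test_function)+
  have "(LINT y|\<mu>. \<bar>curl_kernel n (y - x)\<bar>) \<le> (LINT y|\<mu>. 1 + kern2 n (y - x))"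
    using i kern2_nonneg[of n] by (intro integral_mono) (auto simp: curl_kernel_def abs_le_iff)
  also have "\<dots> = 2"
    using i kern2_integral[of n x] by (simp add: kern2_diff_commute[of n _ x])
  finally show ?thesis .
qed

text \<open>At a fixed point the potential is a pairing of the field with the reflected vector
  kernel, so \<open>pairing_evolution\<close> applies and the curl becomes
  \<open>curl_kernel\<close>. The constant depends on \<open>n\<close> through the supremum of that
  kernel, which is harmless while \<open>n\<close> is fixed.\<close>

lemma A_lipschitz:
  obtains L where "L \<ge> 0" "\<And>s t x. 0 \<le> s \<Longrightarrow> s \<le> t \<Longrightarrow> t < T \<Longrightarrow> \<bar>A n t x - A n s x\<bar> \<le> L * (t - s)"
proof -
  obtain B where B: "B > 0" "\<And>z. \<bar>curl_kernel n z\<bar> \<le> B"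
    using torus_test_function_bounded[OF curl_kernel_test_function] by blast
  note ts = torus_test_function_shear_kernel[of n] and tl = torus_test_function_line_kernel[of n]
  have "\<bar>A n t x - A n s x\<bar> \<le> 2 * M * B * (t - s)" if st: "0 \<le> s" "s \<le> t" "t < T" for s t x
  proof -
    have t1: "torus_test_function (\<lambda>y. shear_kernel n (x - y))" by (rule torus_test_function_reflect[OF ts])
    have t2: "torus_test_function (\<lambda>y. - line_kernel n (x - y))"
      by (rule torus_test_function_minus[OF torus_test_function_reflect[OF tl]])
    have eq: "A n r x = (LINT y|\<mu>. b1 r y * shear_kernel n (x - y) + b2 r y * (- line_kernel n (x - y)))"
      if "r \<in> {0..<T}" for r
      unfolding A_def potential_def conv_def
      using sq_integrable_mult[OF sq(1)[OF that] sq_integrable_test_function[OF t1]]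
        sq_integrable_mult[OF sq(2)[OF that] sq_integrable_test_function[OF t2]] by simp
    have curl: "partial 2 (\<lambda>y. shear_kernel n (x - y)) y - partial 1 (\<lambda>y. - line_kernel n (x - y)) y = curl_kernel n (x - y)" for y
    proof -
      have "partial 1 (\<lambda>y. - line_kernel n (x - y)) y = - partial 1 (\<lambda>y. line_kernel n (x - y)) y"
        using frechet_derivative_at[OF has_derivative_minus[OF torus_test_function_has_derivative[OF
              torus_test_function_reflect[OF tl, of x]], of y], symmetric] by simp
      then show ?thesis by (simp add: partial_reflect[OF ts] partial_reflect[OF tl] curl_kernel_eq)
    qed
    have "A n t x - A n s x = (LINT r|time. indicator {s..<t} r * (LINT y|\<mu>. W r y * curl_kernel n (x - y)))"
      using pairing_evolution[OF t1 t2 st] eq[of t] eq[of s] st by (simp add: curl)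
    also have "\<bar>\<dots>\<bar> \<le> 2 * M * B * (t - s)"
      by (intro time_integral_bound st W_pairing_bound torus_test_function_reflect_measurable
          curl_kernel_test_function B(2))
    finally show ?thesis .
  qed
  then show thesis using M_nonneg B(1) by (intro that[of "2 * M * B"]) auto
qed

lemma A_lipschitz':
  obtains L where "L \<ge> 0" "\<And>s t x. s \<in> {0..<T} \<Longrightarrow> t \<in> {0..<T} \<Longrightarrow> \<bar>A n t x - A n s x\<bar> \<le> L * \<bar>t - s\<bar>"
proof -
  obtain L where L: "L \<ge> 0" "\<And>s t x. 0 \<le> s \<Longrightarrow> s \<le> t \<Longrightarrow> t < T \<Longrightarrow> \<bar>A n t x - A n s x\<bar> \<le> L * (t - s)"
    using A_lipschitz by blast
  have "\<bar>A n t x - A n s x\<bar> \<le> L * \<bar>t - s\<bar>" if "s \<in> {0..<T}" "t \<in> {0..<T}" for s t x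
    using L(2)[of s t x] L(2)[of t s x] that by (cases "s \<le> t") (auto simp: abs_minus_commute)
  then show thesis using that L(1) by blast
qed

text \<open>The result of moving the convolution with \<open>curl_kernel\<close> from the flux to
  the sine: the flux is only integrable, whereas this function is smooth and bounded independently
  of \<open>n\<close>.\<close>

definition psi :: "nat \<Rightarrow> real \<Rightarrow> real ^ 2 \<Rightarrow> real" where
  "psi n s y = (LINT x|\<mu>. sin (A n s x) * curl_kernel n (x - y))"

lemma psi_eq_conv: "psi n s = conv (\<lambda>x. sin (A n s x)) (\<lambda>z. curl_kernel n (0 - z))"
  by (rule ext) (simp add: psi_def conv_def)

lemma sin_A_integrable: "s \<in> {0..<T} \<Longrightarrow> integrable \<mu> (\<lambda>x. sin (A n s x))"
  by (intro torus_test_function_integrable torus_test_function_sin A_test_function)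

lemma psi_test_function: "s \<in> {0..<T} \<Longrightarrow> torus_test_function (psi n s)"
  unfolding psi_eq_conv
  by (intro torus_test_function_conv sin_A_integrable torus_test_function_reflect curl_kernel_test_function)

lemma psi_bound: "s \<in> {0..<T} \<Longrightarrow> \<bar>psi n s y\<bar> \<le> 2"
proof -
  assume s: "s \<in> {0..<T}"
  have tsh: "torus_test_function (\<lambda>x. curl_kernel n (x - y))"
    by (rule torus_test_function_shift[OF curl_kernel_test_function])
  have "\<bar>psi n s y\<bar> \<le> (LINT x|\<mu>. \<bar>sin (A n s x) * curl_kernel n (x - y)\<bar>)"
    unfolding psi_def by (rule integral_abs_bound)
  also have "\<dots> \<le> (LINT x|\<mu>. \<bar>curl_kernel n (x - y)\<bar>)"
  proof (rule integral_mono)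
    show "integrable \<mu> (\<lambda>x. \<bar>sin (A n s x) * curl_kernel n (x - y)\<bar>)"
      by (intro integrable_abs integrable_mult_test_function sin_A_integrable s tsh)
    show "integrable \<mu> (\<lambda>x. \<bar>curl_kernel n (x - y)\<bar>)"
      by (intro integrable_abs torus_test_function_integrable tsh)
    show "\<bar>sin (A n s x) * curl_kernel n (x - y)\<bar> \<le> \<bar>curl_kernel n (x - y)\<bar>" for x
      unfolding abs_mult by (rule mult_left_le_one_le) simp_all
  qed
  also have "\<dots> \<le> 2" by (rule curl_kernel_L1)
  finally show ?thesis .
qed

text \<open>The sine is 1-Lipschitz and the kernel has L^1 norm at most 2, so the time modulus of
  \<open>A n\<close> carries over with a factor 2.\<close>

lemma psi_lipschitz:
  obtains L where "L \<ge> 0" "\<And>s t y. s \<in> {0..<T} \<Longrightarrow> t \<in> {0..<T} \<Longrightarrow> \<bar>psi n t y - psi n s y\<bar> \<le> L * \<bar>t - s\<bar>"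
proof -
  obtain L where L: "L \<ge> 0" "\<And>s t x. s \<in> {0..<T} \<Longrightarrow> t \<in> {0..<T} \<Longrightarrow> \<bar>A n t x - A n s x\<bar> \<le> L * \<bar>t - s\<bar>"
    using A_lipschitz' by blast
  have "\<bar>psi n t y - psi n s y\<bar> \<le> 2 * L * \<bar>t - s\<bar>" if st: "s \<in> {0..<T}" "t \<in> {0..<T}" for s t y
  proof -
    have tsh: "torus_test_function (\<lambda>x. curl_kernel n (x - y))"
      by (rule torus_test_function_shift[OF curl_kernel_test_function])
    have i: "integrable \<mu> (\<lambda>x. sin (A n r x) * curl_kernel n (x - y))" if "r \<in> {0..<T}" for r
      by (intro integrable_mult_test_function sin_A_integrable that tsh)
    have eq: "psi n t y - psi n s y = (LINT x|\<mu>. sin (A n t x) * curl_kernel n (x - y) - sin (A n s x) * curl_kernel n (x - y))"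
      unfolding psi_def by (rule Bochner_Integration.integral_diff[symmetric, OF i[OF st(2)] i[OF st(1)]])
    have "\<bar>psi n t y - psi n s y\<bar> \<le> (LINT x|\<mu>. \<bar>sin (A n t x) * curl_kernel n (x - y) - sin (A n s x) * curl_kernel n (x - y)\<bar>)"
      unfolding eq by (rule integral_abs_bound)
    also have "\<dots> \<le> (LINT x|\<mu>. L * \<bar>t - s\<bar> * \<bar>curl_kernel n (x - y)\<bar>)"
    proof (rule integral_mono)
      show "integrable \<mu> (\<lambda>x. \<bar>sin (A n t x) * curl_kernel n (x - y) - sin (A n s x) * curl_kernel n (x - y)\<bar>)"
        by (rule integrable_abs[OF Bochner_Integration.integrable_diff[OF i[OF st(2)] i[OF st(1)]]])
      show "integrable \<mu> (\<lambda>x. L * \<bar>t - s\<bar> * \<bar>curl_kernel n (x - y)\<bar>)"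
        by (rule integrable_mult_right, rule integrable_abs, rule torus_test_function_integrable[OF tsh])
      fix x
      have lip: "\<bar>sin (A n t x) - sin (A n s x)\<bar> \<le> L * \<bar>t - s\<bar>"
        using sin_diff_le[of "A n t x" "A n s x"] L(2)[OF st, of x] by linarith
      have e: "\<bar>a * c - b * c\<bar> = \<bar>a - b\<bar> * \<bar>c\<bar>" for a b c :: real
        by (simp only: abs_mult[symmetric] left_diff_distrib)
      show "\<bar>sin (A n t x) * curl_kernel n (x - y) - sin (A n s x) * curl_kernel n (x - y)\<bar>
        \<le> L * \<bar>t - s\<bar> * \<bar>curl_kernel n (x - y)\<bar>"
        unfolding e by (intro mult_right_mono lip) simp
    qed
    also have "\<dots> \<le> L * \<bar>t - s\<bar> * 2"
      using curl_kernel_L1 L(1) by (subst integral_mult_right_zero) (intro mult_left_mono, simp_all)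
    finally show ?thesis by simp
  qed
  then show thesis using L(1) by (intro that[of "2 * L"]) auto
qed

lemma psi_continuous: "continuous_on {0..<T} (\<lambda>t. psi n t y)"
proof -
  obtain L where L: "L \<ge> 0" "\<And>s t y. s \<in> {0..<T} \<Longrightarrow> t \<in> {0..<T} \<Longrightarrow> \<bar>psi n t y - psi n s y\<bar> \<le> L * \<bar>t - s\<bar>"
    using psi_lipschitz by blast
  have "L-lipschitz_on {0..<T} (\<lambda>t. psi n t y)"
    by (rule lipschitz_onI) (use L in \<open>auto simp: dist_real_def\<close>)
  then show ?thesis by (rule lipschitz_on_continuous_on)
qed

text \<open>The expected time derivative of \<open>cos_energy (A n r)\<close>: the pairing of
  \<open>sin (A n r)\<close> with the time derivative of the potential, after the convolution has
  been transposed onto the sine.\<close>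

definition rate :: "nat \<Rightarrow> real \<Rightarrow> real" where
  "rate n r = (LINT y|\<mu>. W r y * psi n r y)"

lemma rate_bound: "r \<in> {0..<T} \<Longrightarrow> \<bar>rate n r\<bar> \<le> 4 * M"
  unfolding rate_def
  using W_pairing_bound[of r "psi n r" 2] psi_bound torus_test_function_measurable[OF psi_test_function] by fastforce

lemma rate_measurable: "rate n \<in> borel_measurable time"
  unfolding rate_def[abs_def]
proof (rule W_pairing_measurable[where B=2])
  show "psi n t \<in> borel_measurable \<mu>" if "t \<in> {0..<T}" for t
    by (rule torus_test_function_measurable[OF psi_test_function[OF that]])
qed (rule psi_bound, assumption, rule psi_continuous)

lemma rate_tendsto_0:
  assumes r: "r \<in> {0..<T}" shows "(\<lambda>n. rate n r) \<longlonglongrightarrow> 0"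
proof -
  have "rate n r = flux_defect n (b1 r) (b2 r) (W r)" for n
  proof -
    have one: "torus_test_function (\<lambda>z. 1)" by (rule torus_test_function_const)
    have c: "conv (W r) (curl_kernel n) x = (LINT y|\<mu>. W r y) - conv (W r) (kern2 n) x" for x
      using conv_diff[OF W_integrable[OF r] one torus_test_function_kern2, of n x]
      by (simp add: curl_kernel_def[abs_def]) (simp add: conv_def)
    have "rate n r = (LINT x|\<mu>. sin (A n r x) * conv (W r) (curl_kernel n) x)"
      unfolding rate_def psi_def
      by (rule conv_fubini[OF W_integrable[OF r] sin_A_integrable[OF r] curl_kernel_test_function, symmetric])
    then show ?thesis by (simp only: c flux_defect_def A_def)
  qed
  then show ?thesis
    using flux_defect_tendsto_0[OF sq[OF r] div_free_b[OF r] div_free_u[OF r] mean_b(1)[OF r] mean_b(2)[OF r]]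
    by (simp add: W_def)
qed

text \<open>Freezing the sine at time \<open>s\<close> turns the pairing into one with a test field
  independent of time. Transposing the potential's kernels produces the fields \<phi>1 and \<phi>2,
  whose curl is \<open>psi n s\<close>.\<close>

lemma sin_A_increment:
  assumes st: "0 \<le> s" "s \<le> t" "t < T"
  shows "(LINT x|\<mu>. sin (A n s x) * (A n t x - A n s x)) = (LINT r|time. indicator {s..<t} r * (LINT y|\<mu>. W r y * psi n s y))"
proof -
  have s: "s \<in> {0..<T}" and t: "t \<in> {0..<T}" using st by auto
  note ts = torus_test_function_shear_kernel[of n] and tl = torus_test_function_line_kernel[of n]
  define \<eta> where "\<eta> x = sin (A n s x)" for x
  have \<eta>: "integrable \<mu> \<eta>" unfolding \<eta>_def[abs_def] by (rule sin_A_integrable[OF s])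
  define \<phi>1 where "\<phi>1 = conv \<eta> (\<lambda>z. shear_kernel n (0 - z))"
  define \<phi>2 where "\<phi>2 = conv \<eta> (\<lambda>z. - line_kernel n (0 - z))"
  have rs: "torus_test_function (\<lambda>z. shear_kernel n (0 - z))" by (rule torus_test_function_reflect[OF ts])
  have rl: "torus_test_function (\<lambda>z. - line_kernel n (0 - z))"
    by (rule torus_test_function_minus[OF torus_test_function_reflect[OF tl]])
  have t1: "torus_test_function \<phi>1" unfolding \<phi>1_def by (rule torus_test_function_conv[OF \<eta> rs])
  have t2: "torus_test_function \<phi>2" unfolding \<phi>2_def by (rule torus_test_function_conv[OF \<eta> rl])
  have curl: "partial 2 \<phi>1 y - partial 1 \<phi>2 y = psi n s y" for y
  proof -
    have "partial 1 (\<lambda>z. - line_kernel n (0 - z)) z = partial 1 (line_kernel n) (0 - z)" for z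
    proof -
      have "partial 1 (\<lambda>z. - line_kernel n (0 - z)) z = - partial 1 (\<lambda>z. line_kernel n (0 - z)) z"
        using frechet_derivative_at[OF has_derivative_minus[OF torus_test_function_has_derivative[OF
              torus_test_function_reflect[OF tl, of 0]], of z], symmetric] by simp
      then show ?thesis using partial_reflect[OF tl, where j=1 and x=0 and y=z] by simp
    qed
    moreover have "partial 2 (\<lambda>z. shear_kernel n (0 - z)) z = - partial 2 (shear_kernel n) (0 - z)" for z
      by (rule partial_reflect[OF ts])
    ultimately have d: "partial 2 (\<lambda>z. shear_kernel n (0 - z)) z - partial 1 (\<lambda>z. - line_kernel n (0 - z)) z
        = curl_kernel n (0 - z)" for z
      by (simp only: curl_kernel_eq)
    have "partial 2 \<phi>1 y - partial 1 \<phi>2 y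
      = conv \<eta> (\<lambda>z. partial 2 (\<lambda>z. shear_kernel n (0 - z)) z - partial 1 (\<lambda>z. - line_kernel n (0 - z)) z) y"
      unfolding \<phi>1_def \<phi>2_def conv_frechet_derivative[OF \<eta> rs] conv_frechet_derivative[OF \<eta> rl]
      by (rule conv_diff[OF \<eta> torus_test_function_partial[OF rs] torus_test_function_partial[OF rl], symmetric])
    also have "\<dots> = psi n s y" unfolding d by (simp only: psi_eq_conv \<eta>_def[abs_def])
    finally show ?thesis .
  qed
  have pair: "(LINT x|\<mu>. \<eta> x * A n r x) = (LINT y|\<mu>. b1 r y * \<phi>1 y + b2 r y * \<phi>2 y)" if r: "r \<in> {0..<T}" for r
  proof -
    note i1 = sq_integrable_integrable[OF sq(1)[OF r]] and i2 = sq_integrable_integrable[OF sq(2)[OF r]]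
    have c: "integrable \<mu> (\<lambda>x. \<eta> x * conv (b1 r) (shear_kernel n) x)" "integrable \<mu> (\<lambda>x. \<eta> x * conv (b2 r) (line_kernel n) x)"
      by (intro integrable_mult_test_function \<eta> torus_test_function_conv i1 i2 ts tl)+
    have "(LINT x|\<mu>. \<eta> x * A n r x) = (LINT x|\<mu>. \<eta> x * conv (b1 r) (shear_kernel n) x) - (LINT x|\<mu>. \<eta> x * conv (b2 r) (line_kernel n) x)"
      using c by (simp add: A_def potential_def right_diff_distrib)
    also have "(LINT x|\<mu>. \<eta> x * conv (b1 r) (shear_kernel n) x) = (LINT y|\<mu>. b1 r y * \<phi>1 y)"
      unfolding conv_fubini[OF i1 \<eta> ts] \<phi>1_def conv_def[of \<eta>] by simp
    also have "(LINT x|\<mu>. \<eta> x * conv (b2 r) (line_kernel n) x) = - (LINT y|\<mu>. b2 r y * \<phi>2 y)"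
      unfolding conv_fubini[OF i2 \<eta> tl] \<phi>2_def conv_def[of \<eta>] by simp
    also have "(LINT y|\<mu>. b1 r y * \<phi>1 y) - - (LINT y|\<mu>. b2 r y * \<phi>2 y) = (LINT y|\<mu>. b1 r y * \<phi>1 y + b2 r y * \<phi>2 y)"
      using integrable_mult_test_function[OF i1 t1] integrable_mult_test_function[OF i2 t2] by simp
    finally show ?thesis .
  qed
  have i: "integrable \<mu> (\<lambda>x. \<eta> x * A n r x)" if "r \<in> {0..<T}" for r
    by (rule integrable_mult_test_function[OF \<eta> A_test_function[OF that]])
  have "(LINT x|\<mu>. sin (A n s x) * (A n t x - A n s x)) = (LINT x|\<mu>. \<eta> x * A n t x) - (LINT x|\<mu>. \<eta> x * A n s x)"
    using i[OF s] i[OF t] by (simp add: \<eta>_def right_diff_distrib)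
  also have "\<dots> = (LINT r|time. indicator {s..<t} r * (LINT y|\<mu>. W r y * psi n s y))"
    unfolding pair[OF s] pair[OF t] pairing_evolution[OF t1 t2 st] curl ..
  finally show ?thesis .
qed

lemma energy_increment:
  obtains C where "\<And>s t. 0 \<le> s \<Longrightarrow> s \<le> t \<Longrightarrow> t < T \<Longrightarrow>
    \<bar>cos_energy (A n t) - cos_energy (A n s) - (LINT r|time. indicator {s..<t} r * rate n r)\<bar> \<le> C * (t - s)\<^sup>2"
proof -
  obtain L where L: "L \<ge> 0" "\<And>s t x. 0 \<le> s \<Longrightarrow> s \<le> t \<Longrightarrow> t < T \<Longrightarrow> \<bar>A n t x - A n s x\<bar> \<le> L * (t - s)"
    using A_lipschitz by blast
  obtain P where P: "P \<ge> 0" "\<And>s t y. s \<in> {0..<T} \<Longrightarrow> t \<in> {0..<T} \<Longrightarrow> \<bar>psi n t y - psi n s y\<bar> \<le> P * \<bar>t - s\<bar>"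
    using psi_lipschitz by blast
  have "\<bar>cos_energy (A n t) - cos_energy (A n s) - (LINT r|time. indicator {s..<t} r * rate n r)\<bar>
      \<le> (L\<^sup>2 + 2 * M * P) * (t - s)\<^sup>2" if st: "0 \<le> s" "s \<le> t" "t < T" for s t
  proof -
    have s: "s \<in> {0..<T}" and t: "t \<in> {0..<T}" using st by auto
    note tA = A_test_function[OF s, of n] A_test_function[OF t, of n]
    define X where "X = (LINT x|\<mu>. sin (A n s x) * (A n t x - A n s x))"
    have e1: "\<bar>cos_energy (A n t) - cos_energy (A n s) - X\<bar> \<le> L\<^sup>2 * (t - s)\<^sup>2"
    proof -
      have tc: "torus_test_function (\<lambda>x. 1 - cos (A n r x))" if "r \<in> {0..<T}" for r
        by (intro torus_test_function_diff torus_test_function_const torus_test_function_cos A_test_function that)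
      have tx: "torus_test_function (\<lambda>x. sin (A n s x) * (A n t x - A n s x))"
        by (intro torus_test_function_mult torus_test_function_sin torus_test_function_diff tA)
      define F where "F x = (1 - cos (A n t x)) - (1 - cos (A n s x)) - sin (A n s x) * (A n t x - A n s x)" for x
      have tF: "torus_test_function F" unfolding F_def[abs_def] by (intro torus_test_function_diff tc tx s t)
      have "cos_energy (A n t) - cos_energy (A n s) - X = (LINT x|\<mu>. F x)"
        unfolding cos_energy_def X_def F_def
        by (simp only: Bochner_Integration.integral_diff Bochner_Integration.integrable_diff
            tc[OF s, THEN torus_test_function_integrable] tc[OF t, THEN torus_test_function_integrable]
            tx[THEN torus_test_function_integrable])
      moreover have "\<bar>LINT x|\<mu>. F x\<bar> \<le> (LINT x|\<mu>. \<bar>F x\<bar>)" by (rule integral_abs_bound)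
      moreover have "(LINT x|\<mu>. \<bar>F x\<bar>) \<le> (LINT x|\<mu>. L\<^sup>2 * (t - s)\<^sup>2)"
      proof (rule integral_mono)
        fix x
        have "\<bar>F x\<bar> \<le> (A n t x - A n s x)\<^sup>2"
          using cos_taylor_le[of "A n s x" "A n t x"] by (simp add: F_def)
        also have "\<dots> \<le> L\<^sup>2 * (t - s)\<^sup>2"
          using power_mono[OF L(2)[OF st, of x], of 2] by (simp add: power_mult_distrib)
        finally show "\<bar>F x\<bar> \<le> L\<^sup>2 * (t - s)\<^sup>2" .
      qed (use torus_test_function_integrable[OF tF] in simp_all)
      ultimately show ?thesis unfolding torus_integral_const by linarith
    qed
    have e2: "\<bar>X - (LINT r|time. indicator {s..<t} r * rate n r)\<bar> \<le> 2 * M * P * (t - s)\<^sup>2"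
    proof -
      define g where "g r = (LINT y|\<mu>. W r y * psi n s y)" for r
      have gm: "g \<in> borel_measurable time" unfolding g_def[abs_def]
        by (rule W_pairing_measurable[where B=2])
          (rule torus_test_function_measurable[OF psi_test_function[OF s]], rule psi_bound[OF s], rule continuous_on_const)
      have gb: "\<bar>g r\<bar> \<le> 2 * M * 2" if "r \<in> {0..<T}" for r
        unfolding g_def by (rule W_pairing_bound[OF that torus_test_function_measurable[OF psi_test_function[OF s]] psi_bound[OF s]])
      have i1: "integrable time (\<lambda>r. indicator {s..<t} r * g r)" by (rule time_integrable_indicator[OF gm gb st])
      have i2: "integrable time (\<lambda>r. indicator {s..<t} r * rate n r)"
        by (rule time_integrable_indicator[OF rate_measurable rate_bound st])
      have "X = (LINT r|time. indicator {s..<t} r * g r)" unfolding X_def g_def by (rule sin_A_increment[OF st])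
      then have eq: "X - (LINT r|time. indicator {s..<t} r * rate n r) = (LINT r|time. indicator {s..<t} r * (g r - rate n r))"
        using i1 i2 by (simp add: right_diff_distrib)
      have "\<bar>LINT r|time. indicator {s..<t} r * (g r - rate n r)\<bar> \<le> 2 * M * (P * (t - s)) * (t - s)"
      proof (rule time_integral_bound[OF st])
        fix r assume r: "r \<in> {0..<T}" "r \<in> {s..<t}"
        note ps = torus_test_function_measurable[OF psi_test_function[OF s, of n]]
          and pr = torus_test_function_measurable[OF psi_test_function[OF r(1), of n]]
        have "g r - rate n r = (LINT y|\<mu>. W r y * (psi n s y - psi n r y))"
          unfolding g_def rate_def
          using integrable_mult_test_function[OF W_integrable[OF r(1)] psi_test_function[OF s, of n]]
            integrable_mult_test_function[OF W_integrable[OF r(1)] psi_test_function[OF r(1), of n]]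
          by (simp add: right_diff_distrib)
        also have "\<bar>\<dots>\<bar> \<le> 2 * M * (P * (t - s))"
        proof (rule W_pairing_bound[OF r(1)])
          show "(\<lambda>y. psi n s y - psi n r y) \<in> borel_measurable \<mu>" using ps pr by (rule borel_measurable_diff)
          show "\<bar>psi n s y - psi n r y\<bar> \<le> P * (t - s)" for y
          proof -
            have "\<bar>psi n s y - psi n r y\<bar> \<le> P * \<bar>s - r\<bar>" by (rule P(2)[OF r(1) s])
            also have "\<dots> \<le> P * (t - s)" using r P(1) by (intro mult_left_mono) auto
            finally show ?thesis .
          qed
        qed
        finally show "\<bar>g r - rate n r\<bar> \<le> 2 * M * (P * (t - s))" .
      qed
      then show ?thesis unfolding eq by (simp add: power2_eq_square mult.assoc)
    qed
    show ?thesis using e1 e2 by (simp add: distrib_right)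
  qed
  then show thesis by (rule that)
qed

section \<open>Conservation in the limit and its consequences\<close>

lemma energy_evolution:
  assumes "t \<in> {0..<T}"
  shows "cos_energy (A n t) - cos_energy (A n 0) = (LINT r|time. indicator {0..<t} r * rate n r)"
proof -
  obtain C where C: "\<And>s t. 0 \<le> s \<Longrightarrow> s \<le> t \<Longrightarrow> t < T \<Longrightarrow>
    \<bar>cos_energy (A n t) - cos_energy (A n s) - (LINT r|time. indicator {s..<t} r * rate n r)\<bar> \<le> C * (t - s)\<^sup>2"
    using energy_increment by blast
  define D where "D t = cos_energy (A n t) - (LINT r|time. indicator {0..<t} r * rate n r)" for t
  have "D t = D 0"
  proof (rule quadratic_modulus_imp_constant[where S="{0..<T}" and C=C and D=D])
    fix s t assume st: "s \<in> {0..<T}" "t \<in> {0..<T}" "s \<le> t"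
    have i: "integrable time (\<lambda>r. indicator {0..<a} r * rate n r)" if "0 \<le> a" "a < T" for a
      by (rule time_integrable_indicator[OF rate_measurable rate_bound]) (use that in auto)
    have "(LINT r|time. indicator {0..<t} r * rate n r) - (LINT r|time. indicator {0..<s} r * rate n r)
      = (LINT r|time. indicator {0..<t} r * rate n r - indicator {0..<s} r * rate n r)"
      using i[of s] i[of t] st by simp
    also have "\<dots> = (LINT r|time. indicator {s..<t} r * rate n r)"
      using st by (intro Bochner_Integration.integral_cong) (auto simp: indicator_def)
    finally have eq: "D t - D s = cos_energy (A n t) - cos_energy (A n s) - (LINT r|time. indicator {s..<t} r * rate n r)"
      by (simp add: D_def)
    show "\<bar>D t - D s\<bar> \<le> C * (t - s)\<^sup>2" unfolding eq using st by (intro C) auto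
  qed (use assms T_pos in auto)
  then show ?thesis by (simp add: D_def)
qed

lemma energy_difference_tendsto_0:
  assumes t: "t \<in> {0..<T}"
  shows "(\<lambda>n. cos_energy (A n t) - cos_energy (A n 0)) \<longlonglongrightarrow> 0"
proof -
  interpret time: finite_measure time by (rule finite_measure_Ico)
  have "(\<lambda>n. LINT r|time. indicator {0..<t} r * rate n r) \<longlonglongrightarrow> (LINT r|time. 0)"
  proof (rule integral_dominated_convergence[where w="\<lambda>r. 4 * M"])
    show "(\<lambda>r. indicator {0..<t} r * rate n r) \<in> borel_measurable time" for n
      using time_integrable_indicator[OF rate_measurable rate_bound, of 0 t] t by auto
    show "AE r in time. (\<lambda>n. indicator {0..<t} r * rate n r) \<longlonglongrightarrow> 0"
      by (rule AE_I2) (use rate_tendsto_0 in \<open>auto intro!: tendsto_mult_right_zero\<close>)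
    show "AE r in time. norm (indicator {0..<t} r * rate n r) \<le> 4 * M" for n
      by (rule AE_I2) (use rate_bound M_nonneg in \<open>auto simp: indicator_def\<close>)
  qed simp_all
  then show ?thesis using energy_evolution[OF t] by simp
qed

text \<open>The factor 1/2 from \<open>cos_energy_le\<close> cancels the factor 2 from
  \<open>potential_L2_bound\<close>.\<close>

lemma energy_le:
  assumes t: "t \<in> {0..<T}"
  shows "cos_energy (A n t) \<le> (LINT x|\<mu>. (b1 t x)\<^sup>2) + (LINT x|\<mu>. (b2 t x)\<^sup>2)"
  using cos_energy_le[OF A_test_function[OF t, of n]] potential_L2_bound[OF sq(1)[OF t] sq(2)[OF t], of n]
  by (simp add: A_def)

text \<open>Up to sign, the partial derivatives of \<open>A n t\<close> are the mollified components
  of the field. By \<open>cos_energy_controls_gradient\<close> they tend to 0 when paired with any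
  test function, but they also converge to the components themselves, which are therefore orthogonal
  to all test functions.\<close>

lemma vanishing_energy:
  assumes t: "t \<in> {0..<T}" and E: "(\<lambda>n. cos_energy (A n t)) \<longlonglongrightarrow> 0"
  shows "AE x in \<mu>. b1 t x = 0" "AE x in \<mu>. b2 t x = 0"
proof -
  note i = sq_integrable_integrable[OF sq(1)[OF t]] sq_integrable_integrable[OF sq(2)[OF t]]
  \<comment> \<open>Equality of absolute values absorbs the sign, so both components are treated at
    once.\<close>
  have main: "AE x in \<mu>. v x = 0"
    if v: "sq_integrable v" and j: "\<And>n x. \<bar>partial j (A n t) x\<bar> = \<bar>conv v (kern2 n) x\<bar>"
      "\<And>n \<psi>. \<bar>LINT x|\<mu>. partial j (A n t) x * \<psi> x\<bar> = \<bar>LINT x|\<mu>. conv v (kern2 n) x * \<psi> x\<bar>" for v j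
  proof -
    note vi = sq_integrable_integrable[OF v]
    have zero: "(LINT x|\<mu>. v x * \<psi> x) = 0" if \<psi>: "torus_test_function \<psi>" for \<psi>
    proof -
      obtain S where S: "\<And>x. \<bar>\<psi> x\<bar> \<le> S" using torus_test_function_bounded[OF \<psi>] by blast
      obtain S' where S': "\<And>x. \<bar>partial j \<psi> x\<bar> \<le> S'"
        using torus_test_function_bounded[OF torus_test_function_partial[OF \<psi>]] by blast
      have S0: "S \<ge> 0" using S[of 0] by linarith
      define N where "N = sqrt (LINT x|\<mu>. (v x)\<^sup>2)"
      have "(\<lambda>n. LINT x|\<mu>. conv v (kern2 n) x * \<psi> x) \<longlonglongrightarrow> 0"
      proof (rule Lim_null_comparison[OF always_eventually])
        have "(\<lambda>n. sqrt (2 * cos_energy (A n t)) * (S' + S * N)) \<longlonglongrightarrow> sqrt (2 * 0) * (S' + S * N)"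
          by (intro tendsto_intros E)
        then show "(\<lambda>n. sqrt (2 * cos_energy (A n t)) * (S' + S * N)) \<longlonglongrightarrow> 0" by simp
        show "\<forall>n. norm (LINT x|\<mu>. conv v (kern2 n) x * \<psi> x) \<le> sqrt (2 * cos_energy (A n t)) * (S' + S * N)"
        proof
          fix n
          have "(partial j (A n t) x)\<^sup>2 = (conv v (kern2 n) x)\<^sup>2" for x
            using j(1)[of n x] by (simp only: power2_eq_iff abs_eq_iff)
          then have "sqrt (LINT x|\<mu>. (partial j (A n t) x)\<^sup>2) \<le> N"
            using kern2_conv_L2_bound[OF v, of n] by (simp add: N_def)
          then have "sqrt (2 * cos_energy (A n t)) * (S' + S * sqrt (LINT x|\<mu>. (partial j (A n t) x)\<^sup>2))
            \<le> sqrt (2 * cos_energy (A n t)) * (S' + S * N)"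
            using S0 by (intro mult_left_mono add_left_mono) (simp_all add: cos_energy_nonneg)
          then show "norm (LINT x|\<mu>. conv v (kern2 n) x * \<psi> x) \<le> sqrt (2 * cos_energy (A n t)) * (S' + S * N)"
            using cos_energy_controls_gradient[OF A_test_function[OF t] \<psi> S S', of n] j(2)[of n \<psi>]
            by simp
        qed
      qed
      moreover have "(\<lambda>n. LINT x|\<mu>. conv v (kern2 n) x * \<psi> x) \<longlonglongrightarrow> (LINT x|\<mu>. v x * \<psi> x)"
      proof -
        have rs: "sq_integrable (\<lambda>x. conv v (kern2 n) x - v x)" for n
          by (intro sq_integrable_diff v sq_integrable_test_function torus_test_function_conv vi torus_test_function_kern2)
        note \<psi>s = sq_integrable_test_function[OF \<psi>]
        have "(\<lambda>n. sqrt (LINT x|\<mu>. (conv v (kern2 n) x - v x)\<^sup>2) * sqrt (LINT x|\<mu>. (\<psi> x)\<^sup>2)) \<longlonglongrightarrow> sqrt 0 * sqrt (LINT x|\<mu>. (\<psi> x)\<^sup>2)"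
          by (intro tendsto_intros kern2_conv_tendsto_L2 v)
        then have l: "(\<lambda>n. sqrt (LINT x|\<mu>. (conv v (kern2 n) x - v x)\<^sup>2) * sqrt (LINT x|\<mu>. (\<psi> x)\<^sup>2)) \<longlonglongrightarrow> 0"
          by simp
        have "(\<lambda>n. LINT x|\<mu>. (conv v (kern2 n) x - v x) * \<psi> x) \<longlonglongrightarrow> 0"
          by (rule Lim_null_comparison[OF always_eventually l]) (use torus_cauchy_schwarz_abs[OF rs \<psi>s] in simp)
        moreover have "(LINT x|\<mu>. (conv v (kern2 n) x - v x) * \<psi> x) = (LINT x|\<mu>. conv v (kern2 n) x * \<psi> x) - (LINT x|\<mu>. v x * \<psi> x)" for n
          using integrable_mult_test_function[OF vi \<psi>]
            integrable_mult_test_function[OF torus_test_function_integrable[OF torus_test_function_conv[OF vi torus_test_function_kern2[of n]]] \<psi>]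
          by (simp add: left_diff_distrib)
        ultimately show ?thesis using LIM_zero_cancel by force
      qed
      ultimately show ?thesis using LIMSEQ_unique by blast
    qed
    \<comment> \<open>The reflected kernel is itself a test function, so every mollification of
      \<open>v\<close> vanishes, and so does its limit.\<close>
    have "conv v (kern2 n) x = 0" for n x
      unfolding conv_def by (rule zero[OF torus_test_function_reflect[OF torus_test_function_kern2]])
    then have "(LINT x|\<mu>. (v x)\<^sup>2) = 0"
      using kern2_conv_tendsto_L2[OF v] by (simp add: LIMSEQ_const_iff)
    then have "AE x in \<mu>. (v x)\<^sup>2 = 0"
      using v by (subst (asm) integral_nonneg_eq_0_iff_AE) (auto simp: sq_integrable_def)
    then show ?thesis by simp
  qed
  have p: "partial 1 (A n t) x = - conv (b2 t) (kern2 n) x" "partial 2 (A n t) x = conv (b1 t) (kern2 n) x" for n x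
    unfolding A_def by (rule partial_potential[OF i div_free_b[OF t] mean_b(1)[OF t] mean_b(2)[OF t]])+
  show "AE x in \<mu>. b1 t x = 0" by (rule main[OF sq(1)[OF t], of 2]) (simp_all add: p)
  show "AE x in \<mu>. b2 t x = 0" by (rule main[OF sq(2)[OF t], of 1]) (simp_all add: p)
qed

theorem dichotomy:
  "(\<forall>t\<in>{0..<T}. (AE x in \<mu>. b1 t x = 0) \<and> (AE x in \<mu>. b2 t x = 0)) \<or>
   (\<exists>C>0. \<forall>t\<in>{0..<T}. C \<le> (LINT x|\<mu>. (b1 t x)\<^sup>2) + (LINT x|\<mu>. (b2 t x)\<^sup>2))"
proof (rule disjCI)
  assume neg: "\<not> (\<exists>C>0. \<forall>t\<in>{0..<T}. C \<le> (LINT x|\<mu>. (b1 t x)\<^sup>2) + (LINT x|\<mu>. (b2 t x)\<^sup>2))"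
  show "\<forall>t\<in>{0..<T}. (AE x in \<mu>. b1 t x = 0) \<and> (AE x in \<mu>. b2 t x = 0)"
  proof
    fix t0 assume t0: "t0 \<in> {0..<T}"
    have "(\<lambda>n. cos_energy (A n t0)) \<longlonglongrightarrow> 0"
    proof (rule LIMSEQ_I)
      fix e :: real assume e: "e > 0"
      \<comment> \<open>The low-energy time is fixed before \<open>n\<close>: the convergence to a
        conserved energy is used at the two times \<open>t0\<close> and \<open>t\<close> only, each
        compared with time 0.\<close>
      then obtain t where t: "t \<in> {0..<T}" "(LINT x|\<mu>. (b1 t x)\<^sup>2) + (LINT x|\<mu>. (b2 t x)\<^sup>2) < e / 2"
        using neg by (metis half_gt_zero not_le)
      have "(\<lambda>n. (cos_energy (A n t0) - cos_energy (A n 0)) - (cos_energy (A n t) - cos_energy (A n 0))) \<longlonglongrightarrow> 0 - 0"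
        by (intro tendsto_diff energy_difference_tendsto_0 t0 t(1))
      then have "(\<lambda>n. cos_energy (A n t0) - cos_energy (A n t)) \<longlonglongrightarrow> 0" by simp
      then have "\<forall>\<^sub>F n in sequentially. cos_energy (A n t0) - cos_energy (A n t) < e / 2"
        by (rule order_tendstoD(2)) (use e in simp)
      then obtain N where N: "\<And>n. n \<ge> N \<Longrightarrow> cos_energy (A n t0) - cos_energy (A n t) < e / 2"
        by (auto simp: eventually_sequentially)
      show "\<exists>N. \<forall>n\<ge>N. norm (cos_energy (A n t0) - 0) < e"
      proof (intro exI allI impI)
        fix n assume "n \<ge> N"
        then have "cos_energy (A n t0) < e" using N[of n] energy_le[OF t(1), of n] t(2) by simp
        then show "norm (cos_energy (A n t0) - 0) < e" using cos_energy_nonneg[of "A n t0"] by simp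
      qed
    qed
    from vanishing_energy[OF t0 this]
    show "(AE x in \<mu>. b1 t0 x = 0) \<and> (AE x in \<mu>. b2 t0 x = 0)" ..
  qed
qed

end


subsection \<open>From almost every time to every time\<close>

text \<open>A set of full measure meets every short interval to the right of \<open>t\<close>.
  Approaching from the right includes the time 0.\<close>

lemma time_AE_sequence:
  assumes P: "AE t in lebesgue_on {0..<T::real}. P t" and t: "t \<in> {0..<T}"
  obtains s where "\<And>n. s n \<in> {0..<T}" "\<And>n. P (s n)" "s \<longlonglongrightarrow> t"
proof -
  have P': "AE r in lebesgue. r \<in> {0..<T} \<longrightarrow> P r"
    using P by (subst (asm) AE_restrict_space_iff) auto
  have "\<exists>r. r \<in> {0..<T} \<and> t \<le> r \<and> r < t + e \<and> P r" if "e > 0" for e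
  proof (rule ccontr)
    assume neg: "\<not> (\<exists>r. r \<in> {0..<T} \<and> t \<le> r \<and> r < t + e \<and> P r)"
    have "AE r in lebesgue. r \<notin> {t..<min T (t + e)}"
      using P' by eventually_elim (use neg t in auto)
    then have "{t..<min T (t + e)} \<in> null_sets lebesgue"
      by (subst (asm) AE_iff_null_sets[symmetric]) auto
    then have "emeasure lebesgue {t..<min T (t + e)} = 0" by auto
    moreover have "emeasure lebesgue {t..<min T (t + e)} = ennreal (min T (t + e) - t)"
      using t that by (subst emeasure_completion) auto
    ultimately show False using t that by (auto simp: min_def split: if_splits)
  qed
  then have "\<exists>r. r \<in> {0..<T} \<and> t \<le> r \<and> r < t + inverse (real (Suc n)) \<and> P r" for n by simp
  then obtain s where s: "\<And>n. s n \<in> {0..<T} \<and> t \<le> s n \<and> s n < t + inverse (real (Suc n)) \<and> P (s n)"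
    by metis
  have "s \<longlonglongrightarrow> t"
  proof (rule tendsto_sandwich[of "\<lambda>_. t" s _ "\<lambda>n. t + inverse (real (Suc n))"])
    have "(\<lambda>n. t + inverse (real (Suc n))) \<longlonglongrightarrow> t + 0"
      by (intro tendsto_intros LIMSEQ_inverse_real_of_nat)
    then show "(\<lambda>n. t + inverse (real (Suc n))) \<longlonglongrightarrow> t" by simp
    show "\<forall>\<^sub>F n in sequentially. s n \<le> t + inverse (real (Suc n))"
      by (intro always_eventually allI less_imp_le) (use s in blast)
  qed (use s in auto)
  then show thesis using s that by blast
qed

lemma continuous_time_AE_zero:
  fixes F :: "real \<Rightarrow> real"
  assumes F: "continuous_on {0..<T} F" "AE t in lebesgue_on {0..<T}. F t = 0" and t: "t \<in> {0..<T}"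
  shows "F t = 0"
proof -
  obtain s where s: "\<And>n. s n \<in> {0..<T}" "\<And>n. F (s n) = 0" "s \<longlonglongrightarrow> t"
    using time_AE_sequence[OF F(2) t] by blast
  have "(\<lambda>n. F (s n)) \<longlonglongrightarrow> F t"
    using F(1) s(1,3) t unfolding continuous_on_sequentially comp_def by blast
  then show ?thesis by (simp add: s(2) LIMSEQ_const_iff)
qed

text \<open>The fundamental lemma of the calculus of variations. The tests live in the open
  interval, so interior times come first and continuity then reaches time 0.\<close>

lemma continuous_time_test_zero:
  fixes F :: "real \<Rightarrow> real"
  assumes F: "continuous_on {0..<T} F"
    and test: "\<And>\<theta>. smooth \<theta> \<Longrightarrow> (\<exists>K. compact K \<and> K \<subseteq> {0<..<T} \<and> (\<forall>t\<in>{0<..<T} - K. \<theta> t = 0)) \<Longrightarrow>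
      (LINT t|lebesgue_on {0<..<T}. \<theta> t * F t) = 0"
    and t: "t \<in> {0..<T}"
  shows "F t = 0"
proof -
  have pos: "\<not> G \<tau> > 0" if G: "continuous_on {0..<T} G" and test: "\<And>\<theta>. smooth \<theta> \<Longrightarrow>
      (\<exists>K. compact K \<and> K \<subseteq> {0<..<T} \<and> (\<forall>t\<in>{0<..<T} - K. \<theta> t = 0)) \<Longrightarrow>
      (LINT t|lebesgue_on {0<..<T}. \<theta> t * G t) = 0" and \<tau>: "0 < \<tau>" "\<tau> < T" for G :: "real \<Rightarrow> real" and \<tau>
  proof
    assume "G \<tau> > 0"
    then obtain d where d: "d > 0" "\<And>r. r \<in> {0..<T} \<Longrightarrow> dist r \<tau> < d \<Longrightarrow> dist (G r) (G \<tau>) < G \<tau>"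
      using G[unfolded continuous_on_iff, rule_format, of \<tau> "G \<tau>"] \<tau> by auto
    \<comment> \<open>Small enough for the interval of radius \<open>e\<close> about \<tau> to stay
      inside the open time interval and where \<open>G\<close> is positive.\<close>
    define e where "e = min (d / 2) (min (\<tau> / 2) ((T - \<tau>) / 2))"
    have e: "e > 0" "e < d" "e < \<tau>" "e < T - \<tau>" using d \<tau> by (auto simp: e_def min_def)
    define \<alpha> where "\<alpha> = \<tau> - e"
    define \<beta> where "\<beta> = \<tau> + e"
    have sub: "{\<alpha>..\<beta>} \<subseteq> {0<..<T}" using e by (auto simp: \<alpha>_def \<beta>_def)
    have Gp: "G r > 0" if "r \<in> {\<alpha>..\<beta>}" for r
      using d(2)[of r] sub that e by (force simp: dist_real_def \<alpha>_def \<beta>_def)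
    \<comment> \<open>A smooth bump, positive exactly between \<alpha> and \<beta>.\<close>
    define \<theta> where "\<theta> r = flat_exp 0 (1 * r + - \<alpha>) * flat_exp 0 (- 1 * r + \<beta>)" for r
    have sm: "smooth \<theta>"
      unfolding \<theta>_def by (intro smooth_mult smooth_affine[OF bounded_linear_mult_right smooth_flat_exp])
    have zero: "\<theta> r = 0" if "r \<notin> {\<alpha>..\<beta>}" for r
      using that by (auto simp: \<theta>_def flat_exp_eq_0)
    have cont: "continuous_on {\<alpha>..\<beta>} (\<lambda>r. \<theta> r * G r)"
      by (intro continuous_on_mult smooth_continuous_on[OF sm] continuous_on_subset[OF G]) (use sub in force)
    define I where "I = integral {\<alpha>..\<beta>} (\<lambda>r. \<theta> r * G r)"
    have hI: "((\<lambda>r. \<theta> r * G r) has_integral I) {\<alpha>..\<beta>}"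
      unfolding I_def by (rule integrable_integral[OF integrable_continuous_real[OF cont]])
    have "has_bochner_integral (lebesgue_on {0<..<T}) (\<lambda>r. \<theta> r * G r) I"
      by (rule has_bochner_integral_lebesgue_on_superset[OF hI cont sub]) (use zero in auto)
    moreover have "(LINT t|lebesgue_on {0<..<T}. \<theta> t * G t) = 0"
      by (rule test[OF sm]) (use sub zero in \<open>auto intro!: exI[of _ "{\<alpha>..\<beta>}"]\<close>)
    ultimately have "I = 0" by (simp add: has_bochner_integral_iff)
    have "\<theta> \<tau> * G \<tau> = 0"
    proof (rule has_integral_0_cbox_imp_0[of \<alpha> \<beta> "\<lambda>r. \<theta> r * G r"])
      show "0 \<le> \<theta> r * G r" if "r \<in> box \<alpha> \<beta>" for r
        using Gp[of r] that by (auto simp: \<theta>_def flat_exp_nonneg intro!: mult_nonneg_nonneg)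
    qed (use cont hI \<open>I = 0\<close> e in \<open>auto simp: \<alpha>_def \<beta>_def\<close>)
    moreover have "\<theta> \<tau> > 0" using e by (simp add: \<theta>_def \<alpha>_def \<beta>_def flat_exp_pos)
    ultimately show False using \<open>G \<tau> > 0\<close> by simp
  qed
  have "F \<tau> = 0" if \<tau>: "0 < \<tau>" "\<tau> < T" for \<tau>
  proof -
    have "\<not> F \<tau> > 0" by (rule pos[OF F test \<tau>])
    moreover have "\<not> - F \<tau> > 0"
    proof (rule pos[OF _ _ \<tau>])
      show "continuous_on {0..<T} (\<lambda>r. - F r)" by (intro continuous_intros F)
    qed (use test in simp)
    ultimately show ?thesis by simp
  qed
  moreover have "AE r in lebesgue_on {0..<T}. r \<noteq> 0"
  proof -
    have "AE r in lebesgue. r \<notin> {0::real}"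
      by (intro AE_not_in) (simp add: negligible_iff_null_sets[symmetric])
    then show ?thesis by (subst AE_restrict_space_iff) auto
  qed
  then have "AE r in lebesgue_on {0..<T}. F r = 0"
    by (rule AE_mp[OF _ AE_I2]) (use calculation in auto)
  then show ?thesis by (rule continuous_time_AE_zero[OF F _ t])
qed

subsection \<open>Components of the fields\<close>

lemma norm_real2_squared: "(norm (v :: real ^ 2))\<^sup>2 = (v $ 1)\<^sup>2 + (v $ 2)\<^sup>2"
  by (simp add: norm_vec_def L2_set_def sum_2)

lemma inner_real2: "(v :: real ^ 2) \<bullet> w = v $ 1 * w $ 1 + v $ 2 * w $ 2"
  by (simp add: inner_vec_def sum_2)

lemma L2_torus_component:
  assumes "f \<in> L2_torus"
  shows "sq_integrable (\<lambda>x. f x $ j)"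
proof -
  have m: "f \<in> borel_measurable \<mu>" and i: "integrable \<mu> (\<lambda>x. (norm (f x))\<^sup>2)"
    using assms by (auto simp: L2_torus_def)
  have "(\<lambda>x. f x \<bullet> axis j 1) \<in> borel_measurable \<mu>" using m by measurable
  then have m': "(\<lambda>x. f x $ j) \<in> borel_measurable \<mu>" by (simp add: inner_axis)
  have "integrable \<mu> (\<lambda>x. (f x $ j)\<^sup>2)"
  proof (rule Bochner_Integration.integrable_bound[OF i])
    show "AE x in \<mu>. norm ((f x $ j)\<^sup>2) \<le> norm ((norm (f x))\<^sup>2)"
      using component_le_norm_cart by (auto intro!: AE_I2 simp: abs_le_square_iff[symmetric])
  qed (use m' in simp)
  then show ?thesis using m' by (simp add: sq_integrable_def)
qed

lemma L2_torus_axis: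
  assumes "sq_integrable h" shows "(\<lambda>x. h x *\<^sub>R axis j 1) \<in> L2_torus"
  using assms by (auto simp: sq_integrable_def L2_torus_def power_mult_distrib norm_axis_1)

lemma L2_torus_integral_component:
  assumes "f \<in> L2_torus"
  shows "(LINT x|\<mu>. f x) $ j = (LINT x|\<mu>. f x $ j)"
proof -
  have m: "f \<in> borel_measurable \<mu>" and i: "integrable \<mu> (\<lambda>x. (norm (f x))\<^sup>2)"
    using assms by (auto simp: L2_torus_def)
  have "integrable \<mu> f"
  proof (rule Bochner_Integration.integrable_bound[where f="\<lambda>x. 1 + (norm (f x))\<^sup>2"])
    have "r \<le> 1 + r\<^sup>2" for r :: real
      using zero_le_power2[of "r - 1 / 2"] by (simp add: power2_diff power_divide)
    then show "AE x in \<mu>. norm (f x) \<le> norm (1 + (norm (f x))\<^sup>2)" by (auto intro!: AE_I2)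
  qed (use m i in auto)
  then show ?thesis
    using integral_bounded_linear[OF bounded_linear_vec_nth] by metis
qed

lemma Cw_L2_slice: "v \<in> Cw_L2 T \<Longrightarrow> t \<in> {0..<T} \<Longrightarrow> (\<lambda>x. v (x, t)) \<in> L2_torus"
  by (simp add: Cw_L2_def)

lemma Cw_L2_pairing_continuous:
  assumes v: "v \<in> Cw_L2 T" and h: "sq_integrable h"
  shows "continuous_on {0..<T} (\<lambda>t. LINT x|\<mu>. v (x, t) $ j * h x)"
  unfolding continuous_on_sequentially
proof (intro allI ballI impI, elim conjE)
  fix s t assume "t \<in> {0..<T}" "\<forall>n. s n \<in> {0..<T}" "s \<longlonglongrightarrow> t"
  then have "weakly_converges_L2 (\<lambda>n x. v (x, s n)) (\<lambda>x. v (x, t))"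
    using v by (auto simp: Cw_L2_def)
  then have "(\<lambda>n. LINT x|\<mu>. v (x, s n) \<bullet> (h x *\<^sub>R axis j 1)) \<longlonglongrightarrow> (LINT x|\<mu>. v (x, t) \<bullet> (h x *\<^sub>R axis j 1))"
    unfolding weakly_converges_L2_def using L2_torus_axis[OF h, of j] by (rule bspec)
  then show "((\<lambda>t. LINT x|\<mu>. v (x, t) $ j * h x) \<circ> s) \<longlonglongrightarrow> (LINT x|\<mu>. v (x, t) $ j * h x)"
    by (simp add: comp_def inner_axis mult.commute)
qed

text \<open>The bound is given at almost every time only. At any other time, approximate by good
  times and pair with the slice itself: Cauchy-Schwarz gives \<open>X \<le> sqrt M * sqrt X\<close>
  in the limit, hence \<open>X \<le> M\<close>.\<close>

lemma Cw_L2_weak_path: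
  assumes v: "v \<in> Cw_L2 T"
  obtains M where "\<And>j. weak_path T M (\<lambda>t x. v (x, t) $ j)"
proof -
  obtain M0 where M0: "AE t in lebesgue_on {0..<T}. (LINT x|\<mu>. (norm (v (x, t)))\<^sup>2) \<le> M0"
    using v by (auto simp: Cw_L2_def)
  \<comment> \<open>The maximum with 0 settles the case \<open>X = 0\<close>, where one cannot
    divide by \<open>sqrt X\<close>.\<close>
  define M where "M = max 0 M0"
  have good: "(LINT x|\<mu>. (v (x, t) $ j)\<^sup>2) \<le> M" if t: "t \<in> {0..<T}" "(LINT x|\<mu>. (norm (v (x, t)))\<^sup>2) \<le> M0" for t j
  proof -
    have "(LINT x|\<mu>. (v (x, t) $ j)\<^sup>2) \<le> (LINT x|\<mu>. (norm (v (x, t)))\<^sup>2)"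
    proof (rule integral_mono)
      show "integrable \<mu> (\<lambda>x. (v (x, t) $ j)\<^sup>2)"
        using L2_torus_component[OF Cw_L2_slice[OF v t(1)]] by (simp add: sq_integrable_def)
      show "integrable \<mu> (\<lambda>x. (norm (v (x, t)))\<^sup>2)"
        using Cw_L2_slice[OF v t(1)] by (simp add: L2_torus_def)
      show "(v (x, t) $ j)\<^sup>2 \<le> (norm (v (x, t)))\<^sup>2" for x
        using component_le_norm_cart[of "v (x, t)" j] by (simp add: abs_le_square_iff[symmetric])
    qed
    then show ?thesis using t(2) by (simp add: M_def)
  qed
  have bound: "(LINT x|\<mu>. (v (x, t) $ j)\<^sup>2) \<le> M" if t: "t \<in> {0..<T}" for t j
  proof -
    obtain s where s: "\<And>n. s n \<in> {0..<T}" "\<And>n. (LINT x|\<mu>. (norm (v (x, s n)))\<^sup>2) \<le> M0" "s \<longlonglongrightarrow> t"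
      using time_AE_sequence[OF M0 t] by blast
    define X where "X = (LINT x|\<mu>. (v (x, t) $ j)\<^sup>2)"
    have X: "X \<ge> 0" by (simp add: X_def)
    have vt: "sq_integrable (\<lambda>x. v (x, t) $ j)" by (rule L2_torus_component[OF Cw_L2_slice[OF v t]])
    have "(\<lambda>n. LINT x|\<mu>. v (x, s n) $ j * v (x, t) $ j) \<longlonglongrightarrow> (LINT x|\<mu>. v (x, t) $ j * v (x, t) $ j)"
      using Cw_L2_pairing_continuous[OF v vt, of j] s(1,3) t unfolding continuous_on_sequentially comp_def by blast
    moreover have "(LINT x|\<mu>. v (x, s n) $ j * v (x, t) $ j) \<le> sqrt M * sqrt X" for n
    proof -
      have "(LINT x|\<mu>. v (x, s n) $ j * v (x, t) $ j) \<le> sqrt (LINT x|\<mu>. (v (x, s n) $ j)\<^sup>2) * sqrt X"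
        using torus_cauchy_schwarz_abs[OF L2_torus_component[OF Cw_L2_slice[OF v s(1)]] vt, of n j] by (simp add: X_def)
      also have "\<dots> \<le> sqrt M * sqrt X"
        using good[OF s(1) s(2)] X by (intro mult_right_mono) simp_all
      finally show ?thesis .
    qed
    ultimately have "(LINT x|\<mu>. v (x, t) $ j * v (x, t) $ j) \<le> sqrt M * sqrt X"
      by (intro LIMSEQ_le_const2) auto
    moreover have "(LINT x|\<mu>. v (x, t) $ j * v (x, t) $ j) = sqrt X * sqrt X"
      using X by (simp add: X_def power2_eq_square)
    ultimately have le: "sqrt X * sqrt X \<le> sqrt M * sqrt X" by simp
    have "X \<le> M"
    proof (cases "X = 0")
      case False
      then show ?thesis using mult_right_le_imp_le[OF le] X by simp
    qed (simp add: M_def)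
    then show ?thesis by (simp add: X_def)
  qed
  have "weak_path T M (\<lambda>t x. v (x, t) $ j)" for j
    unfolding weak_path_def
    using L2_torus_component[OF Cw_L2_slice[OF v]] bound Cw_L2_pairing_continuous[OF v] by blast
  then show thesis by (rule that)
qed

lemma weak_path_mono: "weak_path T M v \<Longrightarrow> M \<le> M' \<Longrightarrow> weak_path T M' v"
  unfolding weak_path_def by (meson order_trans)

lemma smooth_product_time:
  fixes \<psi> :: "real ^ 2 \<Rightarrow> real" and \<theta> :: "real \<Rightarrow> real"
  assumes "smooth \<psi>" "smooth \<theta>"
  shows "smooth (\<lambda>p. \<theta> (snd p) * \<psi> (fst p))"
  using smooth_mult[OF smooth_affine[OF bounded_linear_snd assms(2), of 0] smooth_affine[OF bounded_linear_fst assms(1), of 0]]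
  by simp

text \<open>Testing with a product of a time and a space function isolates, for each space function,
  a pairing that is continuous in time. It vanishes at every time, so no exceptional null set
  depending on the test function arises.\<close>

lemma spacetime_div_free_imp_div_free:
  assumes v: "v \<in> Cw_L2 T" and dv: "spacetime_div_free T v" and t: "t \<in> {0..<T}"
  shows "div_free (\<lambda>x. v (x, t) $ 1) (\<lambda>x. v (x, t) $ 2)"
  unfolding div_free_def
proof (intro allI impI)
  fix \<psi> assume \<psi>: "torus_test_function \<psi>"
  note t\<psi> = sq_integrable_test_function[OF torus_test_function_partial[OF \<psi>]]
  define F where "F t = (LINT x|\<mu>. v (x, t) $ 1 * partial 1 \<psi> x + v (x, t) $ 2 * partial 2 \<psi> x)" for t
  have Fs: "F r = (LINT x|\<mu>. v (x, r) $ 1 * partial 1 \<psi> x) + (LINT x|\<mu>. v (x, r) $ 2 * partial 2 \<psi> x)"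
    if "r \<in> {0..<T}" for r
    unfolding F_def
    by (intro Bochner_Integration.integral_add sq_integrable_mult t\<psi> L2_torus_component[OF Cw_L2_slice[OF v that]])
  have "continuous_on {0..<T} (\<lambda>r. (LINT x|\<mu>. v (x, r) $ 1 * partial 1 \<psi> x) + (LINT x|\<mu>. v (x, r) $ 2 * partial 2 \<psi> x))"
    by (intro continuous_on_add Cw_L2_pairing_continuous[OF v t\<psi>])
  then have Fc: "continuous_on {0..<T} F" by (subst continuous_on_cong[OF refl Fs])
  have "F t = 0"
  proof (rule continuous_time_test_zero[OF Fc _ t])
    fix \<theta> :: "real \<Rightarrow> real"
    assume \<theta>: "smooth \<theta>" "\<exists>K. compact K \<and> K \<subseteq> {0<..<T} \<and> (\<forall>t\<in>{0<..<T} - K. \<theta> t = 0)"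
    define \<phi> where "\<phi> p = \<theta> (snd p) * \<psi> (fst p)" for p
    have "test_function {0<..<T} \<phi>"
      unfolding test_function_def
    proof (intro conjI)
      show "smooth \<phi>" unfolding \<phi>_def[abs_def]
        using \<psi> \<theta>(1) by (intro smooth_product_time) (auto simp: torus_test_function_def)
      show "\<forall>x t j. \<phi> (x + axis j 1, t) = \<phi> (x, t)"
        using \<psi> by (simp add: \<phi>_def torus_test_function_def)
      show "\<exists>K. compact K \<and> K \<subseteq> {0<..<T} \<and> (\<forall>x. \<forall>t\<in>{0<..<T} - K. \<phi> (x, t) = 0)"
        using \<theta>(2) by (auto simp: \<phi>_def)
    qed
    then have "(LINT t|lebesgue_on {0<..<T}. LINT x|\<mu>. v (x, t) \<bullet> grad (\<lambda>y. \<phi> (y, t)) x) = 0"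
      using dv by (simp add: spacetime_div_free_def)
    moreover have "(LINT x|\<mu>. v (x, t) \<bullet> grad (\<lambda>y. \<phi> (y, t)) x) = \<theta> t * F t" for t
    proof -
      have "partial j (\<lambda>y. \<theta> t * \<psi> y) x = \<theta> t * partial j \<psi> x" for j x
        using partial_mult[OF torus_test_function_const[of "\<theta> t"] \<psi>, where j=j and x=x]
        by (simp add: frechet_derivative_const)
      then have "v (x, t) \<bullet> grad (\<lambda>y. \<phi> (y, t)) x = \<theta> t * (v (x, t) $ 1 * partial 1 \<psi> x + v (x, t) $ 2 * partial 2 \<psi> x)" for x
        by (simp add: grad_def \<phi>_def inner_real2 algebra_simps)
      then show ?thesis by (simp add: F_def)
    qed
    ultimately show "(LINT t|lebesgue_on {0<..<T}. \<theta> t * F t) = 0" by simp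
  qed
  then show "(LINT x|\<mu>. v (x, t) $ 1 * partial 1 \<psi> x + v (x, t) $ 2 * partial 2 \<psi> x) = 0"
    by (simp add: F_def)
qed

lemma mean_zero_all_times:
  assumes v: "v \<in> Cw_L2 T" and mean: "AE t in lebesgue_on {0..<T}. (LINT x|\<mu>. v (x, t)) = 0" and t: "t \<in> {0..<T}"
  shows "(LINT x|\<mu>. v (x, t) $ j) = 0"
proof (rule continuous_time_AE_zero[OF _ _ t])
  show "continuous_on {0..<T} (\<lambda>t. LINT x|\<mu>. v (x, t) $ j)"
    using Cw_L2_pairing_continuous[OF v sq_integrable_test_function[OF torus_test_function_const[of 1]], of j] by simp
  show "AE t in lebesgue_on {0..<T}. (LINT x|\<mu>. v (x, t) $ j) = 0"
    using mean AE_space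
  proof eventually_elim
    case (elim t)
    then show ?case using L2_torus_integral_component[OF Cw_L2_slice[OF v, of t], of j] by simp
  qed
qed

text \<open>For the test field \<theta>(t) (\<phi>1, \<phi>2) the diagonal of the antisymmetric
  matrix drops out, and the two remaining entries combine into the flux times
  \<open>partial 2 \<phi>1 x - partial 1 \<phi>2 x\<close>.\<close>

lemma weak_induction_equation_separated:
  assumes u: "u \<in> Cw_L2 T" and b: "b \<in> Cw_L2 T" and "weak_induction_equation T b0 u b"
    and t1: "torus_test_function \<phi>1" and t2: "torus_test_function \<phi>2" and \<theta>: "smooth \<theta>"
      "\<exists>K. compact K \<and> K \<subseteq> {0..<T} \<and> (\<forall>t\<in>{0..<T} - K. \<theta> t = 0)"
  shows "(LINT t|lebesgue_on {0..<T}. (LINT x|\<mu>. b (x, t) $ 1 * \<phi>1 x + b (x, t) $ 2 * \<phi>2 x) * deriv \<theta> t +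
        (LINT x|\<mu>. flux (\<lambda>x. b (x, t) $ 1) (\<lambda>x. b (x, t) $ 2) (\<lambda>x. u (x, t) $ 1) (\<lambda>x. u (x, t) $ 2) x
           * (partial 2 \<phi>1 x - partial 1 \<phi>2 x)) * \<theta> t) +
      (LINT x|\<mu>. b0 x $ 1 * \<phi>1 x + b0 x $ 2 * \<phi>2 x) * \<theta> 0 = 0"
proof -
  define \<Phi> :: "real ^ 2 \<Rightarrow> real ^ 2" where "\<Phi> x = \<phi>1 x *\<^sub>R axis 1 1 + \<phi>2 x *\<^sub>R axis 2 1" for x
  define \<phi> where "\<phi> p = \<theta> (snd p) *\<^sub>R \<Phi> (fst p)" for p
  have comp: "\<Phi> x $ 1 = \<phi>1 x" "\<Phi> x $ 2 = \<phi>2 x" for x by (simp_all add: \<Phi>_def axis_def)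
  have "test_function {0..<T} \<phi>"
    unfolding test_function_def
  proof (intro conjI)
    have "smooth \<Phi>" unfolding \<Phi>_def[abs_def]
      using t1 t2 by (intro smooth_intros) (auto simp: torus_test_function_def)
    then have "smooth (\<lambda>p. \<theta> (snd p + 0) *\<^sub>R \<Phi> (fst p + 0))"
      by (intro smooth_scaleR smooth_affine[OF bounded_linear_snd \<theta>(1)] smooth_affine[OF bounded_linear_fst])
    then show "smooth \<phi>" by (simp add: \<phi>_def[abs_def])
    show "\<forall>x t j. \<phi> (x + axis j 1, t) = \<phi> (x, t)"
      using t1 t2 by (simp add: \<phi>_def \<Phi>_def torus_test_function_def)
    show "\<exists>K. compact K \<and> K \<subseteq> {0..<T} \<and> (\<forall>x. \<forall>t\<in>{0..<T} - K. \<phi> (x, t) = 0)"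
      using \<theta>(2) by (auto simp: \<phi>_def)
  qed
  then have eq: "(LINT t|lebesgue_on {0..<T}. LINT x|\<mu>.
           b (x, t) \<bullet> vector_derivative (\<lambda>s. \<phi> (x, s)) (at t) +
           (outer (b (x, t)) (u (x, t)) - outer (u (x, t)) (b (x, t)))
             \<bullet> jacobian (\<lambda>y. \<phi> (y, t)) (at x)) +
        (LINT x|\<mu>. b0 x \<bullet> \<phi> (x, 0)) = 0"
    using assms(3) by (simp add: weak_induction_equation_def)
  have vd: "vector_derivative (\<lambda>s. \<phi> (x, s)) (at t) = deriv \<theta> t *\<^sub>R \<Phi> x" for x t
  proof (rule vector_derivative_at)
    have "(\<theta> has_real_derivative deriv \<theta> t) (at t)"
      using smooth_has_derivative[OF \<theta>(1), of t]
      by (metis DERIV_deriv_iff_real_differentiable differentiable_def)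
    then have "(\<theta> has_vector_derivative deriv \<theta> t) (at t)"
      by (simp add: has_real_derivative_iff_has_vector_derivative)
    from has_vector_derivative_scaleR[OF this[unfolded has_real_derivative_iff_has_vector_derivative[symmetric]]
        has_vector_derivative_const[of "\<Phi> x"]]
    show "((\<lambda>s. \<phi> (x, s)) has_vector_derivative deriv \<theta> t *\<^sub>R \<Phi> x) (at t)" by (simp add: \<phi>_def)
  qed
  have jac: "jacobian (\<lambda>y. \<phi> (y, t)) (at x) $ i $ j = \<theta> t * (if i = 1 then partial j \<phi>1 x else partial j \<phi>2 x)"
    for x t i j
  proof -
    have "((\<lambda>y. \<phi> (y, t)) has_derivative (\<lambda>h. \<theta> t *\<^sub>R (frechet_derivative \<phi>1 (at x) h *\<^sub>R axis 1 1 +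
        frechet_derivative \<phi>2 (at x) h *\<^sub>R axis 2 1))) (at x)"
      unfolding \<phi>_def \<Phi>_def fst_conv snd_conv
      by (intro has_derivative_scaleR_right has_derivative_add has_derivative_scaleR_left
          torus_test_function_has_derivative t1 t2)
    from frechet_derivative_at[OF this, symmetric] show ?thesis
      using exhaust_2[of i] by (auto simp: jacobian_def matrix_def axis_def)
  qed
  let ?W = "\<lambda>t. flux (\<lambda>x. b (x, t) $ 1) (\<lambda>x. b (x, t) $ 2) (\<lambda>x. u (x, t) $ 1) (\<lambda>x. u (x, t) $ 2)"
  have integrand: "b (x, t) \<bullet> vector_derivative (\<lambda>s. \<phi> (x, s)) (at t) +
           (outer (b (x, t)) (u (x, t)) - outer (u (x, t)) (b (x, t))) \<bullet> jacobian (\<lambda>y. \<phi> (y, t)) (at x)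
    = (b (x, t) $ 1 * \<phi>1 x + b (x, t) $ 2 * \<phi>2 x) * deriv \<theta> t + ?W t x * (partial 2 \<phi>1 x - partial 1 \<phi>2 x) * \<theta> t" for x t
    by (simp add: vd inner_vec_def sum_2 jac outer_def flux_def comp algebra_simps)
  have inner: "(LINT x|\<mu>. b (x, t) \<bullet> vector_derivative (\<lambda>s. \<phi> (x, s)) (at t) +
           (outer (b (x, t)) (u (x, t)) - outer (u (x, t)) (b (x, t))) \<bullet> jacobian (\<lambda>y. \<phi> (y, t)) (at x))
    = (LINT x|\<mu>. b (x, t) $ 1 * \<phi>1 x + b (x, t) $ 2 * \<phi>2 x) * deriv \<theta> t +
      (LINT x|\<mu>. ?W t x * (partial 2 \<phi>1 x - partial 1 \<phi>2 x)) * \<theta> t" if t: "t \<in> {0..<T}" for t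
  proof -
    note bs = L2_torus_component[OF Cw_L2_slice[OF b t]] and us = L2_torus_component[OF Cw_L2_slice[OF u t]]
    have i1: "integrable \<mu> (\<lambda>x. b (x, t) $ 1 * \<phi>1 x + b (x, t) $ 2 * \<phi>2 x)"
      by (intro Bochner_Integration.integrable_add sq_integrable_mult bs sq_integrable_test_function t1 t2)
    have i2: "integrable \<mu> (\<lambda>x. ?W t x * (partial 2 \<phi>1 x - partial 1 \<phi>2 x))"
      by (intro integrable_mult_test_function flux_integrable bs us torus_test_function_diff torus_test_function_partial t1 t2)
    show ?thesis unfolding integrand using i1 i2
      by (subst Bochner_Integration.integral_add) (simp_all only: integrable_mult_left integral_mult_left_zero)
  qed
  have "(LINT t|lebesgue_on {0..<T}. LINT x|\<mu>. b (x, t) \<bullet> vector_derivative (\<lambda>s. \<phi> (x, s)) (at t) +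
           (outer (b (x, t)) (u (x, t)) - outer (u (x, t)) (b (x, t))) \<bullet> jacobian (\<lambda>y. \<phi> (y, t)) (at x))
    = (LINT t|lebesgue_on {0..<T}. (LINT x|\<mu>. b (x, t) $ 1 * \<phi>1 x + b (x, t) $ 2 * \<phi>2 x) * deriv \<theta> t +
      (LINT x|\<mu>. ?W t x * (partial 2 \<phi>1 x - partial 1 \<phi>2 x)) * \<theta> t)"
    by (rule Bochner_Integration.integral_cong[OF refl]) (rule inner, simp)
  moreover have "(LINT x|\<mu>. b0 x \<bullet> \<phi> (x, 0)) = (LINT x|\<mu>. (b0 x $ 1 * \<phi>1 x + b0 x $ 2 * \<phi>2 x) * \<theta> 0)"
    by (rule Bochner_Integration.integral_cong) (simp_all add: \<phi>_def inner_real2 comp algebra_simps)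
  then have "(LINT x|\<mu>. b0 x \<bullet> \<phi> (x, 0)) = (LINT x|\<mu>. b0 x $ 1 * \<phi>1 x + b0 x $ 2 * \<phi>2 x) * \<theta> 0"
    by simp
  ultimately show ?thesis using eq by simp
qed

theorem corollary1p2:
  fixes T :: real
    and u0 b0 :: "real ^ 2 \<Rightarrow> real ^ 2"
    and u b :: "(real ^ 2) \<times> real \<Rightarrow> real ^ 2"
  assumes "T > 0"
    and "u0 \<in> L2_torus" and "b0 \<in> L2_torus"
    and "weakly_div_free u0" and "weakly_div_free b0"
    and "u \<in> Cw_L2 T" and "b \<in> Cw_L2 T"
    and "weak_induction_equation T b0 u b"
    and "spacetime_div_free T u" and "spacetime_div_free T b"
    and "AE x in lebesgue_on torus. u (x, 0) = u0 x"
    and "AE x in lebesgue_on torus. b (x, 0) = b0 x"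
    and "AE t in lebesgue_on {0..<T}. (LINT x|lebesgue_on torus. u (x, t)) = 0 \<and>
           (LINT x|lebesgue_on torus. b (x, t)) = 0"
  shows "(\<forall>t\<in>{0..<T}. AE x in lebesgue_on torus. b (x, t) = 0) \<or>
    (\<exists>C>0. \<forall>t\<in>{0..<T}. (LINT x|lebesgue_on torus. (norm (b (x, t)))\<^sup>2) \<ge> C)"
proof -
  note u = \<open>u \<in> Cw_L2 T\<close> and b = \<open>b \<in> Cw_L2 T\<close>
  obtain Mu where Mu: "\<And>j. weak_path T Mu (\<lambda>t x. u (x, t) $ j)" using Cw_L2_weak_path[OF u] by blast
  obtain Mb where Mb: "\<And>j. weak_path T Mb (\<lambda>t x. b (x, t) $ j)" using Cw_L2_weak_path[OF b] by blast
  define M where "M = max Mu Mb"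
  have pu: "weak_path T M (\<lambda>t x. u (x, t) $ j)" and pb: "weak_path T M (\<lambda>t x. b (x, t) $ j)" for j
    using weak_path_mono[OF Mu] weak_path_mono[OF Mb] by (simp_all add: M_def)
  have mean: "AE t in lebesgue_on {0..<T}. (LINT x|\<mu>. b (x, t)) = 0"
    using assms(13) by eventually_elim simp
  interpret induction_flow T M "\<lambda>t x. b (x, t) $ 1" "\<lambda>t x. b (x, t) $ 2" "\<lambda>t x. u (x, t) $ 1" "\<lambda>t x. u (x, t) $ 2"
  proof
    fix \<phi>1 \<phi>2 :: "real ^ 2 \<Rightarrow> real" and \<theta> :: "real \<Rightarrow> real"
    assume t: "torus_test_function \<phi>1" "torus_test_function \<phi>2" "smooth \<theta>"
      "\<exists>K. compact K \<and> K \<subseteq> {0..<T} \<and> (\<forall>t\<in>{0..<T} - K. \<theta> t = 0)"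
    have 0: "0 \<in> {0..<T}" using \<open>T > 0\<close> by simp
    \<comment> \<open>The locale takes the slice at time 0 as initial datum, which agrees with
      \<open>b0\<close> only almost everywhere.\<close>
    have "(LINT x|\<mu>. b0 x $ 1 * \<phi>1 x + b0 x $ 2 * \<phi>2 x) = (LINT x|\<mu>. b (x, 0) $ 1 * \<phi>1 x + b (x, 0) $ 2 * \<phi>2 x)"
    proof (rule integral_cong_AE)
      show "AE x in \<mu>. b0 x $ 1 * \<phi>1 x + b0 x $ 2 * \<phi>2 x = b (x, 0) $ 1 * \<phi>1 x + b (x, 0) $ 2 * \<phi>2 x"
        using assms(12) by eventually_elim simp
      have m: "(\<lambda>x. f x $ j * \<psi> x) \<in> borel_measurable \<mu>" if "f \<in> L2_torus" "torus_test_function \<psi>" for f j \<psi>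
        using L2_torus_component[OF that(1), of j] torus_test_function_measurable[OF that(2)]
        by (intro borel_measurable_times) (simp_all add: sq_integrable_def)
      show "(\<lambda>x. b0 x $ 1 * \<phi>1 x + b0 x $ 2 * \<phi>2 x) \<in> borel_measurable \<mu>"
        by (intro borel_measurable_add m t assms(3))
      show "(\<lambda>x. b (x, 0) $ 1 * \<phi>1 x + b (x, 0) $ 2 * \<phi>2 x) \<in> borel_measurable \<mu>"
        by (intro borel_measurable_add m[OF Cw_L2_slice[OF b 0]] t)
    qed
    with weak_induction_equation_separated[OF u b assms(8) t]
    show "(LINT t|lebesgue_on {0..<T}. (LINT x|\<mu>. b (x, t) $ 1 * \<phi>1 x + b (x, t) $ 2 * \<phi>2 x) * deriv \<theta> t +
        (LINT x|\<mu>. flux (\<lambda>x. b (x, t) $ 1) (\<lambda>x. b (x, t) $ 2) (\<lambda>x. u (x, t) $ 1) (\<lambda>x. u (x, t) $ 2) x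
           * (partial 2 \<phi>1 x - partial 1 \<phi>2 x)) * \<theta> t) +
      (LINT x|\<mu>. b (x, 0) $ 1 * \<phi>1 x + b (x, 0) $ 2 * \<phi>2 x) * \<theta> 0 = 0"
      by simp
  qed (use \<open>T > 0\<close> pu pb mean_zero_all_times[OF b mean] spacetime_div_free_imp_div_free[OF u assms(9)]
      spacetime_div_free_imp_div_free[OF b assms(10)] in blast)+
  have norm_eq: "(LINT x|\<mu>. (norm (b (x, t)))\<^sup>2) = (LINT x|\<mu>. (b (x, t) $ 1)\<^sup>2) + (LINT x|\<mu>. (b (x, t) $ 2)\<^sup>2)"
    if "t \<in> {0..<T}" for t
    using sq(1)[OF that] sq(2)[OF that] by (simp add: norm_real2_squared sq_integrable_def)
  from dichotomy show ?thesis
  proof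
    assume *: "\<forall>t\<in>{0..<T}. (AE x in \<mu>. b (x, t) $ 1 = 0) \<and> (AE x in \<mu>. b (x, t) $ 2 = 0)"
    have "AE x in \<mu>. b (x, t) = 0" if "t \<in> {0..<T}" for t
    proof -
      have "AE x in \<mu>. b (x, t) $ 1 = 0" "AE x in \<mu>. b (x, t) $ 2 = 0" using * that by auto
      then show ?thesis by eventually_elim (simp add: vec_eq_iff forall_2)
    qed
    then show ?thesis by blast
  next
    assume "\<exists>C>0. \<forall>t\<in>{0..<T}. C \<le> (LINT x|\<mu>. (b (x, t) $ 1)\<^sup>2) + (LINT x|\<mu>. (b (x, t) $ 2)\<^sup>2)"
    then obtain C where C: "C > 0" "\<And>t. t \<in> {0..<T} \<Longrightarrow> C \<le> (LINT x|\<mu>. (norm (b (x, t)))\<^sup>2)"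
      by (auto simp only: norm_eq)
    then show ?thesis by blast
  qed
qed

end
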